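(* Let $f=f(x,u,p,q)$ be smooth and assume that the third-order ODE $u'''=f(x,u,u',u'')$ is equivalent to $\bar u'''=0$ under a contact transformation with nonvanishing Jacobian. Then a linearizing contact transformation $$\bar x=\varphi(x,u,p),\qquad \bar u=\psi(x,u,p),\qquad \bar p=\chi(x,u,p)$$ between $u'''=f(x,u,u',u'')$ and $\bar u'''=0$ can be obtained by the following procedure. That is, there exist (locally) functions $v(x,u,p)$, $w(x,u,p,q)$, $a_1(x,u,p)$, $a_2(x,u,p,q)$, $a_3(x,u,p,q)$, $a_7(x,u,p)$, $a_8(x,u,p)$, $r_2(x,u,p,q)$, $\eta(x,u,p,q)$, $\chi(x,u,p)$, $\varphi(x,u,p)$, $\psi(x,u,p)$ satisfying all of Steps 1–10 below, with $\chi=\hat D_x\psi/\hat D_x\varphi$ and $\eta=\hat D_x\chi/\hat D_x\varphi$, and for any such functions $(\varphi,\psi,\chi)$ is a contact transformation between the two ODEs. Step 1. $(v,w)$, with $v\ne0$, solves the linear system $\hat D_xv=w$, $\ \hat D_xw+\tfrac13I_1w=-\tfrac14I_2v$. Step 2. $a_3\neq 0$ solves the linear system $\hat D_xa_3=\tfrac13I_1a_3$, $\ v\,a_{3,p}+\left(2w-\tfrac13vI_1\right)a_{3,q}=\left(\tfrac16vI_{1,q}-2v_p\right)a_3$. Step 3. $a_1=\dfrac1{v^2}$, $\ a_2=-2a_3\dfrac wv$. Step 4. $a_8=\left(\dfrac{a_1}{a_3}\right)_q$, $\ a_7=\left(\dfrac{a_1}{a_3}\right)_p-\hat D_xa_8$.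 Step 5. $r_2=\dfrac{a_3}{a_1^2}\left(-\tfrac13I_1a_7+\tfrac23\dfrac{a_2a_8}{a_3}I_1-\tfrac16\dfrac{a_1a_2}{a_3^2}I_{1,q}-\hat D_xa_7\right)$. Step 6. The functions from Steps 1–5 satisfy $$\begin{aligned}\hat D_xr_2={}&\tfrac13I_1r_2+\frac{a_2^2a_7}{2a_1^2a_3}-\frac{a_2^2a_8}{3a_1^2a_3}I_1+\frac{a_2^2}{12a_1a_3^2}I_{1,q}-\frac{a_3a_8}{2a_1^2}\hat D_xI_2+\frac{a_3a_7}{a_1^2}\left(\tfrac12I_2-\tfrac13\hat D_xI_1\right)\\&+\frac{2a_2a_8}{3a_1^2}\hat D_xI_1-\frac1{a_1}I_5+\frac{a_2}{a_1a_3}I_6,\end{aligned}$$ and all remaining equations of the full auxiliary system (defined in the context). Step 7. $\eta$ solves the linear system $\hat D_x\eta=0$, $\ \eta_u=\dfrac{a_2^2}{2a_1}+\dfrac{a_3^2}{2a_1}I_2$, $\ \eta_p=\dfrac{a_2a_3}{a_1}+\dfrac{a_3^2}{3a_1}I_1$, $\ \eta_q=\dfrac{a_3^2}{a_1}$. Step 8. $\chi$ solves the linear system $\hat D_x\chi=\dfrac{a_1}{a_3}\eta$, $\ \chi_u=a_2+a_7\eta$, $\ \chi_p=a_3+a_8\eta$. Step 9. $\varphi$ solves the linear system $\hat D_x\varphi=\dfrac{a_1}{a_3}$, $\ \varphi_u=a_7$, $\ \varphi_p=a_8$. Step 10. $\psi$ solves the linear system $a_7\hat D_x\psi=\dfrac{a_1}{a_3}(\psi_u-a_1)$,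 $\ \psi_x=\chi\varphi_x-p\,a_1$, $\ \psi_p=a_8\chi$.
   Context: Everything is local and smooth. $(x,u,p,q)$, $p=u'$, $q=u''$, are coordinates on the second-order jet space $M=\mathbf J^2$. Subscripts (after a comma when the symbol already carries an index, e.g. $I_{1,q}=\partial I_1/\partial q$, $I_{2,uq}=\partial^2I_2/\partial u\partial q$) denote partial derivatives. A contact transformation is a local map $\bar x=\varphi(x,u,p)$, $\bar u=\psi(x,u,p)$, $\bar p=\chi(x,u,p)$ with nonvanishing Jacobian and $d\bar u-\bar p\,d\bar x=\lambda(du-p\,dx)$ for some function $\lambda(x,u,p)$; two third-order ODEs are equivalent under it if its prolongation maps one to the other. Notation: $$\hat D_x=\partial_x+p\,\partial_u+q\,\partial_p+f\,\partial_q,\quad I_1=-f_q,\quad I_2=-\tfrac29I_1^2-f_p-\tfrac13\hat D_xI_1,$$ $$I_5=-\tfrac23I_{1,u}+\tfrac12I_{2,p}-\tfrac16I_1I_{2,q}+\tfrac14I_2I_{1,q},\quad I_6=-\tfrac13I_{1,p}+\tfrac12I_{2,q}+\tfrac1{18}I_1I_{1,q}.$$ The full auxiliary system. Let $\omega^1=du-p\,dx$, $\omega^2=dp-q\,dx$, $\omega^3=dq-f\,dx$, $\omega^4=dx$. On the ten-dimensional space with coordinates $(x,u,p,q,a_1,a_2,a_3,a_7,a_8,r_2)$, $a_1a_3\neq0$, put $$\theta^1=a_1\omega^1,\quad \theta^2=a_2\omega^1+a_3\omega^2,\quad \theta^3=\left(\tfrac{a_2^2}{2a_1}+\tfrac{a_3^2}{2a_1}I_2\right)\omega^1+\left(\tfrac{a_2a_3}{a_1}+\tfrac{a_3^2}{3a_1}I_1\right)\omega^2+\tfrac{a_3^2}{a_1}\omega^3,\quad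 \theta^4=a_7\omega^1+a_8\omega^2+\tfrac{a_1}{a_3}\omega^4 .$$ With $\Delta=a_2a_8-a_3a_7$, let $$\Pi=\begin{pmatrix}\frac1{a_1}&0&0&0&0\\0&\frac1{a_1}&-\frac{a_2}{a_1a_3}&0&0\\0&0&\frac1{a_3}&0&0\\\frac{\Delta}{a_1^2a_3}&0&-\frac{\Delta}{a_1a_3^2}&\frac1{a_1}&-\frac{a_2}{a_1a_3}\\-\frac{a_8}{a_1a_3}&0&\frac{a_8}{a_3^2}&0&\frac1{a_3}\end{pmatrix},$$ $$\Lambda=\begin{pmatrix}-\frac{A+2B}{6a_1^2a_3}&\frac{a_7}{a_1}&0&-\frac{a_2}{a_1}\\\frac{H}{6a_1^3a_3}&-\frac{A+B+C}{6a_1^2a_3}&-\frac{\Delta}{a_1a_3}&\frac{Q}{6a_1^2}\\-\frac{A+B}{6a_1^2a_3}&-\frac{\Delta}{a_1a_3}+\frac{I_1a_8}{3a_1}-\frac{I_{1,q}}{6a_3}&\frac{a_8}{a_3}&-\frac{a_3I_1}{3a_1}\\0&\frac{a_8C+6a_3a_7\Delta}{6a_1^2a_3^2}&-\frac{a_8\Delta}{a_1a_3^2}&0\\0&0&\frac{a_8^2}{a_3^2}&\frac{a_7}{a_1}+\frac{I_{1,q}}{6a_3}-\frac{2I_1a_8}{3a_1}\end{pmatrix},\qquad R=\begin{pmatrix} 2r_2&0&0&0\\ 0&r_2&0&0\\ {r_2}&0&0&0\\ {r_1}&r_3&0&r_2\\ {r_3}&r_4&0&0\end{pmatrix},$$ where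 $$Q=2I_1a_2a_3-3I_2a_3^2-3a_2^2,\quad A=2(2I_1a_3-3a_2)\Delta+a_1(3a_3I_{2,q}-2a_2I_{1,q}),\quad B=a_8Q+6a_2\Delta,\quad C=a_8Q-2I_1a_3\Delta,$$ $$H=3a_3^3a_8\hat D_xI_2+2I_1I_2a_3^3a_8+6a_3^3a_8f_u+a_1a_3^2(I_1I_{2,q}-I_2I_{1,q}-3I_{2,p}+2I_{1,u})+3a_1a_2a_3I_{2,q}-a_1a_2^2I_{1,q}+\Delta Q,$$ $$\begin{aligned}r_1={}&\tfrac{a_2^2a_7a_8}{2a_1^3a_3}-\tfrac{a_2^3a_8^2}{2a_1^3a_3^2}-\left(\tfrac{a_2a_7a_8}{a_1^3}-\tfrac{2a_2^2a_8^2}{3a_1^3a_3}-\tfrac{a_3a_7^2}{3a_1^3}\right)I_1-\left(\tfrac{a_2a_8^2}{2a_1^3}-\tfrac{a_3a_7a_8}{2a_1^3}\right)I_2\\&-\left(\tfrac{a_2^2a_8}{2a_1^2a_3^2}-\tfrac{a_2a_7}{3a_1^2a_3}\right)I_{1,q}-\left(\tfrac{a_7}{2a_1^2}-\tfrac{a_2a_8}{a_1^2a_3}\right)I_{2,q}+\tfrac{a_2^2}{6a_1a_3^3}I_{1,qq}-\tfrac{a_2}{2a_1a_3^2}I_{2,qq}\\&+\tfrac{a_8}{6a_1^2}\left(-3I_{2,p}+2I_{1,u}+I_1I_{2,q}-I_2I_{1,q}\right)+\tfrac1{6a_1a_3}\left(I_2I_{1,qq}-I_1I_{2,qq}-2I_{1,uq}+3I_{2,uq}\right),\end{aligned}$$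 $$\begin{aligned}r_3={}&-\tfrac{a_7^2}{2a_1^2}+\tfrac{a_2^2a_8^2}{2a_1^2a_3^2}-\left(\tfrac{2a_2a_8^2}{3a_1^2a_3}-\tfrac{2a_7a_8}{3a_1^2}\right)I_1-\left(\tfrac{a_7}{6a_1a_3}-\tfrac{a_2a_8}{2a_1a_3^2}\right)I_{1,q}-\tfrac{a_8}{2a_1a_3}I_{2,q}-\tfrac{a_2}{6a_3^3}I_{1,qq}+\tfrac1{4a_3^2}I_{2,qq},\end{aligned}$$ $$r_4=-\tfrac{a_2a_8^2}{a_1a_3^2}+\tfrac{2a_8^2}{3a_1a_3}I_1-\tfrac{a_8}{2a_3^2}I_{1,q}+\tfrac{a_1}{6a_3^3}I_{1,qq}.$$ Define one-forms $\pi'^1,\dots,\pi'^5$ by $(\pi'^1,\dots,\pi'^5)^T=\Pi\,(da_1,da_2,da_3,da_7,da_8)^T+(\Lambda+R)(\theta^1,\theta^2,\theta^3,\theta^4)^T$, and the vector field $$\begin{aligned}\partial_{\theta^4}={}&\tfrac{a_3}{a_1}\hat D_x+a_2\partial_{a_1}+\left(\tfrac{a_3^2}{2a_1}I_2+\tfrac{a_2^2}{2a_1}\right)\partial_{a_2}+\tfrac{a_3^2}{3a_1}I_1\partial_{a_3}+\left(\tfrac{2a_2a_8}{3a_1}I_1-\tfrac{a_3a_7}{3a_1}I_1-a_1r_2-\tfrac{a_2}{6a_3}I_{1,q}\right)\partial_{a_7}\\&+\left(\tfrac{a_3a_8}{3a_1}I_1-\tfrac16I_{1,q}+\tfrac{a_2a_8}{a_1}-\tfrac{a_3a_7}{a_1}\right)\partial_{a_8}+\Big(\tfrac{a_3r_2}{3a_1}I_1+\tfrac{a_2^2a_7}{2a_1^3}-\tfrac{a_2^2a_8}{3a_1^3}I_1+\tfrac{a_2^2}{12a_1^2a_3}I_{1,q}-\tfrac{a_3^2a_8}{2a_1^3}\hat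 D_xI_2\\&+\tfrac{a_3^2a_7}{a_1^3}\left(\tfrac12I_2-\tfrac13\hat D_xI_1\right)+\tfrac{2a_2a_3a_8}{3a_1^3}\hat D_xI_1-\tfrac{a_3}{a_1^2}I_5+\tfrac{a_2}{a_1^2}I_6\Big)\partial_{r_2}.\end{aligned}$$ Let $\rho'^2$ denote the one-form (the superscript is an index) obtained as minus the interior product of $\partial_{\theta^4}$ with $d\pi'^4$. It has the form $\rho'^2=\boldsymbol\beta\,(da_1,da_2,da_3,da_7,da_8)^T+dr_2+\sum_{i=1}^4s_i\theta^i$, where $\boldsymbol\beta=(\beta_1,\dots,\beta_5)$ with $$\beta_1=\tfrac{r_2}{a_1}-\tfrac{a_2^2a_8}{2a_1^3a_3}+\left(-\tfrac{a_3a_7}{3a_1^3}+\tfrac{2a_2a_8}{3a_1^3}\right)I_1-\tfrac{a_3a_8}{2a_1^3}I_2,\quad \beta_2=\tfrac{a_7}{a_1^2}-\tfrac{2a_8}{3a_1^2}I_1+\tfrac{I_{1,q}}{6a_1a_3},$$ $$\beta_3=\tfrac{a_2^2a_8}{2a_1^2a_3^2}-\tfrac{a_2a_7}{a_1^2a_3}+\tfrac{a_7}{3a_1^2}I_1+\tfrac{a_8}{2a_1^2}I_2-\tfrac{a_2}{6a_1a_3^2}I_{1,q},\quad \beta_4=\tfrac{a_3}{3a_1^2}I_1,\quad \beta_5=\tfrac{a_2^2}{2a_1^2a_3}-\tfrac{2a_2}{3a_1^2}I_1+\tfrac{a_3}{2a_1^2}I_2;$$ this defines the functions $s_1,\dots,s_4$.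 For functions $a_1,a_2,a_3,a_7,a_8,r_2$ on $M$, define the operators on $M$ $$\mathcal D_1=\tfrac{\Delta}{a_1^2}\hat D_x+\tfrac1{a_1}\partial_u-\tfrac{a_2}{a_1a_3}\partial_p+\tfrac{2a_2a_3I_1-3a_3^2I_2+3a_2^2}{6a_1a_3^2}\partial_q,\quad \mathcal D_2=-\tfrac{a_8}{a_1}\hat D_x+\tfrac1{a_3}\partial_p-\tfrac{a_3I_1+3a_2}{3a_3^2}\partial_q,\quad \mathcal D_3=\tfrac{a_1}{a_3^2}\partial_q,\quad \mathcal D_4=\tfrac{a_3}{a_1}\hat D_x.$$ The full auxiliary system is the first-order PDE system $$\big(\mathcal D_j(y_i)\big)_{1\le i\le6,\,1\le j\le4}=-\begin{pmatrix}\Pi&0\\\boldsymbol\beta&1\end{pmatrix}^{-1}\begin{pmatrix}\Lambda+R\\ s_1\ \ s_2\ \ s_3\ \ s_4\end{pmatrix},\qquad (y_1,\dots,y_6)=(a_1,a_2,a_3,a_7,a_8,r_2),$$ where the right-hand side is evaluated on these functions of $(x,u,p,q)$.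
   Formalization: Two misprints in the full auxiliary system (Step 6) are corrected: the row 4, column 2 entry of Λ gets a minus sign, and the last term of r_1 has 3I_{2,pq} instead of 3I_{2,uq}; as printed, existence fails, e.g. for f=-3pq/u. *)

theory Defs
  imports "HOL-Analysis.Analysis"
begin

text \<open>
  Points of the jet space \<open>J\<^sup>2\<close> are vectors \<open>(x, u, p, q) :: real^4\<close> and points of \<open>J\<^sup>1\<close> are vectors
  \<open>(x, u, p) :: real^3\<close>. A point of the ten-dimensional space with coordinates
  \<open>(x, u, p, q, a\<^sub>1, a\<^sub>2, a\<^sub>3, a\<^sub>7, a\<^sub>8, r\<^sub>2)\<close> is a pair \<open>(z, y) :: (real^4) \<times> (real^6)\<close>.
  A one-form on a space \<open>'e\<close> is a function \<open>'e \<Rightarrow> 'e \<Rightarrow> real\<close> taking a base point and a tangent vector.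
\<close>


subsection \<open>Calculus on jet spaces\<close>

definition pd :: "'n::finite \<Rightarrow> (real^'n \<Rightarrow> real) \<Rightarrow> real^'n \<Rightarrow> real" where
  "pd i g z = frechet_derivative g (at z) (axis i 1)"

text \<open>Meant for open \<open>S\<close>: all iterated partial derivatives exist and are differentiable on \<open>S\<close>.\<close>

definition smooth_on :: "(real^'n::finite) set \<Rightarrow> (real^'n \<Rightarrow> real) \<Rightarrow> bool" where
  "smooth_on S g \<longleftrightarrow> (\<forall>is. \<forall>z\<in>S. foldr pd is g differentiable (at z))"

definition proj :: "real^4 \<Rightarrow> real^3" where
  "proj z = vector [z$1, z$2, z$3]"

definition lift :: "(real^3 \<Rightarrow> real) \<Rightarrow> real^4 \<Rightarrow> real" where
  "lift g = g \<circ> proj"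

text \<open>The total derivatives of functions on \<open>J\<^sup>1\<close> and on \<open>J\<^sup>2\<close>; in the latter, \<open>r\<close> stands for \<open>u'''\<close>.\<close>

definition total1 :: "(real^3 \<Rightarrow> real) \<Rightarrow> real^4 \<Rightarrow> real" where
  "total1 g z = pd 1 g (proj z) + z$3 * pd 2 g (proj z) + z$4 * pd 3 g (proj z)"

definition total2 :: "(real^4 \<Rightarrow> real) \<Rightarrow> real^4 \<Rightarrow> real \<Rightarrow> real" where
  "total2 g z r = pd 1 g z + z$3 * pd 2 g z + z$4 * pd 3 g z + r * pd 4 g z"

definition Dhat :: "(real^4 \<Rightarrow> real) \<Rightarrow> (real^4 \<Rightarrow> real) \<Rightarrow> real^4 \<Rightarrow> real" where
  "Dhat f g z = total2 g z (f z)"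

definition ext_deriv :: "('e::real_normed_vector \<Rightarrow> 'e \<Rightarrow> real) \<Rightarrow> 'e \<Rightarrow> 'e \<Rightarrow> 'e \<Rightarrow> real" where
  "ext_deriv \<omega> e X Y =
     frechet_derivative (\<lambda>e'. \<omega> e' Y) (at e) X - frechet_derivative (\<lambda>e'. \<omega> e' X) (at e) Y"


subsection \<open>Contact transformations and equivalence of third-order ODEs\<close>

definition contact_transformation ::
  "(real^3) set \<Rightarrow> (real^3 \<Rightarrow> real) \<Rightarrow> (real^3 \<Rightarrow> real) \<Rightarrow> (real^3 \<Rightarrow> real) \<Rightarrow> bool" where
  "contact_transformation V \<phi> \<psi> chi \<longleftrightarrow>
     open V \<and> smooth_on V \<phi> \<and> smooth_on V \<psi> \<and> smooth_on V chi \<and>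
     (\<forall>m\<in>V. det (matrix (frechet_derivative (\<lambda>m. vector [\<phi> m, \<psi> m, chi m] :: real^3) (at m))) \<noteq> 0) \<and>
     (\<exists>l :: real^3 \<Rightarrow> real. \<forall>m\<in>V. \<forall>Y.
        frechet_derivative \<psi> (at m) Y - chi m * frechet_derivative \<phi> (at m) Y
          = l m * (Y$2 - m$3 * Y$1))"

definition prolong_q :: "(real^3 \<Rightarrow> real) \<Rightarrow> (real^3 \<Rightarrow> real) \<Rightarrow> real^4 \<Rightarrow> real" where
  "prolong_q \<phi> chi z = total1 chi z / total1 \<phi> z"

definition prolong_r :: "(real^3 \<Rightarrow> real) \<Rightarrow> (real^3 \<Rightarrow> real) \<Rightarrow> real^4 \<Rightarrow> real \<Rightarrow> real" where
  "prolong_r \<phi> chi z r = total2 (prolong_q \<phi> chi) z r / total1 \<phi> z"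

text \<open>
  The prolongation to \<open>J\<^sup>3\<close>, defined where the total derivative of \<open>\<phi>\<close> does not vanish, carries the
  hypersurface \<open>u''' = f\<close> over \<open>U\<close> into \<open>u''' = g\<close>, and no other point over \<open>U\<close> is carried there.
\<close>

definition maps_ode_to ::
  "(real^4) set \<Rightarrow> (real^3 \<Rightarrow> real) \<Rightarrow> (real^3 \<Rightarrow> real) \<Rightarrow> (real^3 \<Rightarrow> real)
    \<Rightarrow> (real^4 \<Rightarrow> real) \<Rightarrow> (real^4 \<Rightarrow> real) \<Rightarrow> bool" where
  "maps_ode_to U \<phi> \<psi> chi f g \<longleftrightarrow>
     (\<forall>z\<in>U. total1 \<phi> z \<noteq> 0 \<and>
       (\<forall>r. r = f z \<longleftrightarrow>
          prolong_r \<phi> chi z r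
            = g (vector [\<phi> (proj z), \<psi> (proj z), chi (proj z), prolong_q \<phi> chi z])))"

definition linearizing_contact_transformation ::
  "(real^4) set \<Rightarrow> (real^4 \<Rightarrow> real) \<Rightarrow> (real^3 \<Rightarrow> real) \<Rightarrow> (real^3 \<Rightarrow> real) \<Rightarrow> (real^3 \<Rightarrow> real) \<Rightarrow> bool" where
  "linearizing_contact_transformation U f \<phi> \<psi> chi \<longleftrightarrow>
     contact_transformation (proj ` U) \<phi> \<psi> chi \<and> maps_ode_to U \<phi> \<psi> chi f (\<lambda>_. 0)"


subsection \<open>Invariants\<close>

definition I1 :: "(real^4 \<Rightarrow> real) \<Rightarrow> real^4 \<Rightarrow> real" where
  "I1 f z = - pd 4 f z"

definition I2 :: "(real^4 \<Rightarrow> real) \<Rightarrow> real^4 \<Rightarrow> real" where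
  "I2 f z = - (2/9) * (I1 f z)\<^sup>2 - pd 3 f z - (1/3) * Dhat f (I1 f) z"

definition I5 :: "(real^4 \<Rightarrow> real) \<Rightarrow> real^4 \<Rightarrow> real" where
  "I5 f z = - (2/3) * pd 2 (I1 f) z + (1/2) * pd 3 (I2 f) z - (1/6) * I1 f z * pd 4 (I2 f) z
            + (1/4) * I2 f z * pd 4 (I1 f) z"

definition I6 :: "(real^4 \<Rightarrow> real) \<Rightarrow> real^4 \<Rightarrow> real" where
  "I6 f z = - (1/3) * pd 3 (I1 f) z + (1/2) * pd 4 (I2 f) z + (1/18) * I1 f z * pd 4 (I1 f) z"


subsection \<open>The coframe and the matrices of the full auxiliary system\<close>

definition Theta :: "(real^4 \<Rightarrow> real) \<Rightarrow> (real^4) \<times> (real^6) \<Rightarrow> (real^4) \<times> (real^6) \<Rightarrow> real^4" where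
  "Theta f e Y =
     (let z = fst e; y = snd e; dz = fst Y;
          a1 = y$1; a2 = y$2; a3 = y$3; a7 = y$4; a8 = y$5;
          \<omega>1 = dz$2 - z$3 * dz$1; \<omega>2 = dz$3 - z$4 * dz$1; \<omega>3 = dz$4 - f z * dz$1; \<omega>4 = dz$1
      in vector
        [a1 * \<omega>1,
         a2 * \<omega>1 + a3 * \<omega>2,
         (a2^2 / (2*a1) + a3^2 / (2*a1) * I2 f z) * \<omega>1
           + (a2*a3 / a1 + a3^2 / (3*a1) * I1 f z) * \<omega>2 + a3^2 / a1 * \<omega>3,
         a7 * \<omega>1 + a8 * \<omega>2 + a1 / a3 * \<omega>4])"

definition Delta :: "real^6 \<Rightarrow> real" where
  "Delta y = y$2 * y$5 - y$3 * y$4"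

definition Pi_mat :: "real^6 \<Rightarrow> real^5^5" where
  "Pi_mat y =
     (let a1 = y$1; a2 = y$2; a3 = y$3; a7 = y$4; a8 = y$5; \<Delta> = Delta y
      in vector
        [vector [1/a1, 0, 0, 0, 0],
         vector [0, 1/a1, - (a2 / (a1*a3)), 0, 0],
         vector [0, 0, 1/a3, 0, 0],
         vector [\<Delta> / (a1^2*a3), 0, - (\<Delta> / (a1*a3^2)), 1/a1, - (a2 / (a1*a3))],
         vector [- (a8 / (a1*a3)), 0, a8 / a3^2, 0, 1/a3]])"

definition coeff_Q :: "(real^4 \<Rightarrow> real) \<Rightarrow> real^4 \<Rightarrow> real^6 \<Rightarrow> real" where
  "coeff_Q f z y =
     (let a2 = y$2; a3 = y$3
      in 2 * I1 f z * a2 * a3 - 3 * I2 f z * a3^2 - 3 * a2^2)"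

definition coeff_A :: "(real^4 \<Rightarrow> real) \<Rightarrow> real^4 \<Rightarrow> real^6 \<Rightarrow> real" where
  "coeff_A f z y =
     (let a1 = y$1; a2 = y$2; a3 = y$3
      in 2 * (2 * I1 f z * a3 - 3 * a2) * Delta y
         + a1 * (3 * a3 * pd 4 (I2 f) z - 2 * a2 * pd 4 (I1 f) z))"

definition coeff_B :: "(real^4 \<Rightarrow> real) \<Rightarrow> real^4 \<Rightarrow> real^6 \<Rightarrow> real" where
  "coeff_B f z y = (let a2 = y$2; a8 = y$5 in a8 * coeff_Q f z y + 6 * a2 * Delta y)"

definition coeff_C :: "(real^4 \<Rightarrow> real) \<Rightarrow> real^4 \<Rightarrow> real^6 \<Rightarrow> real" where
  "coeff_C f z y = (let a3 = y$3; a8 = y$5 in a8 * coeff_Q f z y - 2 * I1 f z * a3 * Delta y)"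

definition coeff_H :: "(real^4 \<Rightarrow> real) \<Rightarrow> real^4 \<Rightarrow> real^6 \<Rightarrow> real" where
  "coeff_H f z y =
     (let a1 = y$1; a2 = y$2; a3 = y$3; a8 = y$5; i1 = I1 f z; i2 = I2 f z
      in 3 * a3^3 * a8 * Dhat f (I2 f) z + 2 * i1 * i2 * a3^3 * a8 + 6 * a3^3 * a8 * pd 2 f z
         + a1 * a3^2 * (i1 * pd 4 (I2 f) z - i2 * pd 4 (I1 f) z - 3 * pd 3 (I2 f) z + 2 * pd 2 (I1 f) z)
         + 3 * a1 * a2 * a3 * pd 4 (I2 f) z - a1 * a2^2 * pd 4 (I1 f) z + Delta y * coeff_Q f z y)"

text \<open>
  The entry in row 4, column 2 carries a minus sign that is missing in the source. Only with it the
  identity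
  \<open>d\<theta>\<^sup>4 = \<pi>\<^sup>4 \<and> \<theta>\<^sup>1 + \<pi>\<^sup>5 \<and> \<theta>\<^sup>2 + (\<pi>\<^sup>1 - \<pi>\<^sup>3) \<and> \<theta>\<^sup>4\<close> holds for every \<open>f\<close>, where \<open>\<pi>\<^sup>i\<close> are
  the components of \<open>Pi_form\<close> below.
\<close>

definition Lambda_mat :: "(real^4 \<Rightarrow> real) \<Rightarrow> real^4 \<Rightarrow> real^6 \<Rightarrow> real^4^5" where
  "Lambda_mat f z y =
     (let a1 = y$1; a2 = y$2; a3 = y$3; a7 = y$4; a8 = y$5; \<Delta> = Delta y;
          i1 = I1 f z; i1q = pd 4 (I1 f) z;
          Q = coeff_Q f z y; A = coeff_A f z y; B = coeff_B f z y; C = coeff_C f z y; H = coeff_H f z y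
      in vector
        [vector [- ((A + 2*B) / (6*a1^2*a3)), a7/a1, 0, - (a2/a1)],
         vector [H / (6*a1^3*a3), - ((A + B + C) / (6*a1^2*a3)), - (\<Delta> / (a1*a3)), Q / (6*a1^2)],
         vector [- ((A + B) / (6*a1^2*a3)), - (\<Delta> / (a1*a3)) + i1*a8 / (3*a1) - i1q / (6*a3),
                 a8/a3, - (a3*i1 / (3*a1))],
         vector [0, - ((a8*C + 6*a3*a7*\<Delta>) / (6*a1^2*a3^2)), - (a8*\<Delta> / (a1*a3^2)), 0],
         vector [0, 0, a8^2 / a3^2, a7/a1 + i1q / (6*a3) - 2*i1*a8 / (3*a1)]])"

text \<open>
  The last second-order derivative in \<open>coeff_r1\<close> is \<open>I\<^sub>2\<^sub>,\<^sub>p\<^sub>q\<close>; the source prints \<open>I\<^sub>2\<^sub>,\<^sub>u\<^sub>q\<close>, which is not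
  homogeneous with its neighbours under scalings of \<open>x\<close> and makes the system unsolvable already for
  \<open>f = - 3 p q / u\<close>, which the point transformation \<open>(x, u) \<mapsto> (x, u\<^sup>2)\<close> linearizes.
\<close>

definition coeff_r1 :: "(real^4 \<Rightarrow> real) \<Rightarrow> real^4 \<Rightarrow> real^6 \<Rightarrow> real" where
  "coeff_r1 f z y =
     (let a1 = y$1; a2 = y$2; a3 = y$3; a7 = y$4; a8 = y$5;
          i1 = I1 f z; i2 = I2 f z; i1q = pd 4 (I1 f) z; i2q = pd 4 (I2 f) z;
          i1u = pd 2 (I1 f) z; i2p = pd 3 (I2 f) z;
          i1qq = pd 4 (pd 4 (I1 f)) z; i2qq = pd 4 (pd 4 (I2 f)) z;
          i1uq = pd 4 (pd 2 (I1 f)) z; i2pq = pd 4 (pd 3 (I2 f)) z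
      in a2^2*a7*a8 / (2*a1^3*a3) - a2^3*a8^2 / (2*a1^3*a3^2)
         - (a2*a7*a8 / a1^3 - 2*a2^2*a8^2 / (3*a1^3*a3) - a3*a7^2 / (3*a1^3)) * i1
         - (a2*a8^2 / (2*a1^3) - a3*a7*a8 / (2*a1^3)) * i2
         - (a2^2*a8 / (2*a1^2*a3^2) - a2*a7 / (3*a1^2*a3)) * i1q
         - (a7 / (2*a1^2) - a2*a8 / (a1^2*a3)) * i2q
         + a2^2 / (6*a1*a3^3) * i1qq - a2 / (2*a1*a3^2) * i2qq
         + a8 / (6*a1^2) * (- 3*i2p + 2*i1u + i1*i2q - i2*i1q)
         + 1 / (6*a1*a3) * (i2*i1qq - i1*i2qq - 2*i1uq + 3*i2pq))"

definition coeff_r3 :: "(real^4 \<Rightarrow> real) \<Rightarrow> real^4 \<Rightarrow> real^6 \<Rightarrow> real" where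
  "coeff_r3 f z y =
     (let a1 = y$1; a2 = y$2; a3 = y$3; a7 = y$4; a8 = y$5;
          i1 = I1 f z; i1q = pd 4 (I1 f) z; i2q = pd 4 (I2 f) z;
          i1qq = pd 4 (pd 4 (I1 f)) z; i2qq = pd 4 (pd 4 (I2 f)) z
      in - (a7^2 / (2*a1^2)) + a2^2*a8^2 / (2*a1^2*a3^2)
         - (2*a2*a8^2 / (3*a1^2*a3) - 2*a7*a8 / (3*a1^2)) * i1
         - (a7 / (6*a1*a3) - a2*a8 / (2*a1*a3^2)) * i1q
         - a8 / (2*a1*a3) * i2q - a2 / (6*a3^3) * i1qq + 1 / (4*a3^2) * i2qq)"

definition coeff_r4 :: "(real^4 \<Rightarrow> real) \<Rightarrow> real^4 \<Rightarrow> real^6 \<Rightarrow> real" where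
  "coeff_r4 f z y =
     (let a1 = y$1; a2 = y$2; a3 = y$3; a8 = y$5
      in - (a2*a8^2 / (a1*a3^2)) + 2*a8^2 / (3*a1*a3) * I1 f z - a8 / (2*a3^2) * pd 4 (I1 f) z
         + a1 / (6*a3^3) * pd 4 (pd 4 (I1 f)) z)"

definition R_mat :: "(real^4 \<Rightarrow> real) \<Rightarrow> real^4 \<Rightarrow> real^6 \<Rightarrow> real^4^5" where
  "R_mat f z y =
     (let r1 = coeff_r1 f z y; r2 = y$6; r3 = coeff_r3 f z y; r4 = coeff_r4 f z y
      in vector
        [vector [2*r2, 0, 0, 0],
         vector [0, r2, 0, 0],
         vector [r2, 0, 0, 0],
         vector [r1, r3, 0, r2],
         vector [r3, r4, 0, 0]])"

definition da :: "(real^4) \<times> (real^6) \<Rightarrow> real^5" where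
  "da Y = vector [snd Y $ 1, snd Y $ 2, snd Y $ 3, snd Y $ 4, snd Y $ 5]"

definition Pi_form :: "(real^4 \<Rightarrow> real) \<Rightarrow> (real^4) \<times> (real^6) \<Rightarrow> (real^4) \<times> (real^6) \<Rightarrow> real^5" where
  "Pi_form f e Y = Pi_mat (snd e) *v da Y
     + (Lambda_mat f (fst e) (snd e) + R_mat f (fst e) (snd e)) *v Theta f e Y"

definition d_theta4 :: "(real^4 \<Rightarrow> real) \<Rightarrow> (real^4) \<times> (real^6) \<Rightarrow> (real^4) \<times> (real^6)" where
  "d_theta4 f e =
     (let z = fst e; y = snd e;
          a1 = y$1; a2 = y$2; a3 = y$3; a7 = y$4; a8 = y$5; r2 = y$6;
          i1 = I1 f z; i2 = I2 f z; i1q = pd 4 (I1 f) z; Di1 = Dhat f (I1 f) z; Di2 = Dhat f (I2 f) z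
      in ((a3/a1) *\<^sub>R vector [1, z$3, z$4, f z],
          vector
            [a2,
             a3^2 / (2*a1) * i2 + a2^2 / (2*a1),
             a3^2 / (3*a1) * i1,
             2*a2*a8 / (3*a1) * i1 - a3*a7 / (3*a1) * i1 - a1*r2 - a2 / (6*a3) * i1q,
             a3*a8 / (3*a1) * i1 - (1/6) * i1q + a2*a8 / a1 - a3*a7 / a1,
             a3*r2 / (3*a1) * i1 + a2^2*a7 / (2*a1^3) - a2^2*a8 / (3*a1^3) * i1
               + a2^2 / (12*a1^2*a3) * i1q - a3^2*a8 / (2*a1^3) * Di2
               + a3^2*a7 / a1^3 * ((1/2) * i2 - (1/3) * Di1) + 2*a2*a3*a8 / (3*a1^3) * Di1
               - a3 / a1^2 * I5 f z + a2 / a1^2 * I6 f z]))"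

definition rho2_form :: "(real^4 \<Rightarrow> real) \<Rightarrow> (real^4) \<times> (real^6) \<Rightarrow> (real^4) \<times> (real^6) \<Rightarrow> real" where
  "rho2_form f e Y = - ext_deriv (\<lambda>e Y. Pi_form f e Y $ 4) e (d_theta4 f e) Y"

definition beta :: "(real^4 \<Rightarrow> real) \<Rightarrow> real^4 \<Rightarrow> real^6 \<Rightarrow> real^5" where
  "beta f z y =
     (let a1 = y$1; a2 = y$2; a3 = y$3; a7 = y$4; a8 = y$5; r2 = y$6;
          i1 = I1 f z; i2 = I2 f z; i1q = pd 4 (I1 f) z
      in vector
        [r2/a1 - a2^2*a8 / (2*a1^3*a3) + (- (a3*a7 / (3*a1^3)) + 2*a2*a8 / (3*a1^3)) * i1
           - a3*a8 / (2*a1^3) * i2,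
         a7 / a1^2 - 2*a8 / (3*a1^2) * i1 + i1q / (6*a1*a3),
         a2^2*a8 / (2*a1^2*a3^2) - a2*a7 / (a1^2*a3) + a7 / (3*a1^2) * i1 + a8 / (2*a1^2) * i2
           - a2 / (6*a1*a3^2) * i1q,
         a3 / (3*a1^2) * i1,
         a2^2 / (2*a1^2*a3) - 2*a2 / (3*a1^2) * i1 + a3 / (2*a1^2) * i2])"

definition coeff_s :: "(real^4 \<Rightarrow> real) \<Rightarrow> real^4 \<Rightarrow> real^6 \<Rightarrow> real^4" where
  "coeff_s f z y = (THE s. \<forall>Y. rho2_form f (z, y) Y
     = (\<Sum>i\<in>UNIV. beta f z y $ i * da Y $ i) + snd Y $ 6 + (\<Sum>i\<in>UNIV. s $ i * Theta f (z, y) Y $ i))"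

definition ops :: "(real^4 \<Rightarrow> real) \<Rightarrow> real^4 \<Rightarrow> real^6 \<Rightarrow> (real^4 \<Rightarrow> real) \<Rightarrow> real^4" where
  "ops f z y g =
     (let a1 = y$1; a2 = y$2; a3 = y$3; a8 = y$5; i1 = I1 f z; i2 = I2 f z
      in vector
        [Delta y / a1^2 * Dhat f g z + 1/a1 * pd 2 g z - a2 / (a1*a3) * pd 3 g z
           + (2*a2*a3*i1 - 3*a3^2*i2 + 3*a2^2) / (6*a1*a3^2) * pd 4 g z,
         - (a8/a1) * Dhat f g z + 1/a3 * pd 3 g z - (a3*i1 + 3*a2) / (3*a3^2) * pd 4 g z,
         a1 / a3^2 * pd 4 g z,
         a3/a1 * Dhat f g z])"

definition append_entry :: "real^5 \<Rightarrow> real \<Rightarrow> real^6" where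
  "append_entry r t = vector [r$1, r$2, r$3, r$4, r$5, t]"

definition lhs_mat :: "(real^4 \<Rightarrow> real) \<Rightarrow> real^4 \<Rightarrow> real^6 \<Rightarrow> real^6^6" where
  "lhs_mat f z y =
     (let P = Pi_mat y
      in vector [append_entry (P$1) 0, append_entry (P$2) 0, append_entry (P$3) 0,
                 append_entry (P$4) 0, append_entry (P$5) 0, append_entry (beta f z y) 1])"

definition rhs_mat :: "(real^4 \<Rightarrow> real) \<Rightarrow> real^4 \<Rightarrow> real^6 \<Rightarrow> real^4^6" where
  "rhs_mat f z y =
     (let M = Lambda_mat f z y + R_mat f z y
      in vector [M$1, M$2, M$3, M$4, M$5, coeff_s f z y])"

definition full_auxiliary_system ::
  "(real^4 \<Rightarrow> real) \<Rightarrow> (real^4) set \<Rightarrow> (real^4 \<Rightarrow> real^6) \<Rightarrow> bool" where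
  "full_auxiliary_system f U y \<longleftrightarrow>
     (\<forall>z\<in>U. (\<chi> i j. ops f z (y z) (\<lambda>z'. y z' $ i) $ j)
             = - (matrix_inv (lhs_mat f z (y z)) ** rhs_mat f z (y z)))"


subsection \<open>The linearization procedure\<close>

text \<open>All arguments are functions of \<open>(x, u, p, q)\<close>; those depending on \<open>(x, u, p)\<close> only are passed lifted.\<close>

definition linearization_steps ::
  "(real^4 \<Rightarrow> real) \<Rightarrow> (real^4) set \<Rightarrow>
   (real^4 \<Rightarrow> real) \<Rightarrow> (real^4 \<Rightarrow> real) \<Rightarrow> (real^4 \<Rightarrow> real) \<Rightarrow> (real^4 \<Rightarrow> real) \<Rightarrow> (real^4 \<Rightarrow> real) \<Rightarrow>
   (real^4 \<Rightarrow> real) \<Rightarrow> (real^4 \<Rightarrow> real) \<Rightarrow> (real^4 \<Rightarrow> real) \<Rightarrow> (real^4 \<Rightarrow> real) \<Rightarrow> (real^4 \<Rightarrow> real) \<Rightarrow>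
   (real^4 \<Rightarrow> real) \<Rightarrow> (real^4 \<Rightarrow> real) \<Rightarrow> bool" where
  "linearization_steps f U v w a1 a2 a3 a7 a8 r2 \<eta> chi \<phi> \<psi> \<longleftrightarrow>
   (\<forall>z\<in>U. v z \<noteq> 0 \<and> Dhat f v z = w z \<and>
      Dhat f w z + (1/3) * I1 f z * w z = - (1/4) * I2 f z * v z) \<and>
   (\<forall>z\<in>U. a3 z \<noteq> 0 \<and> Dhat f a3 z = (1/3) * I1 f z * a3 z \<and>
      v z * pd 3 a3 z + (2 * w z - (1/3) * v z * I1 f z) * pd 4 a3 z
        = ((1/6) * v z * pd 4 (I1 f) z - 2 * pd 3 v z) * a3 z) \<and>
   (\<forall>z\<in>U. a1 z = 1 / (v z)^2 \<and> a2 z = - 2 * a3 z * (w z / v z)) \<and>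
   (\<forall>z\<in>U. a8 z = pd 4 (\<lambda>z. a1 z / a3 z) z \<and> a7 z = pd 3 (\<lambda>z. a1 z / a3 z) z - Dhat f a8 z) \<and>
   (\<forall>z\<in>U. r2 z = a3 z / (a1 z)^2 *
      (- (1/3) * I1 f z * a7 z + (2/3) * (a2 z * a8 z / a3 z) * I1 f z
       - (1/6) * (a1 z * a2 z / (a3 z)^2) * pd 4 (I1 f) z - Dhat f a7 z)) \<and>
   (\<forall>z\<in>U. Dhat f r2 z =
      (1/3) * I1 f z * r2 z + (a2 z)^2 * a7 z / (2 * (a1 z)^2 * a3 z)
      - (a2 z)^2 * a8 z / (3 * (a1 z)^2 * a3 z) * I1 f z
      + (a2 z)^2 / (12 * a1 z * (a3 z)^2) * pd 4 (I1 f) z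
      - a3 z * a8 z / (2 * (a1 z)^2) * Dhat f (I2 f) z
      + a3 z * a7 z / (a1 z)^2 * ((1/2) * I2 f z - (1/3) * Dhat f (I1 f) z)
      + 2 * a2 z * a8 z / (3 * (a1 z)^2) * Dhat f (I1 f) z
      - 1 / a1 z * I5 f z + a2 z / (a1 z * a3 z) * I6 f z) \<and>
   full_auxiliary_system f U (\<lambda>z. vector [a1 z, a2 z, a3 z, a7 z, a8 z, r2 z]) \<and>
   (\<forall>z\<in>U. Dhat f \<eta> z = 0 \<and>
      pd 2 \<eta> z = (a2 z)^2 / (2 * a1 z) + (a3 z)^2 / (2 * a1 z) * I2 f z \<and>
      pd 3 \<eta> z = a2 z * a3 z / a1 z + (a3 z)^2 / (3 * a1 z) * I1 f z \<and>
      pd 4 \<eta> z = (a3 z)^2 / a1 z) \<and>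
   (\<forall>z\<in>U. Dhat f chi z = a1 z / a3 z * \<eta> z \<and>
      pd 2 chi z = a2 z + a7 z * \<eta> z \<and> pd 3 chi z = a3 z + a8 z * \<eta> z) \<and>
   (\<forall>z\<in>U. Dhat f \<phi> z = a1 z / a3 z \<and> pd 2 \<phi> z = a7 z \<and> pd 3 \<phi> z = a8 z) \<and>
   (\<forall>z\<in>U. a7 z * Dhat f \<psi> z = a1 z / a3 z * (pd 2 \<psi> z - a1 z) \<and>
      pd 1 \<psi> z = chi z * pd 1 \<phi> z - z$3 * a1 z \<and> pd 3 \<psi> z = a8 z * chi z) \<and>
   (\<forall>z\<in>U. chi z = Dhat f \<psi> z / Dhat f \<phi> z \<and> \<eta> z = Dhat f chi z / Dhat f \<phi> z)"

definition linearization_procedure ::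
  "(real^4 \<Rightarrow> real) \<Rightarrow> (real^4) set \<Rightarrow>
   (real^3 \<Rightarrow> real) \<Rightarrow> (real^4 \<Rightarrow> real) \<Rightarrow> (real^3 \<Rightarrow> real) \<Rightarrow> (real^4 \<Rightarrow> real) \<Rightarrow> (real^4 \<Rightarrow> real) \<Rightarrow>
   (real^3 \<Rightarrow> real) \<Rightarrow> (real^3 \<Rightarrow> real) \<Rightarrow> (real^4 \<Rightarrow> real) \<Rightarrow> (real^4 \<Rightarrow> real) \<Rightarrow> (real^3 \<Rightarrow> real) \<Rightarrow>
   (real^3 \<Rightarrow> real) \<Rightarrow> (real^3 \<Rightarrow> real) \<Rightarrow> bool" where
  "linearization_procedure f U v w a1 a2 a3 a7 a8 r2 \<eta> chi \<phi> \<psi> \<longleftrightarrow>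
     (\<forall>g\<in>{v, a1, a7, a8, chi, \<phi>, \<psi>}. smooth_on (proj ` U) g) \<and>
     (\<forall>g\<in>{w, a2, a3, r2, \<eta>}. smooth_on U g) \<and>
     linearization_steps f U (lift v) w (lift a1) a2 a3 (lift a7) (lift a8) r2 \<eta>
       (lift chi) (lift \<phi>) (lift \<psi>)"

end

theory Submission
  imports Defs
begin

text \<open>
  A contact transformation \<open>(\<phi>, \<psi>, \<chi>)\<close> that linearizes the equation, with \<open>\<eta> = D\<chi> / D\<phi>\<close> the transformed
  second derivative and \<open>D\<close> the total derivative \<open>Dhat f\<close>, pulls the coframe of the flat equation back to
  \<open>\<theta>\<^sup>1 = d\<psi> - \<chi> d\<phi>\<close>, \<open>\<theta>\<^sup>2 = d\<chi> - \<eta> d\<phi>\<close>, \<open>\<theta>\<^sup>3 = d\<eta>\<close>, \<open>\<theta>\<^sup>4 = d\<phi>\<close>. Comparison with the general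
  coframe \<open>Theta f\<close> dictates the coefficients: \<open>a\<^sub>1 = \<psi>\<^sub>u - \<chi> \<phi>\<^sub>u\<close>, \<open>a\<^sub>7 = \<phi>\<^sub>u\<close>, \<open>a\<^sub>8 = \<phi>\<^sub>p\<close>,
  \<open>a\<^sub>3 = a\<^sub>1 / D\<phi>\<close>, \<open>a\<^sub>2 = \<chi>\<^sub>u - a\<^sub>7 \<eta>\<close>. The steps of the procedure are these equations and consequences of
  their integrability.

  The steps suffice. The equations for \<open>\<phi>\<close>, \<open>\<psi>\<close>, \<open>\<chi>\<close> say that \<open>d\<psi> - \<chi> d\<phi> = a\<^sub>1 (du - p dx)\<close> and that the
  Jacobian determinant is \<open>a\<^sub>1\<^sup>2\<close>. The prolongation sends \<open>q\<close> to \<open>\<eta>\<close>, and since \<open>D\<eta> = 0\<close> it sends the value \<open>r\<close> of \<open>u'''\<close>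
  to \<open>(r - f) \<eta>\<^sub>q / D\<phi>\<close>, where \<open>\<eta>\<^sub>q = a\<^sub>3\<^sup>2 / a\<^sub>1\<close> has no zeros; so exactly the hypersurface \<open>r = f\<close> is mapped
  into the flat equation. This is \<open>linearization_procedure_linearizes\<close>.

  The steps can be carried out. In the locale \<open>linearized_ode\<close> a linearizing transformation is given, and
  every first derivative of \<open>a\<^sub>1, a\<^sub>2, a\<^sub>3, a\<^sub>7, a\<^sub>8\<close> is computed from the fact that partial derivatives
  commute with each other and commute with \<open>D\<close> up to \<open>[\<partial>\<^sub>u, D] = f\<^sub>u \<partial>\<^sub>q\<close>, \<open>[\<partial>\<^sub>p, D] = \<partial>\<^sub>u + f\<^sub>p \<partial>\<^sub>q\<close>,
  \<open>[\<partial>\<^sub>q, D] = \<partial>\<^sub>p - I\<^sub>1 \<partial>\<^sub>q\<close>. Applied to \<open>D\<eta> = 0\<close> these commutators bring in \<open>I\<^sub>1\<close>, then \<open>I\<^sub>2\<close>, and finally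
  the vanishing of the Wuenschmann invariant (\<open>u_f\<close>), which closes the system: one quantity, \<open>r\<^sub>2\<close>,
  remains free and parametrizes \<open>Da\<^sub>7\<close>, and all other derivatives become expressions in the \<open>a\<^sub>i\<close>, \<open>r\<^sub>2\<close> and
  the derivatives of \<open>I\<^sub>1\<close> and \<open>I\<^sub>2\<close>. Substituting them shows that the five forms \<open>\<pi>'\<^sup>i\<close> vanish on the graph of
  \<open>(a\<^sub>1, a\<^sub>2, a\<^sub>3, a\<^sub>7, a\<^sub>8, r\<^sub>2)\<close> (\<open>Pi_form_section\<close>), which is the part of the auxiliary system that does not
  involve the \<open>s\<^sub>i\<close>.

  For the last row the large expressions \<open>s\<^sub>i\<close> are avoided. The vector field \<open>\<partial>\<^bsub>\<theta>4\<^esub>\<close> is tangent to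
  the graph (\<open>d_theta4_tangent\<close>), and \<open>d\<pi>'\<^sup>4\<close> vanishes on pairs of tangent vectors because \<open>\<pi>'\<^sup>4\<close> does
  (\<open>ext_deriv_on_integral_manifold\<close>). Hence \<open>\<rho>'\<^sup>2 = \<beta> da + dr\<^sub>2 + s \<theta>\<close> vanishes on the graph, and this is the
  last row of the system. Only the vertical part of \<open>\<rho>'\<^sup>2\<close> has to be computed (\<open>rho2_vertical\<close>), to know
  that coefficients \<open>s\<^sub>i\<close> with this property exist.
\<close>

section \<open>Smooth functions\<close>

lemma frechet_derivative_cong_open:
  assumes "open S" "z \<in> S" "\<And>x. x \<in> S \<Longrightarrow> g x = h x"
  shows "frechet_derivative g (at z) = frechet_derivative h (at z)"
proof -
  have "(g has_derivative D) (at z) \<longleftrightarrow> (h has_derivative D) (at z)" for D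
    using assms by (metis has_derivative_transform_within_open)
  then show ?thesis
    by (simp add: frechet_derivative_def)
qed

lemma differentiable_cong_open:
  assumes "open S" "z \<in> S" "\<And>x. x \<in> S \<Longrightarrow> g x = h x" "h differentiable (at z)"
  shows "g differentiable (at z)"
  using assms unfolding differentiable_def
  by (metis has_derivative_transform_within_open)

lemma pd_cong:
  assumes "open S" "z \<in> S" "\<And>x. x \<in> S \<Longrightarrow> g x = h x"
  shows "pd i g z = pd i h z"
  using frechet_derivative_cong_open[OF assms] by (simp add: pd_def)

lemma Dhat_cong:
  assumes "open S" "z \<in> S" "\<And>x. x \<in> S \<Longrightarrow> g x = h x"
  shows "Dhat f g z = Dhat f h z"
  by (simp add: Dhat_def total2_def pd_cong[OF assms])

lemma smooth_on_differentiable: "smooth_on S g \<Longrightarrow> z \<in> S \<Longrightarrow> g differentiable (at z)"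
  unfolding smooth_on_def by (metis foldr.simps(1) id_apply)

lemma smooth_on_pd: "smooth_on S g \<Longrightarrow> smooth_on S (pd i g)"
  unfolding smooth_on_def
proof (intro allI ballI)
  fix js z assume *: "\<forall>is. \<forall>z\<in>S. foldr pd is g differentiable (at z)" and "z \<in> S"
  then have "foldr pd (js @ [i]) g differentiable (at z)"
    by blast
  then show "foldr pd js (pd i g) differentiable (at z)" by simp
qed

lemma smooth_on_subset: "smooth_on S g \<Longrightarrow> T \<subseteq> S \<Longrightarrow> smooth_on T g"
  by (auto simp: smooth_on_def)

text \<open>
  Smoothness is the greatest fixed point of the condition to be differentiable with all partial
  derivatives smooth. Equality on \<open>S\<close> suffices in the step because \<open>S\<close> is open.
\<close>

lemma smooth_on_coinduct:
  assumes "open S" and "P g"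
    and step: "\<And>g. P g \<Longrightarrow> (\<forall>z\<in>S. g differentiable (at z)) \<and> (\<forall>i. \<exists>h. P h \<and> (\<forall>z\<in>S. pd i g z = h z))"
  shows "smooth_on S g"
proof -
  have "\<forall>z\<in>S. foldr pd is g' differentiable (at z)" if "P h" "\<forall>z\<in>S. g' z = h z" for g' h "is"
    using that
  proof (induction "is" arbitrary: g' h rule: rev_induct)
    case Nil
    then show ?case using step differentiable_cong_open[OF \<open>open S\<close>, of _ g' h] by auto
  next
    case (snoc i js)
    obtain h' where h': "P h'" "\<forall>z\<in>S. pd i h z = h' z" using step[OF snoc.prems(1)] by blast
    have "\<forall>z\<in>S. pd i g' z = h' z"
      using snoc.prems(2) h' pd_cong[OF \<open>open S\<close>, of _ g' h] by simp
    from snoc.IH[OF h'(1) this] show ?case by simp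
  qed
  then show ?thesis using \<open>P g\<close> unfolding smooth_on_def by blast
qed

lemma smooth_on_cong:
  assumes "open S" "smooth_on S h" "\<And>x. x \<in> S \<Longrightarrow> g x = h x"
  shows "smooth_on S g"
proof (rule smooth_on_coinduct[where P = "\<lambda>g. \<exists>h. smooth_on S h \<and> (\<forall>x\<in>S. g x = h x)"])
  fix g assume "\<exists>h. smooth_on S h \<and> (\<forall>x\<in>S. g x = h x)"
  then obtain h where h: "smooth_on S h" "\<forall>x\<in>S. g x = h x" by blast
  then show "(\<forall>z\<in>S. g differentiable (at z)) \<and>
     (\<forall>i. \<exists>k. (\<exists>h. smooth_on S h \<and> (\<forall>x\<in>S. k x = h x)) \<and> (\<forall>z\<in>S. pd i g z = k z))"
    using differentiable_cong_open[OF assms(1), of _ g h] pd_cong[OF assms(1), of _ g h]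
      smooth_on_differentiable[OF h(1)] smooth_on_pd[OF h(1)]
    by (metis (no_types, lifting))
qed (use assms in auto)

lemma pd_const [simp]: "pd i (\<lambda>_. c) z = 0"
  by (simp add: pd_def frechet_derivative_const)

lemma smooth_on_const [simp]: "open S \<Longrightarrow> smooth_on S (\<lambda>_. c)"
  by (rule smooth_on_coinduct[where P = "\<lambda>g. \<exists>c. g = (\<lambda>_. c)"]) auto

lemma pd_eqI: "(g has_derivative D) (at z) \<Longrightarrow> pd i g z = D (axis i 1)"
  using frechet_derivative_at[of g D z] by (simp add: pd_def)

lemma has_derivative_frechet: "g differentiable (at z) \<Longrightarrow> (g has_derivative frechet_derivative g (at z)) (at z)"
  by (simp add: frechet_derivative_works)

lemma pd_coordinate: "pd i (\<lambda>z. z $ j) z = (if i = j then 1 else 0)"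
  by (subst pd_eqI[OF bounded_linear_imp_has_derivative[OF bounded_linear_vec_nth]]) (auto simp: axis_def)

lemma coordinate_differentiable [simp]: "(\<lambda>z. z $ j) differentiable (at z)"
  by (metis bounded_linear_imp_has_derivative[OF bounded_linear_vec_nth] differentiable_def)

lemma smooth_on_coordinate [simp]: "open S \<Longrightarrow> smooth_on S (\<lambda>z. z $ j)"
  by (rule smooth_on_coinduct[where P = "\<lambda>g. (\<exists>c. g = (\<lambda>_. c)) \<or> (\<exists>j. g = (\<lambda>z. z $ j))"])
     (auto simp: pd_coordinate intro!: exI[where x="\<lambda>_. _::real"])

lemma pd_add: "g differentiable (at z) \<Longrightarrow> h differentiable (at z) \<Longrightarrow>
    pd i (\<lambda>z. g z + h z) z = pd i g z + pd i h z"
  by (subst pd_eqI[OF has_derivative_add[OF has_derivative_frechet has_derivative_frechet]])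
     (auto simp: pd_def)

lemma pd_diff: "g differentiable (at z) \<Longrightarrow> h differentiable (at z) \<Longrightarrow>
    pd i (\<lambda>z. g z - h z) z = pd i g z - pd i h z"
  by (subst pd_eqI[OF has_derivative_diff[OF has_derivative_frechet has_derivative_frechet]])
     (auto simp: pd_def)

lemma pd_minus: "g differentiable (at z) \<Longrightarrow> pd i (\<lambda>z. - g z) z = - pd i g z"
  by (subst pd_eqI[OF has_derivative_minus[OF has_derivative_frechet]]) (auto simp: pd_def)

lemma pd_mult: "g differentiable (at z) \<Longrightarrow> h differentiable (at z) \<Longrightarrow>
    pd i (\<lambda>z. g z * h z) z = pd i g z * h z + g z * pd i h z"
  by (subst pd_eqI[OF has_derivative_mult[OF has_derivative_frechet has_derivative_frechet]])
     (auto simp: pd_def)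

lemma pd_inverse: "g differentiable (at z) \<Longrightarrow> g z \<noteq> 0 \<Longrightarrow>
    pd i (\<lambda>z. inverse (g z)) z = - (pd i g z / (g z)\<^sup>2)"
  by (subst pd_eqI[OF Deriv.has_derivative_inverse[OF _ has_derivative_frechet]])
     (auto simp: pd_def field_simps power2_eq_square)

lemma pd_divide: "g differentiable (at z) \<Longrightarrow> h differentiable (at z) \<Longrightarrow> h z \<noteq> 0 \<Longrightarrow>
    pd i (\<lambda>z. g z / h z) z = pd i g z / h z - g z * pd i h z / (h z)\<^sup>2"
  unfolding divide_inverse
  by (simp add: pd_mult pd_inverse differentiable_inverse) (simp add: field_simps)

lemma pd_power2: "g differentiable (at z) \<Longrightarrow> pd i (\<lambda>z. (g z)\<^sup>2) z = 2 * g z * pd i g z"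
  by (simp add: power2_eq_square pd_mult)

lemma has_derivative_sqrt:
  assumes "(g has_derivative D) (at z)" "g z > 0"
  shows "((\<lambda>z. sqrt (g z)) has_derivative (\<lambda>h. D h / (2 * sqrt (g z)))) (at z)"
  using assms by (auto intro!: derivative_eq_intros simp: field_simps)

lemma sqrt_differentiable:
  fixes g :: "'a::real_normed_vector \<Rightarrow> real"
  assumes "g differentiable (at z)" "g z > 0"
  shows "(\<lambda>z. sqrt (g z)) differentiable (at z)"
  using has_derivative_sqrt[OF has_derivative_frechet[OF assms(1)] assms(2)]
  by (auto simp: differentiable_def)

lemma pd_sqrt: "g differentiable (at z) \<Longrightarrow> g z > 0 \<Longrightarrow>
    pd i (\<lambda>z. sqrt (g z)) z = pd i g z / (2 * sqrt (g z))"
  by (subst pd_eqI[OF has_derivative_sqrt[OF has_derivative_frechet]]) (auto simp: pd_def)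

text \<open>
  The expressions built from smooth functions by these operations are closed under partial
  differentiation, so that coinduction yields all closure properties of smoothness at once.
\<close>

inductive smooth_expression :: "(real^'n::finite) set \<Rightarrow> (real^'n \<Rightarrow> real) \<Rightarrow> bool" for S where
  atom: "smooth_on S g \<Longrightarrow> smooth_expression S g"
| add: "smooth_expression S g \<Longrightarrow> smooth_expression S h \<Longrightarrow> smooth_expression S (\<lambda>z. g z + h z)"
| mult: "smooth_expression S g \<Longrightarrow> smooth_expression S h \<Longrightarrow> smooth_expression S (\<lambda>z. g z * h z)"
| inv: "smooth_expression S g \<Longrightarrow> (\<And>z. z \<in> S \<Longrightarrow> g z \<noteq> 0) \<Longrightarrow> smooth_expression S (\<lambda>z. inverse (g z))"
| root: "smooth_expression S g \<Longrightarrow> (\<And>z. z \<in> S \<Longrightarrow> g z > 0) \<Longrightarrow> smooth_expression S (\<lambda>z. sqrt (g z))"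

lemma smooth_on_expression:
  assumes "open S" "smooth_expression S g"
  shows "smooth_on S g"
proof (rule smooth_on_coinduct[where P = "smooth_expression S", OF assms])
  fix g assume "smooth_expression S g"
  then show "(\<forall>z\<in>S. g differentiable (at z)) \<and>
      (\<forall>i. \<exists>h. smooth_expression S h \<and> (\<forall>z\<in>S. pd i g z = h z))"
  proof (induction rule: smooth_expression.induct)
    case (atom g)
    then show ?case
      using smooth_on_differentiable smooth_on_pd smooth_expression.atom by blast
  next
    case (add g h)
    show ?case
    proof (intro conjI allI ballI)
      fix i
      obtain g' h' where "smooth_expression S g'" "\<forall>z\<in>S. pd i g z = g' z"
        "smooth_expression S h'" "\<forall>z\<in>S. pd i h z = h' z"
        using add.IH by blast
      then show "\<exists>k. smooth_expression S k \<and> (\<forall>z\<in>S. pd i (\<lambda>z. g z + h z) z = k z)"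
        using add by (intro exI[of _ "\<lambda>z. g' z + h' z"]) (auto simp: pd_add intro: smooth_expression.intros)
    qed (use add in auto)
  next
    case (mult g h)
    show ?case
    proof (intro conjI allI ballI)
      fix i
      obtain g' h' where "smooth_expression S g'" "\<forall>z\<in>S. pd i g z = g' z"
        "smooth_expression S h'" "\<forall>z\<in>S. pd i h z = h' z"
        using mult.IH by blast
      then show "\<exists>k. smooth_expression S k \<and> (\<forall>z\<in>S. pd i (\<lambda>z. g z * h z) z = k z)"
        using mult by (intro exI[of _ "\<lambda>z. g' z * h z + g z * h' z"])
           (auto simp: pd_mult intro: smooth_expression.intros)
    qed (use mult in auto)
  next
    case (inv g)
    show ?case
    proof (intro conjI allI ballI)
      fix i
      obtain g' where "smooth_expression S g'" "\<forall>z\<in>S. pd i g z = g' z"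
        using inv.IH by blast
      moreover have "smooth_expression S (\<lambda>z. (- 1) * (g' z * (inverse (g z) * inverse (g z))))"
        using calculation(1) inv assms(1)
        by (intro smooth_expression.mult smooth_expression.inv smooth_expression.atom[OF smooth_on_const]) auto
      ultimately show "\<exists>k. smooth_expression S k \<and> (\<forall>z\<in>S. pd i (\<lambda>z. inverse (g z)) z = k z)"
        using inv
        by (intro exI[of _ "\<lambda>z. (- 1) * (g' z * (inverse (g z) * inverse (g z)))"]) (auto simp: pd_inverse divide_inverse power2_eq_square)
    qed (use inv in \<open>auto intro: differentiable_inverse\<close>)
  next
    case (root g)
    show ?case
    proof (intro conjI allI ballI)
      fix i
      obtain g' where "smooth_expression S g'" "\<forall>z\<in>S. pd i g z = g' z"
        using root.IH by blast
      moreover have "smooth_expression S (\<lambda>z. (1/2) * (g' z * inverse (sqrt (g z))))"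
        using calculation(1) root.hyps assms(1)
        by (intro smooth_expression.mult smooth_expression.inv smooth_expression.root
             smooth_expression.atom[OF smooth_on_const])
           (auto simp: less_imp_neq[THEN not_sym])
      ultimately show "\<exists>k. smooth_expression S k \<and> (\<forall>z\<in>S. pd i (\<lambda>z. sqrt (g z)) z = k z)"
        using root.hyps conjunct1[OF root.IH]
        by (intro exI[of _ "\<lambda>z. (1/2) * (g' z * inverse (sqrt (g z)))"] conjI ballI)
           (assumption, simp add: pd_sqrt field_simps)
    qed (use root in \<open>auto intro: sqrt_differentiable\<close>)
  qed
qed

lemma
  assumes S: "open S" and g: "smooth_on S g"
  shows smooth_on_add: "smooth_on S h \<Longrightarrow> smooth_on S (\<lambda>z. g z + h z)"
    and smooth_on_mult: "smooth_on S h \<Longrightarrow> smooth_on S (\<lambda>z. g z * h z)"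
    and smooth_on_inverse: "(\<And>z. z \<in> S \<Longrightarrow> g z \<noteq> 0) \<Longrightarrow> smooth_on S (\<lambda>z. inverse (g z))"
    and smooth_on_sqrt: "(\<And>z. z \<in> S \<Longrightarrow> g z > 0) \<Longrightarrow> smooth_on S (\<lambda>z. sqrt (g z))"
  by (rule smooth_on_expression[OF S]; (intro smooth_expression.intros g; assumption))+

lemma smooth_on_minus: "open S \<Longrightarrow> smooth_on S g \<Longrightarrow> smooth_on S (\<lambda>z. - g z)"
  using smooth_on_mult[of S "\<lambda>_. -1" g] by simp

lemma smooth_on_diff: "open S \<Longrightarrow> smooth_on S g \<Longrightarrow> smooth_on S h \<Longrightarrow> smooth_on S (\<lambda>z. g z - h z)"
  using smooth_on_add[of S g "\<lambda>z. - h z"] smooth_on_minus[of S h] by simp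

lemma smooth_on_divide: "open S \<Longrightarrow> smooth_on S g \<Longrightarrow> smooth_on S h \<Longrightarrow> (\<And>z. z \<in> S \<Longrightarrow> h z \<noteq> 0)
    \<Longrightarrow> smooth_on S (\<lambda>z. g z / h z)"
  using smooth_on_mult[of S g "\<lambda>z. inverse (h z)"] smooth_on_inverse[of S h]
  by (simp add: divide_inverse)

lemma smooth_on_power2: "open S \<Longrightarrow> smooth_on S g \<Longrightarrow> smooth_on S (\<lambda>z. (g z)\<^sup>2)"
  by (simp add: power2_eq_square smooth_on_mult)

lemmas smooth_on_intros = smooth_on_add smooth_on_mult smooth_on_minus smooth_on_diff smooth_on_divide
  smooth_on_power2 smooth_on_const smooth_on_coordinate smooth_on_pd

section \<open>Symmetry of second derivatives\<close>

text \<open>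
  Young's theorem: the mean value theorem in the direction \<open>v\<close> turns the second difference into a
  difference of values of the derivative along \<open>v\<close>, which a single differentiability at \<open>z\<close> controls.
\<close>

lemma second_difference_limit:
  fixes g :: "'a::real_normed_vector \<Rightarrow> real"
  assumes "open S" "z \<in> S" and diff: "\<And>x. x \<in> S \<Longrightarrow> g differentiable (at x)"
    and L: "((\<lambda>x. frechet_derivative g (at x) v) has_derivative L) (at z)"
  shows "((\<lambda>t. (g (z + t *\<^sub>R v + t *\<^sub>R w) - g (z + t *\<^sub>R v) - g (z + t *\<^sub>R w) + g z) / t\<^sup>2) \<longlongrightarrow> L w)
           (at_right 0)"
proof (rule tendstoI)
  let ?F = "\<lambda>x. frechet_derivative g (at x) v"
  fix e :: real assume "e > 0"
  \<comment> \<open>The two points compared below lie at distances from \<open>z\<close> adding up to at most \<open>t * N\<close>.\<close>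
  define N where "N = 2 * norm v + norm w + 1"
  have "N > 0" by (simp add: N_def add_nonneg_pos)
  define e' where "e' = e / (2 * N)"
  have "e' > 0" using \<open>e > 0\<close> \<open>N > 0\<close> by (simp add: e'_def)
  interpret L: bounded_linear L using L by (rule has_derivative_bounded_linear)
  obtain d where "d > 0" and d: "\<And>y. norm (y - z) < d \<Longrightarrow> norm (?F y - ?F z - L (y - z)) \<le> e' * norm (y - z)"
    using L \<open>e' > 0\<close> unfolding has_derivative_at_alt by blast
  obtain c where "c > 0" and c: "ball z c \<subseteq> S" using assms(1,2) by (meson openE)
  define T where "T = min c d / N"
  have "T > 0" using \<open>c > 0\<close> \<open>d > 0\<close> \<open>N > 0\<close> by (simp add: T_def)
  have main: "dist ((g (z + t *\<^sub>R v + t *\<^sub>R w) - g (z + t *\<^sub>R v) - g (z + t *\<^sub>R w) + g z) / t\<^sup>2) (L w) < e"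
    if "0 < t" "t < T" for t
  proof -
    have tN: "t * N < min c d" using that \<open>N > 0\<close> by (simp add: T_def field_simps)
    have small: "norm (s *\<^sub>R v + r *\<^sub>R w) < min c d" if "0 \<le> s" "s \<le> t" "0 \<le> r" "r \<le> t" for s r
    proof -
      have "norm (s *\<^sub>R v + r *\<^sub>R w) \<le> s * norm v + r * norm w"
        using that by (intro order_trans[OF norm_triangle_ineq]) simp
      also have "\<dots> \<le> t * norm v + t * norm w"
        using that by (intro add_mono mult_right_mono) auto
      also have "\<dots> \<le> t * N"
        unfolding N_def using \<open>0 < t\<close> by (simp add: algebra_simps)
      finally show ?thesis using tN by simp
    qed
    have inS: "z + (s *\<^sub>R v + r *\<^sub>R w) \<in> S" if "0 \<le> s" "s \<le> t" "0 \<le> r" "r \<le> t" for s r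
    proof -
      have "dist (z + (s *\<^sub>R v + r *\<^sub>R w)) z < c" using small[OF that] by (simp add: dist_norm)
      then show ?thesis using c by (auto simp: dist_commute)
    qed
    have der: "((\<lambda>s. g (z + (s *\<^sub>R v + r *\<^sub>R w))) has_real_derivative ?F (z + (s *\<^sub>R v + r *\<^sub>R w))) (at s)"
      if "0 \<le> s" "s \<le> t" "0 \<le> r" "r \<le> t" for s r
    proof -
      have 1: "((\<lambda>s. z + (s *\<^sub>R v + r *\<^sub>R w)) has_derivative (\<lambda>h. h *\<^sub>R v)) (at s)"
        by (auto intro!: derivative_eq_intros)
      have "((\<lambda>s. g (z + (s *\<^sub>R v + r *\<^sub>R w))) has_derivative
          (\<lambda>h. frechet_derivative g (at (z + (s *\<^sub>R v + r *\<^sub>R w))) (h *\<^sub>R v))) (at s)"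
        using has_derivative_compose[OF 1 has_derivative_frechet[OF diff[OF inS[OF that]]]] .
      moreover have "frechet_derivative g (at x) (h *\<^sub>R v) = ?F x * h" if "x \<in> S" for x h
        using linear_frechet_derivative[OF diff[OF that]] by (simp add: linear_cmul mult.commute)
      ultimately show ?thesis using inS[OF that] by (simp add: has_field_derivative_def)
    qed
    \<comment> \<open>The second difference is \<open>h t - h 0\<close>.\<close>
    define h where "h s = g (z + (s *\<^sub>R v + t *\<^sub>R w)) - g (z + (s *\<^sub>R v + 0 *\<^sub>R w))" for s
    have "\<exists>x. 0 < x \<and> x < t \<and> h t - h 0 = (t - 0) * (?F (z + (x *\<^sub>R v + t *\<^sub>R w)) - ?F (z + (x *\<^sub>R v + 0 *\<^sub>R w)))"
      using \<open>0 < t\<close> unfolding h_def by (intro MVT2 DERIV_diff der) auto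
    then obtain x where x: "0 < x" "x < t"
      "h t - h 0 = t * (?F (z + (x *\<^sub>R v + t *\<^sub>R w)) - ?F (z + (x *\<^sub>R v + 0 *\<^sub>R w)))"
      by auto
    let ?p = "x *\<^sub>R v + t *\<^sub>R w" and ?q = "x *\<^sub>R v + 0 *\<^sub>R w"
    have 1: "\<bar>?F (z + ?p) - ?F z - L ?p\<bar> \<le> e' * norm ?p"
      using d[of "z + ?p"] small[of x t] x by simp
    have 2: "\<bar>?F (z + ?q) - ?F z - L ?q\<bar> \<le> e' * norm ?q"
      using d[of "z + ?q"] small[of x 0] x by simp
    have Lpq: "L ?p - L ?q = t * L w"
      by (simp add: L.add L.scale)
    have n1: "norm ?p \<le> t * norm v + t * norm w"
      using x by (intro order_trans[OF norm_triangle_ineq] add_mono) (auto intro: mult_right_mono)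
    have n2: "norm ?q \<le> t * norm v"
      using x by (auto intro: mult_right_mono)
    have "norm ?p + norm ?q \<le> t * (2 * norm v + norm w)"
      using n1 n2 by (simp add: algebra_simps)
    also have "\<dots> \<le> t * N" unfolding N_def using \<open>0 < t\<close> by simp
    finally have "e' * norm ?p + e' * norm ?q \<le> e' * (t * N)"
      using \<open>e' > 0\<close> by (metis distrib_left mult_le_cancel_left_pos)
    then have "\<bar>?F (z + ?p) - ?F (z + ?q) - t * L w\<bar> \<le> e' * (t * N)"
      using 1 2 Lpq by linarith
    also have "\<dots> = t * (e / 2)" using \<open>N > 0\<close> by (simp add: e'_def field_simps)
    finally have 3: "\<bar>?F (z + ?p) - ?F (z + ?q) - t * L w\<bar> \<le> t * (e / 2)" .
    have "(h t - h 0) / t\<^sup>2 - L w = (?F (z + ?p) - ?F (z + ?q) - t * L w) / t"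
      unfolding x(3) using \<open>0 < t\<close> by (simp add: field_simps power2_eq_square)
    then have "\<bar>(h t - h 0) / t\<^sup>2 - L w\<bar> = \<bar>?F (z + ?p) - ?F (z + ?q) - t * L w\<bar> / t"
      using \<open>0 < t\<close> by (simp only: abs_divide abs_of_pos)
    also have "\<dots> \<le> e / 2"
      using 3 unfolding pos_divide_le_eq[OF \<open>0 < t\<close>] by (simp only: mult.commute)
    finally have "\<bar>(h t - h 0) / t\<^sup>2 - L w\<bar> \<le> e / 2" .
    moreover have "h t - h 0 = g (z + t *\<^sub>R v + t *\<^sub>R w) - g (z + t *\<^sub>R v) - g (z + t *\<^sub>R w) + g z"
      by (simp add: h_def add.assoc)
    ultimately show ?thesis using \<open>e > 0\<close> by (simp add: dist_real_def)
  qed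
  show "\<forall>\<^sub>F t in at_right 0. dist ((g (z + t *\<^sub>R v + t *\<^sub>R w) - g (z + t *\<^sub>R v) - g (z + t *\<^sub>R w) + g z) / t\<^sup>2) (L w) < e"
    unfolding eventually_at_right_field using main \<open>T > 0\<close> by blast
qed

text \<open>The second difference is symmetric in the two directions, and so is its limit.\<close>

lemma pd_commute:
  assumes "open S" "z \<in> S" "smooth_on S g"
  shows "pd i (pd j g) z = pd j (pd i g) z"
proof -
  have der: "((\<lambda>x. frechet_derivative g (at x) (axis k 1)) has_derivative frechet_derivative (pd k g) (at z)) (at z)" for k
    using has_derivative_frechet[OF smooth_on_differentiable[OF smooth_on_pd[OF assms(3), of k] assms(2)]]
    by (simp add: pd_def[abs_def])
  note lim = second_difference_limit[OF assms(1,2) smooth_on_differentiable[OF assms(3)] der]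
  have "g (z + t *\<^sub>R axis i 1 + t *\<^sub>R axis j 1) - g (z + t *\<^sub>R axis i 1) - g (z + t *\<^sub>R axis j 1) + g z
      = g (z + t *\<^sub>R axis j 1 + t *\<^sub>R axis i 1) - g (z + t *\<^sub>R axis j 1) - g (z + t *\<^sub>R axis i 1) + g z" for t
    by (simp add: add_ac)
  from tendsto_unique[OF _ lim[of i "axis j 1"] lim[of j "axis i 1", folded this]]
  show ?thesis by (simp add: pd_def)
qed

section \<open>Vectors and matrices with explicit entries\<close>

lemma vector_4 [simp]:
  "(vector [a, b, c, d] :: 'a::zero^4) $ 1 = a"
  "(vector [a, b, c, d] :: 'a::zero^4) $ 2 = b"
  "(vector [a, b, c, d] :: 'a::zero^4) $ 3 = c"
  "(vector [a, b, c, d] :: 'a::zero^4) $ 4 = d"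
  by (simp_all add: vector_def)

lemma vector_5 [simp]:
  "(vector [a, b, c, d, e] :: 'a::zero^5) $ 1 = a"
  "(vector [a, b, c, d, e] :: 'a::zero^5) $ 2 = b"
  "(vector [a, b, c, d, e] :: 'a::zero^5) $ 3 = c"
  "(vector [a, b, c, d, e] :: 'a::zero^5) $ 4 = d"
  "(vector [a, b, c, d, e] :: 'a::zero^5) $ 5 = e"
  by (simp_all add: vector_def)

lemma vector_6 [simp]:
  "(vector [a, b, c, d, e, k] :: 'a::zero^6) $ 1 = a"
  "(vector [a, b, c, d, e, k] :: 'a::zero^6) $ 2 = b"
  "(vector [a, b, c, d, e, k] :: 'a::zero^6) $ 3 = c"
  "(vector [a, b, c, d, e, k] :: 'a::zero^6) $ 4 = d"
  "(vector [a, b, c, d, e, k] :: 'a::zero^6) $ 5 = e"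
  "(vector [a, b, c, d, e, k] :: 'a::zero^6) $ 6 = k"
  by (simp_all add: vector_def)

lemma exhaust_5:
  fixes x :: 5
  shows "x = 1 \<or> x = 2 \<or> x = 3 \<or> x = 4 \<or> x = 5"
proof (induct x)
  case (of_int z)
  then have "0 \<le> z" "z < 5" by simp_all
  then have "z = 0 \<or> z = 1 \<or> z = 2 \<or> z = 3 \<or> z = 4" by arith
  then show ?case by auto
qed

lemma exhaust_6:
  fixes x :: 6
  shows "x = 1 \<or> x = 2 \<or> x = 3 \<or> x = 4 \<or> x = 5 \<or> x = 6"
proof (induct x)
  case (of_int z)
  then have "0 \<le> z" "z < 6" by simp_all
  then have "z = 0 \<or> z = 1 \<or> z = 2 \<or> z = 3 \<or> z = 4 \<or> z = 5" by arith
  then show ?case by auto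
qed

lemma forall_5: "(\<forall>i::5. P i) \<longleftrightarrow> P 1 \<and> P 2 \<and> P 3 \<and> P 4 \<and> P 5"
  by (metis exhaust_5)

lemma forall_6: "(\<forall>i::6. P i) \<longleftrightarrow> P 1 \<and> P 2 \<and> P 3 \<and> P 4 \<and> P 5 \<and> P 6"
  by (metis exhaust_6)

lemma sum_5: "sum g (UNIV::5 set) = g 1 + g 2 + g 3 + g 4 + g 5"
proof -
  have *: "UNIV = {1, 2, 3, 4, 5::5}" using exhaust_5 by auto
  show ?thesis unfolding * by (simp add: ac_simps)
qed

lemma sum_6: "sum g (UNIV::6 set) = g 1 + g 2 + g 3 + g 4 + g 5 + g 6"
proof -
  have *: "UNIV = {1, 2, 3, 4, 5, 6::6}" using exhaust_6 by auto
  show ?thesis unfolding * by (simp add: ac_simps)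
qed

section \<open>Calculus on the second jet space\<close>

lemma Dhat_const [simp]: "Dhat f (\<lambda>_. c) z = 0"
  by (simp add: Dhat_def total2_def)

lemma
  assumes "g differentiable (at z)"
  shows Dhat_minus: "Dhat f (\<lambda>z. - g z) z = - Dhat f g z"
    and Dhat_power2: "Dhat f (\<lambda>z. (g z)\<^sup>2) z = 2 * g z * Dhat f g z"
    and Dhat_add: "h differentiable (at z) \<Longrightarrow> Dhat f (\<lambda>z. g z + h z) z = Dhat f g z + Dhat f h z"
    and Dhat_diff: "h differentiable (at z) \<Longrightarrow> Dhat f (\<lambda>z. g z - h z) z = Dhat f g z - Dhat f h z"
    and Dhat_mult: "h differentiable (at z) \<Longrightarrow>
      Dhat f (\<lambda>z. g z * h z) z = Dhat f g z * h z + g z * Dhat f h z"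
    and Dhat_divide: "h differentiable (at z) \<Longrightarrow> h z \<noteq> 0 \<Longrightarrow>
      Dhat f (\<lambda>z. g z / h z) z = Dhat f g z / h z - g z * Dhat f h z / (h z)\<^sup>2"
  using assms unfolding Dhat_def total2_def
  by (simp_all add: pd_minus pd_power2 pd_add pd_diff pd_mult pd_divide algebra_simps
        add_divide_distrib diff_divide_distrib)

lemmas pd_rules = pd_add pd_diff pd_minus pd_mult pd_divide pd_power2
lemmas Dhat_rules = Dhat_add Dhat_diff Dhat_minus Dhat_mult Dhat_divide Dhat_power2

lemma smooth_on_Dhat: "open U \<Longrightarrow> smooth_on U f \<Longrightarrow> smooth_on U g \<Longrightarrow> smooth_on U (Dhat f g)"
  unfolding Dhat_def[abs_def] total2_def by (intro smooth_on_intros)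

lemma smooth_on_I1: "open U \<Longrightarrow> smooth_on U f \<Longrightarrow> smooth_on U (I1 f)"
  unfolding I1_def[abs_def] by (intro smooth_on_intros)

lemma smooth_on_I2: "open U \<Longrightarrow> smooth_on U f \<Longrightarrow> smooth_on U (I2 f)"
  unfolding I2_def[abs_def] by (intro smooth_on_intros smooth_on_Dhat smooth_on_I1)

text \<open>These come from differentiating the coefficients of \<open>Dhat f = \<partial>\<^sub>x + p \<partial>\<^sub>u + q \<partial>\<^sub>p + f \<partial>\<^sub>q\<close>; note \<open>f\<^sub>q = - I\<^sub>1\<close>.\<close>

lemma
  assumes "open U" "smooth_on U f" "smooth_on U g" "z \<in> U"
  shows pd_u_Dhat: "pd 2 (Dhat f g) z = Dhat f (pd 2 g) z + pd 2 f z * pd 4 g z"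
    and pd_p_Dhat: "pd 3 (Dhat f g) z = Dhat f (pd 3 g) z + pd 2 g z + pd 3 f z * pd 4 g z"
    and pd_q_Dhat: "pd 4 (Dhat f g) z = Dhat f (pd 4 g) z + pd 3 g z - I1 f z * pd 4 g z"
proof -
  have [simp]: "pd i g differentiable (at z)" "f differentiable (at z)" for i
    using assms smooth_on_differentiable smooth_on_pd by blast+
  have *: "pd i (Dhat f g) z = Dhat f (pd i g) z
      + (if i = 3 then pd 2 g z else 0) + (if i = 4 then pd 3 g z else 0) + pd i f z * pd 4 g z" for i
    unfolding Dhat_def[abs_def] total2_def
    using pd_commute[OF assms(1,4,3)]
    by (simp add: pd_rules pd_coordinate algebra_simps)
  show "pd 2 (Dhat f g) z = Dhat f (pd 2 g) z + pd 2 f z * pd 4 g z"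
    "pd 3 (Dhat f g) z = Dhat f (pd 3 g) z + pd 2 g z + pd 3 f z * pd 4 g z"
    "pd 4 (Dhat f g) z = Dhat f (pd 4 g) z + pd 3 g z - I1 f z * pd 4 g z"
    by (simp_all add: * I1_def)
qed

subsection \<open>Functions lifted from the first jet space\<close>

lemma proj_nth [simp]: "proj z $ 1 = z $ 1" "proj z $ 2 = z $ 2" "proj z $ 3 = z $ 3"
  by (simp_all add: proj_def)

lemma bounded_linear_proj: "bounded_linear proj"
  by (rule linear_conv_bounded_linear[THEN iffD1], rule linearI) (simp_all add: vec_eq_iff forall_3)

lemma open_proj_image:
  assumes "open U" shows "open (proj ` U)"
proof -
  have "surj proj"
  proof (rule surjI)
    fix m :: "real^3"
    show "proj (vector [m$1, m$2, m$3, 0]) = m" by (simp add: vec_eq_iff forall_3)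
  qed
  then show ?thesis
    using open_surjective_linear_image[OF assms] bounded_linear_proj
    by (simp add: linear_conv_bounded_linear)
qed

lemma proj_axis: "proj (axis 1 1) = axis 1 1" "proj (axis 2 1) = axis 2 1" "proj (axis 3 1) = axis 3 1"
    "proj (axis 4 1) = 0"
  by (simp_all add: vec_eq_iff forall_3 axis_def)

lemma has_derivative_lift:
  assumes "g differentiable (at (proj z))"
  shows "(lift g has_derivative frechet_derivative g (at (proj z)) \<circ> proj) (at z)"
  unfolding lift_def
  by (rule diff_chain_at[OF bounded_linear_imp_has_derivative[OF bounded_linear_proj]
        has_derivative_frechet[OF assms]])

lemma
  assumes "g differentiable (at (proj z))"
  shows pd_lift_1: "pd 1 (lift g) z = pd 1 g (proj z)"
    and pd_lift_2: "pd 2 (lift g) z = pd 2 g (proj z)"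
    and pd_lift_3: "pd 3 (lift g) z = pd 3 g (proj z)"
    and pd_lift_4: "pd 4 (lift g) z = 0"
  using linear_frechet_derivative[OF assms]
  by (simp_all add: pd_eqI[OF has_derivative_lift[OF assms]] proj_axis linear_0) (simp_all add: pd_def)

lemma total1_eq_Dhat_lift:
  "g differentiable (at (proj z)) \<Longrightarrow> total1 g z = Dhat f (lift g) z"
  by (simp add: total1_def Dhat_def total2_def pd_lift_1 pd_lift_2 pd_lift_3 pd_lift_4)

lemma smooth_on_lift:
  assumes "open U" "smooth_on (proj ` U) g"
  shows "smooth_on U (lift g)"
proof (rule smooth_on_coinduct[where P = "\<lambda>h. \<exists>g. smooth_on (proj ` U) g \<and> h = lift g"])
  fix h assume "\<exists>g. smooth_on (proj ` U) g \<and> h = lift g"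
  then obtain g where g: "smooth_on (proj ` U) g" "h = lift g" by blast
  have d: "g differentiable (at (proj z))" if "z \<in> U" for z
    using g that smooth_on_differentiable by blast
  have "\<exists>k. smooth_on (proj ` U) k \<and> (\<forall>z\<in>U. pd i (lift g) z = lift k z)" for i
  proof -
    have "\<forall>z\<in>U. pd 1 (lift g) z = lift (pd 1 g) z" "\<forall>z\<in>U. pd 2 (lift g) z = lift (pd 2 g) z"
      "\<forall>z\<in>U. pd 3 (lift g) z = lift (pd 3 g) z" "\<forall>z\<in>U. pd 4 (lift g) z = lift (\<lambda>_. 0) z"
      using d by (simp_all add: pd_lift_1 pd_lift_2 pd_lift_3 pd_lift_4) (simp_all add: lift_def)
    then show ?thesis
      using exhaust_4[of i] smooth_on_pd[OF g(1)] smooth_on_const[OF open_proj_image[OF assms(1)], of 0]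
      by metis
  qed
  then show "(\<forall>z\<in>U. h differentiable (at z)) \<and>
      (\<forall>i. \<exists>h'. (\<exists>g. smooth_on (proj ` U) g \<and> h' = lift g) \<and> (\<forall>z\<in>U. pd i h z = h' z))"
    using d has_derivative_lift g(2) differentiable_def by blast
qed (use assms in auto)

section \<open>Identities between the derivatives of the invariants\<close>

lemma pd_p_eq_I2: "pd 3 f z = - I2 f z - (2/9) * (I1 f z)\<^sup>2 - (1/3) * Dhat f (I1 f) z"
  by (simp add: I2_def)

text \<open>
  By definition of the invariants \<open>f\<^sub>p\<close> and \<open>f\<^sub>q\<close> are expressions in \<open>I\<^sub>1\<close>, \<open>I\<^sub>2\<close> and \<open>Dhat f (I1 f)\<close>; the identity
  is \<open>f\<^sub>p\<^sub>q = f\<^sub>q\<^sub>p\<close>.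
\<close>

lemma Dhat_I1_q:
  assumes U: "open U" "smooth_on U f" "z \<in> U"
  shows "Dhat f (pd 4 (I1 f)) z = - 3 * pd 4 (I2 f) z - (1/3) * I1 f z * pd 4 (I1 f) z + 2 * pd 3 (I1 f) z"
proof -
  have sm: "smooth_on U (I1 f)" "smooth_on U (I2 f)" "smooth_on U (Dhat f (I1 f))"
    using U by (auto intro!: smooth_on_I1 smooth_on_I2 smooth_on_Dhat)
  then have [simp]: "I1 f differentiable (at z)" "I2 f differentiable (at z)" "Dhat f (I1 f) differentiable (at z)"
    using U(3) smooth_on_differentiable by blast+
  have [simp]: "pd i f differentiable (at z)" for i
    using U smooth_on_pd smooth_on_differentiable by blast
  have "pd 4 (pd 3 f) z = pd 4 (\<lambda>z. - I2 f z - (2/9) * (I1 f z)\<^sup>2 - (1/3) * Dhat f (I1 f) z) z"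
    by (rule pd_cong[OF U(1,3)]) (rule pd_p_eq_I2)
  moreover have "pd 4 (pd 3 f) z = - pd 3 (I1 f) z"
    using pd_commute[OF U(1,3,2), of 4 3] by (simp add: I1_def[abs_def] pd_minus)
  ultimately show ?thesis
    by (simp add: pd_rules pd_q_Dhat[OF U(1,2) sm(1) U(3)] field_simps)
qed

text \<open>The \<open>q\<close>-derivative of the preceding identity.\<close>

lemma Dhat_I1_qq:
  assumes U: "open U" "smooth_on U f" "z \<in> U"
  shows "Dhat f (pd 4 (pd 4 (I1 f))) z = - 3 * pd 4 (pd 4 (I2 f)) z - (1/3) * (pd 4 (I1 f) z)\<^sup>2
     + (2/3) * I1 f z * pd 4 (pd 4 (I1 f)) z + pd 4 (pd 3 (I1 f)) z"
proof -
  have sm: "smooth_on U (I1 f)" "smooth_on U (I2 f)"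
    using U by (auto intro!: smooth_on_I1 smooth_on_I2)
  then have [simp]: "I1 f differentiable (at z)" "pd i (I1 f) differentiable (at z)" "pd i (I2 f) differentiable (at z)" for i
    using U(3) smooth_on_differentiable smooth_on_pd by blast+
  have "pd 4 (Dhat f (pd 4 (I1 f))) z
      = pd 4 (\<lambda>z. - 3 * pd 4 (I2 f) z - (1/3) * I1 f z * pd 4 (I1 f) z + 2 * pd 3 (I1 f) z) z"
    by (rule pd_cong[OF U(1,3)]) (rule Dhat_I1_q[OF U(1,2)])
  then show ?thesis
    using pd_commute[OF U(1,3) sm(1), of 3 4]
    by (simp add: pd_rules pd_q_Dhat[OF U(1,2) smooth_on_pd[OF sm(1)] U(3)] power2_eq_square field_simps)
qed

section \<open>Structure equations of the coframe of a linearizable equation\<close>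

text \<open>
  The derivatives below are found by differentiating a known identity, which gives \<open>l = r\<close> with an unknown
  \<open>y\<close> occurring linearly. The solution \<open>T\<close> is stated and verified by comparing \<open>l - r\<close> with \<open>(y - T) * c\<close>,
  where \<open>c\<close> is the coefficient of \<open>y\<close>; this is an identity between rational functions in which no other
  unknown is left.
\<close>

lemma solve_linear: "l = r \<Longrightarrow> (y - T) * c = l - r \<Longrightarrow> c \<noteq> 0 \<Longrightarrow> y = (T::real)"
  by simp

text \<open>
  All functions live on the second jet space; the assumptions \<open>q_phi\<close>, \<open>q_psi\<close>, \<open>q_chi\<close> say that the
  transformation comes from the first one, and \<open>D_eta'\<close> says that \<open>u''' = f\<close> goes to the flat equation. The coefficients \<open>a1\<close>, \<open>a7\<close>, \<open>a8\<close> are parameters, prescribed on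
  \<open>U\<close> only, because they will be lifts of functions on the first jet space, and such lifts agree with the
  corresponding partial derivatives only where the latter exist.
\<close>

locale linearized_ode =
  fixes f \<phi> \<psi> chi a1 a7 a8 :: "real^4 \<Rightarrow> real" and U :: "(real^4) set"
  assumes open_U: "open U"
    and smooth_f [simp]: "smooth_on U f" and smooth_phi [simp]: "smooth_on U \<phi>"
    and smooth_psi [simp]: "smooth_on U \<psi>" and smooth_chi [simp]: "smooth_on U chi"
    and q_phi: "z \<in> U \<Longrightarrow> pd 4 \<phi> z = 0" and q_psi: "z \<in> U \<Longrightarrow> pd 4 \<psi> z = 0"
    and q_chi: "z \<in> U \<Longrightarrow> pd 4 chi z = 0"
    and contact_D: "z \<in> U \<Longrightarrow> Dhat f \<psi> z = chi z * Dhat f \<phi> z"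
    and contact_p: "z \<in> U \<Longrightarrow> pd 3 \<psi> z = chi z * pd 3 \<phi> z"
    and contact_u: "z \<in> U \<Longrightarrow> pd 2 \<psi> z - chi z * pd 2 \<phi> z \<noteq> 0"
    and D_phi_nz: "z \<in> U \<Longrightarrow> Dhat f \<phi> z \<noteq> 0"
    and D_eta': "z \<in> U \<Longrightarrow> Dhat f (\<lambda>z. Dhat f chi z / Dhat f \<phi> z) z = 0"
    and a1_eq: "z \<in> U \<Longrightarrow> a1 z = pd 2 \<psi> z - chi z * pd 2 \<phi> z"
    and a7_eq: "z \<in> U \<Longrightarrow> a7 z = pd 2 \<phi> z" and a8_eq: "z \<in> U \<Longrightarrow> a8 z = pd 3 \<phi> z"
begin

definition "eta = (\<lambda>z. Dhat f chi z / Dhat f \<phi> z)"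
definition "a3 = (\<lambda>z. a1 z / Dhat f \<phi> z)"
definition "a2 = (\<lambda>z. pd 2 chi z - a7 z * eta z)"
definition "r2 = (\<lambda>z. a3 z / (a1 z)^2 *
      (- (1/3) * I1 f z * a7 z + (2/3) * (a2 z * a8 z / a3 z) * I1 f z
       - (1/6) * (a1 z * a2 z / (a3 z)^2) * pd 4 (I1 f) z - Dhat f a7 z))"

lemma a1_nz [simp]: "z \<in> U \<Longrightarrow> a1 z \<noteq> 0"
  using contact_u by (simp add: a1_eq)

lemma a3_nz [simp]: "z \<in> U \<Longrightarrow> a3 z \<noteq> 0"
  using a1_nz D_phi_nz by (simp add: a3_def)

lemma smooth_coefficients [simp]:
  "smooth_on U eta" "smooth_on U a1" "smooth_on U a2" "smooth_on U a3" "smooth_on U a7" "smooth_on U a8"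
  "smooth_on U r2" "smooth_on U (I1 f)" "smooth_on U (I2 f)"
proof -
  show I: "smooth_on U (I1 f)" "smooth_on U (I2 f)"
    using open_U by (simp_all add: smooth_on_I1 smooth_on_I2)
  show eta: "smooth_on U eta"
    unfolding eta_def by (intro smooth_on_intros smooth_on_Dhat open_U D_phi_nz; simp)
  show a1: "smooth_on U a1" and a7: "smooth_on U a7" and a8: "smooth_on U a8"
    by (rule smooth_on_cong[OF open_U _ a1_eq], intro smooth_on_intros open_U, simp_all,
        rule smooth_on_cong[OF open_U _ a7_eq], simp_all add: smooth_on_pd,
        rule smooth_on_cong[OF open_U _ a8_eq], simp_all add: smooth_on_pd)
  show a3: "smooth_on U a3"
    unfolding a3_def by (intro smooth_on_intros smooth_on_Dhat open_U D_phi_nz a1; simp)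
  show a2: "smooth_on U a2"
    unfolding a2_def by (intro smooth_on_intros open_U eta a7; simp)
  show "smooth_on U r2"
    unfolding r2_def by (intro smooth_on_intros smooth_on_Dhat open_U a1 a2 a3 a7 a8 I smooth_f) simp_all
qed

lemma smooth_pd [simp]: "smooth_on U g \<Longrightarrow> smooth_on U (pd i g)"
  by (rule smooth_on_pd)

lemma smooth_Dhat [simp]: "smooth_on U g \<Longrightarrow> smooth_on U (Dhat f g)"
  by (simp add: smooth_on_Dhat open_U)

lemma differentiable [simp]: "smooth_on U g \<Longrightarrow> z \<in> U \<Longrightarrow> g differentiable (at z)"
  by (rule smooth_on_differentiable)

lemma commute:
  assumes "smooth_on U g" "z \<in> U"
  shows pq: "pd 3 (pd 4 g) z = pd 4 (pd 3 g) z" and uq: "pd 2 (pd 4 g) z = pd 4 (pd 2 g) z"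
    and up: "pd 2 (pd 3 g) z = pd 3 (pd 2 g) z"
  using pd_commute[OF open_U assms(2,1)] by blast+

lemmas u_Dhat = pd_u_Dhat[OF open_U smooth_f]
  and p_Dhat = pd_p_Dhat[OF open_U smooth_f]
  and q_Dhat = pd_q_Dhat[OF open_U smooth_f]
  and D_I1q = Dhat_I1_q[OF open_U smooth_f]
  and D_I1qq = Dhat_I1_qq[OF open_U smooth_f]

lemma pd_eq: "(\<And>x. x \<in> U \<Longrightarrow> g x = h x) \<Longrightarrow> z \<in> U \<Longrightarrow> pd i g z = pd i h z"
  by (rule pd_cong[OF open_U])

lemma D_eq: "(\<And>x. x \<in> U \<Longrightarrow> g x = h x) \<Longrightarrow> z \<in> U \<Longrightarrow> Dhat f g z = Dhat f h z"
  by (rule Dhat_cong[OF open_U])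

lemma D_phi: "z \<in> U \<Longrightarrow> Dhat f \<phi> z = a1 z / a3 z"
  using D_phi_nz a1_nz by (simp add: a3_def)

lemma D_chi: "z \<in> U \<Longrightarrow> Dhat f chi z = a1 z / a3 z * eta z"
  using D_phi D_phi_nz by (simp add: eta_def)

lemma u_chi: "z \<in> U \<Longrightarrow> pd 2 chi z = a2 z + a7 z * eta z"
  by (simp add: a2_def)

lemma u_psi: "z \<in> U \<Longrightarrow> pd 2 \<psi> z = a1 z + chi z * a7 z"
  by (simp add: a1_eq a7_eq)

lemma D_psi: "z \<in> U \<Longrightarrow> Dhat f \<psi> z = chi z * (a1 z / a3 z)"
  by (simp add: contact_D D_phi)

lemma p_psi: "z \<in> U \<Longrightarrow> pd 3 \<psi> z = chi z * a8 z"
  by (simp add: contact_p a8_eq)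

lemma D_eta: "z \<in> U \<Longrightarrow> Dhat f eta z = 0"
  unfolding eta_def by (rule D_eta')

lemma
  assumes "z \<in> U"
  shows q_a1: "pd 4 a1 z = 0" and q_a7: "pd 4 a7 z = 0" and q_a8: "pd 4 a8 z = 0"
    and u_a8: "pd 2 a8 z = pd 3 a7 z"
proof -
  have *: "pd 4 (pd i g) z = 0" if "smooth_on U g" "\<And>x. x \<in> U \<Longrightarrow> pd 4 g x = 0" for i g
    using pd_eq[of "pd 4 g" "\<lambda>_. 0" z i] that pd_commute[OF open_U assms that(1), of 4 i] assms by simp
  show "pd 4 a7 z = 0" "pd 4 a8 z = 0"
    using pd_eq[OF a7_eq assms] pd_eq[OF a8_eq assms] *[OF smooth_phi q_phi] by simp_all
  show "pd 4 a1 z = 0"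
    using pd_eq[OF a1_eq assms] assms q_chi[OF assms] *[OF smooth_psi q_psi, of 2] *[OF smooth_phi q_phi, of 2]
    by (simp add: pd_rules)
  show "pd 2 a8 z = pd 3 a7 z"
    using pd_eq[OF a7_eq assms] pd_eq[OF a8_eq assms] up[OF smooth_phi assms] by simp
qed

lemma D_q_zero: "z \<in> U \<Longrightarrow> (\<And>x. x \<in> U \<Longrightarrow> pd 4 g x = 0) \<Longrightarrow> Dhat f (pd 4 g) z = 0"
  using D_eq[of "pd 4 g" "\<lambda>_. 0" z] by simp

lemma
  assumes z: "z \<in> U"
  shows q_E: "pd 4 (\<lambda>z. a1 z / a3 z) z = a8 z"
    and p_E: "pd 3 (\<lambda>z. a1 z / a3 z) z = a7 z + Dhat f a8 z"
    and u_E: "pd 2 (\<lambda>z. a1 z / a3 z) z = Dhat f a7 z"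
proof -
  have E: "pd i (\<lambda>z. a1 z / a3 z) z = pd i (Dhat f \<phi>) z" for i
    by (rule pd_eq) (simp_all add: D_phi z)
  show "pd 4 (\<lambda>z. a1 z / a3 z) z = a8 z" "pd 3 (\<lambda>z. a1 z / a3 z) z = a7 z + Dhat f a8 z"
    "pd 2 (\<lambda>z. a1 z / a3 z) z = Dhat f a7 z"
    using z D_eq[OF a7_eq z] D_eq[OF a8_eq z]
    by (simp_all add: E u_Dhat p_Dhat q_Dhat q_phi D_q_zero a7_eq a8_eq)
qed

text \<open>
  The components of \<open>d\<theta>\<^sup>1 = \<theta>\<^sup>4 \<and> \<theta>\<^sup>2\<close>, which expresses \<open>dd\<psi> = 0\<close> for \<open>\<theta>\<^sup>1 = d\<psi> - \<chi> d\<phi>\<close>. They are obtained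
  by comparing the mixed derivatives of \<open>\<psi>\<close>.
\<close>

lemma
  assumes z: "z \<in> U"
  shows p_chi: "pd 3 chi z = a3 z + a8 z * eta z"
    and D_a1: "Dhat f a1 z = a1 z * a2 z / a3 z"
    and p_a1: "pd 3 a1 z = a2 z * a8 z - a3 z * a7 z"
proof -
  note nz = a1_nz[OF z] a3_nz[OF z]
  have E: "pd i (Dhat f \<psi>) z = pd i chi z * (a1 z / a3 z) + chi z * pd i (\<lambda>z. a1 z / a3 z) z" for i
    using pd_eq[of "Dhat f \<psi>" "\<lambda>z. chi z * (a1 z / a3 z)" z i] D_psi z
      pd_mult[of chi z "\<lambda>z. a1 z / a3 z" i] by (simp add: differentiable_divide)
  have "Dhat f (pd 3 \<psi>) z = Dhat f (\<lambda>z. chi z * a8 z) z"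
    using p_psi z by (intro D_eq)
  then have "pd 3 chi z * (a1 z / a3 z) = a1 z + a1 z / a3 z * eta z * a8 z"
    using E[of 3] z by (simp add: p_Dhat q_psi u_psi D_chi Dhat_rules p_E algebra_simps)
  then have "a1 z * pd 3 chi z = a1 z * (a3 z + a8 z * eta z)"
    using nz by (simp add: field_simps)
  then show chi_p: "pd 3 chi z = a3 z + a8 z * eta z"
    using nz by simp
  have "Dhat f (pd 2 \<psi>) z = Dhat f (\<lambda>z. a1 z + chi z * a7 z) z"
    using u_psi z by (intro D_eq)
  then have "pd 2 chi z * (a1 z / a3 z) = Dhat f a1 z + a1 z / a3 z * eta z * a7 z"
    using E[of 2] z by (simp add: u_Dhat q_psi D_chi Dhat_rules u_E algebra_simps)
  then show "Dhat f a1 z = a1 z * a2 z / a3 z"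
    using nz by (simp add: u_chi[OF z] field_simps)
  have "pd 3 (pd 2 \<psi>) z = pd 3 (\<lambda>z. a1 z + chi z * a7 z) z"
    using u_psi z by (intro pd_eq)
  moreover have "pd 2 (pd 3 \<psi>) z = pd 2 (\<lambda>z. chi z * a8 z) z"
    using p_psi z by (intro pd_eq)
  ultimately show "pd 3 a1 z = a2 z * a8 z - a3 z * a7 z"
    using z by (simp add: up pd_rules chi_p u_chi u_a8 algebra_simps)
qed

text \<open>
  Up to \<open>u_eta\<close>, the components of \<open>d\<theta>\<^sup>2 = \<theta>\<^sup>4 \<and> \<theta>\<^sup>3\<close>. Commutators applied to \<open>D\<chi> = (D\<phi>) \<eta>\<close> express the
  partial derivatives of \<open>\<eta>\<close> through \<open>Da\<^sub>2\<close> and \<open>Da\<^sub>3\<close>.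
\<close>

lemma pd_D_chi: "z \<in> U \<Longrightarrow>
    pd i (Dhat f chi) z = pd i (\<lambda>z. a1 z / a3 z) z * eta z + a1 z / a3 z * pd i eta z"
  using pd_eq[of "Dhat f chi" "\<lambda>z. a1 z / a3 z * eta z" z i] D_chi
    pd_mult[of "\<lambda>z. a1 z / a3 z" z eta i] by (simp add: differentiable_divide)

lemma D_p_chi: "z \<in> U \<Longrightarrow> Dhat f (pd 3 chi) z = Dhat f a3 z + Dhat f a8 z * eta z"
  using D_eq[of "pd 3 chi" "\<lambda>z. a3 z + a8 z * eta z" z] p_chi by (simp add: Dhat_rules D_eta)

lemma D_u_chi: "z \<in> U \<Longrightarrow> Dhat f (pd 2 chi) z = Dhat f a2 z + Dhat f a7 z * eta z"
  using D_eq[of "pd 2 chi" "\<lambda>z. a2 z + a7 z * eta z" z] u_chi by (simp add: Dhat_rules D_eta)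

lemma q_eta: "z \<in> U \<Longrightarrow> pd 4 eta z = (a3 z)\<^sup>2 / a1 z"
  using pd_D_chi[of z 4] a1_nz[of z] a3_nz[of z]
  by (simp add: q_Dhat D_q_zero q_chi p_chi q_E)
        (simp add: field_simps power2_eq_square power3_eq_cube power4_eq_xxxx)

lemma q_a2: "z \<in> U \<Longrightarrow> pd 4 a2 z = - ((a3 z)^2 * a7 z / a1 z)"
  using pd_eq[of "pd 2 chi" "\<lambda>z. a2 z + a7 z * eta z" z 4] u_chi pd_eq[of "pd 4 chi" "\<lambda>_. 0" z 2] q_chi
  by (simp add: uq[symmetric] pd_rules q_a7 q_eta algebra_simps add_eq_0_iff)

lemma q_a3: "z \<in> U \<Longrightarrow> pd 4 a3 z = - ((a3 z)^2 * a8 z / a1 z)"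
  using pd_eq[of "pd 3 chi" "\<lambda>z. a3 z + a8 z * eta z" z 4] p_chi pd_eq[of "pd 4 chi" "\<lambda>_. 0" z 3] q_chi
  by (simp add: pq[symmetric] pd_rules q_a8 q_eta algebra_simps add_eq_0_iff)

lemma p_eta': "z \<in> U \<Longrightarrow> pd 3 eta z = (Dhat f a3 z + a2 z) * a3 z / a1 z"
  using pd_D_chi[of z 3] a1_nz[of z] a3_nz[of z]
  by (simp add: p_Dhat q_chi u_chi D_p_chi p_E) (simp add: field_simps)

lemma u_eta': "z \<in> U \<Longrightarrow> pd 2 eta z = Dhat f a2 z * a3 z / a1 z"
  using pd_D_chi[of z 2] a1_nz[of z] a3_nz[of z]
  by (simp add: u_Dhat q_chi D_u_chi u_E field_simps)

lemma pd_D_eta: "z \<in> U \<Longrightarrow> pd i (Dhat f eta) z = 0"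
  using pd_eq[of "Dhat f eta" "\<lambda>_. 0" z i] D_eta by simp

text \<open>The commutator of \<open>\<partial>\<^sub>q\<close> with \<open>D\<close>, applied to \<open>D\<eta> = 0\<close>, in which \<open>f\<^sub>q = - I\<^sub>1\<close> enters.\<close>

lemma D_a3:
  assumes z: "z \<in> U"
  shows "Dhat f a3 z = I1 f z * a3 z / 3"
proof -
  note nz = a1_nz[OF z] a3_nz[OF z]
  have "Dhat f (pd 4 eta) z = Dhat f (\<lambda>z. (a3 z)\<^sup>2 / a1 z) z"
    using q_eta z by (intro D_eq)
  with pd_D_eta[OF z, of 4] have "0 = Dhat f (\<lambda>z. (a3 z)\<^sup>2 / a1 z) z + pd 3 eta z - I1 f z * pd 4 eta z"
    using z by (simp add: q_Dhat)
  then show ?thesis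
  proof (rule solve_linear)
    show "(Dhat f a3 z - (I1 f z * a3 z / 3)) * (- 3 * a3 z / a1 z)
       = 0 - (Dhat f (\<lambda>z. (a3 z)\<^sup>2 / a1 z) z + pd 3 eta z - I1 f z * pd 4 eta z)"
      using z nz by (simp add: Dhat_rules D_a1 p_eta' q_eta)
        (simp add: field_simps power2_eq_square power3_eq_cube power4_eq_xxxx)
  qed (use nz in simp)
qed

lemma p_eta: "z \<in> U \<Longrightarrow> pd 3 eta z = a2 z * a3 z / a1 z + (a3 z)\<^sup>2 / (3 * a1 z) * I1 f z"
  by (simp add: p_eta' D_a3 field_simps power2_eq_square power3_eq_cube power4_eq_xxxx)

text \<open>The commutator of \<open>\<partial>\<^sub>p\<close> with \<open>D\<close>, applied to \<open>D\<eta> = 0\<close>; here \<open>f\<^sub>p\<close> brings in \<open>I\<^sub>2\<close>.\<close>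

lemma D_a2:
  assumes z: "z \<in> U"
  shows "Dhat f a2 z = I2 f z * a3 z / 2 + (a2 z)^2 / (2 * a3 z)"
proof -
  note nz = a1_nz[OF z] a3_nz[OF z]
  let ?p = "\<lambda>z. a2 z * a3 z / a1 z + (a3 z)\<^sup>2 / (3 * a1 z) * I1 f z"
  have "Dhat f (pd 3 eta) z = Dhat f ?p z"
    using p_eta z by (intro D_eq)
  with pd_D_eta[OF z, of 3] have "0 = Dhat f ?p z + pd 2 eta z + pd 3 f z * pd 4 eta z"
    using z by (simp add: p_Dhat)
  then show ?thesis
  proof (rule solve_linear)
    show "(Dhat f a2 z - (I2 f z * a3 z / 2 + (a2 z)^2 / (2 * a3 z))) * (- 2 * a3 z / a1 z)
       = 0 - (Dhat f ?p z + pd 2 eta z + pd 3 f z * pd 4 eta z)"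
      using z nz by (simp add: Dhat_rules D_a1 D_a3 u_eta' q_eta pd_p_eq_I2)
        (simp add: field_simps power2_eq_square power3_eq_cube power4_eq_xxxx)
  qed (use nz in simp)
qed

lemma u_eta: "z \<in> U \<Longrightarrow> pd 2 eta z = (a2 z)\<^sup>2 / (2 * a1 z) + (a3 z)\<^sup>2 / (2 * a1 z) * I2 f z"
  by (simp add: u_eta' D_a2 field_simps power2_eq_square power3_eq_cube power4_eq_xxxx)

text \<open>
  The vanishing of the Wuenschmann invariant, from the commutator of \<open>\<partial>\<^sub>u\<close> with \<open>D\<close> applied to \<open>D\<eta> = 0\<close>.
  All derivatives of \<open>\<eta>\<close> being known by now, this is a condition on \<open>f\<close> alone.
\<close>

lemma u_f:
  assumes z: "z \<in> U"
  shows "pd 2 f z = - (1/2) * Dhat f (I2 f) z - (1/3) * I1 f z * I2 f z"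
proof -
  note nz = a1_nz[OF z] a3_nz[OF z]
  let ?u = "\<lambda>z. (a2 z)\<^sup>2 / (2 * a1 z) + (a3 z)\<^sup>2 / (2 * a1 z) * I2 f z"
  have "Dhat f (pd 2 eta) z = Dhat f ?u z"
    using u_eta z by (intro D_eq)
  with pd_D_eta[OF z, of 2] have "0 = Dhat f ?u z + pd 2 f z * pd 4 eta z"
    using z by (simp add: u_Dhat)
  then show ?thesis
  proof (rule solve_linear)
    show "(pd 2 f z - (- (1/2) * Dhat f (I2 f) z - (1/3) * I1 f z * I2 f z)) * (- (a3 z)\<^sup>2 / a1 z)
       = 0 - (Dhat f ?u z + pd 2 f z * pd 4 eta z)"
      using z nz by (simp add: Dhat_rules D_a1 D_a3 D_a2 q_eta)
        (simp add: field_simps power2_eq_square power3_eq_cube power4_eq_xxxx)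
  qed (use nz in simp)
qed

text \<open>The compatibility condition \<open>f\<^sub>u\<^sub>q = f\<^sub>q\<^sub>u\<close> for \<open>u_f\<close>, solved for the derivative of \<open>I\<^sub>2\<^sub>,\<^sub>q\<close> along \<open>D\<close>.\<close>

lemma D_I2q:
  assumes z: "z \<in> U"
  shows "Dhat f (pd 4 (I2 f)) z = 2 * pd 2 (I1 f) z - (2/3) * pd 4 (I1 f) z * I2 f z
    + (1/3) * I1 f z * pd 4 (I2 f) z - pd 3 (I2 f) z"
proof -
  have "pd 4 (pd 2 f) z = pd 4 (\<lambda>z. - (1/2) * Dhat f (I2 f) z - (1/3) * I1 f z * I2 f z) z"
    using u_f z by (intro pd_eq)
  moreover have "pd 4 (pd 2 f) z = - pd 2 (I1 f) z"
    using pd_commute[OF open_U z smooth_f, of 4 2] z by (simp add: I1_def[abs_def] pd_minus)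
  ultimately show ?thesis
    using z by (simp add: pd_rules q_Dhat field_simps)
qed

subsection \<open>The remaining derivatives of the coefficients\<close>

lemmas q_derivs = q_a1 q_a2 q_a3 q_a7 q_a8
  and D_derivs = D_a1 D_a2 D_a3

text \<open>
  \<open>E = D\<phi> = a\<^sub>1 / a\<^sub>3\<close> satisfies \<open>E\<^sub>q = a\<^sub>8\<close> and \<open>E\<^sub>p = a\<^sub>7 + Da\<^sub>8\<close>, so the commutator of \<open>\<partial>\<^sub>q\<close> with \<open>D\<close>
  applied to \<open>E\<close> contains \<open>Da\<^sub>8\<close> twice.
\<close>

lemma D_a8:
  assumes z: "z \<in> U"
  shows "Dhat f a8 z = I1 f z * a8 z / 3 - pd 4 (I1 f) z * a1 z / (6 * a3 z) + a2 z * a8 z / a3 z - a7 z"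
proof -
  note nz = a1_nz[OF z] a3_nz[OF z]
  let ?E = "\<lambda>z. a1 z / a3 z" and ?G = "\<lambda>z. a1 z * a2 z / (a3 z)^2 - a1 z * I1 f z / (3 * a3 z)"
  have E: "smooth_on U ?E" by (intro smooth_on_intros open_U) simp_all
  have "Dhat f ?E x = ?G x" if "x \<in> U" for x
    using that by (simp add: Dhat_rules D_derivs)
        (simp add: field_simps power2_eq_square power3_eq_cube power4_eq_xxxx)
  then have "pd 4 ?G z = pd 4 (Dhat f ?E) z"
    using z by (intro pd_eq) auto
  also have "\<dots> = Dhat f a8 z + pd 3 ?E z - I1 f z * pd 4 ?E z"
    using D_eq[OF q_E z] by (simp add: q_Dhat[OF E z])
  finally show ?thesis
  proof (rule solve_linear)
    show "(Dhat f a8 z - (I1 f z * a8 z / 3 - pd 4 (I1 f) z * a1 z / (6 * a3 z) + a2 z * a8 z / a3 z - a7 z)) * (- 2)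
      = pd 4 ?G z - (Dhat f a8 z + pd 3 ?E z - I1 f z * pd 4 ?E z)"
      using z nz unfolding p_E[OF z] q_E[OF z]
      by (simp add: pd_rules q_derivs)
        (simp add: field_simps power2_eq_square power3_eq_cube power4_eq_xxxx)
  qed simp
qed

text \<open>The definition of \<open>r\<^sub>2\<close>, read as a formula for \<open>Da\<^sub>7\<close>.\<close>

lemma D_a7:
  assumes z: "z \<in> U"
  shows "Dhat f a7 z = 2 * I1 f z * a2 z * a8 z / (3 * a3 z) - I1 f z * a7 z / 3
      - pd 4 (I1 f) z * a1 z * a2 z / (6 * (a3 z)^2) - (a1 z)^2 * r2 z / a3 z"
proof -
  have "r2 z * ((a1 z)\<^sup>2 / a3 z) = - (1/3) * I1 f z * a7 z + (2/3) * (a2 z * a8 z / a3 z) * I1 f z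
       - (1/6) * (a1 z * a2 z / (a3 z)^2) * pd 4 (I1 f) z - Dhat f a7 z"
    using a1_nz[OF z] a3_nz[OF z] by (simp add: r2_def)
  then show ?thesis
    by (simp add: algebra_simps)
qed

text \<open>The equation \<open>(a\<^sub>1 / a\<^sub>3)\<^sub>p = a\<^sub>7 + Da\<^sub>8\<close>.\<close>

lemma p_a3:
  assumes z: "z \<in> U"
  shows "pd 3 a3 z = - (I1 f z * (a3 z)^2 * a8 z / (3 * a1 z)) + pd 4 (I1 f) z * a3 z / 6
      - (a3 z)^2 * a7 z / a1 z"
  using p_E[OF z]
proof (rule solve_linear)
  show "(pd 3 a3 z - (- (I1 f z * (a3 z)^2 * a8 z / (3 * a1 z)) + pd 4 (I1 f) z * a3 z / 6
      - (a3 z)^2 * a7 z / a1 z)) * (- (a1 z / (a3 z)\<^sup>2))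
      = pd 3 (\<lambda>z. a1 z / a3 z) z - (a7 z + Dhat f a8 z)"
    using z a1_nz[OF z] a3_nz[OF z]
    by (simp add: pd_rules p_a1 D_a8)
        (simp add: field_simps power2_eq_square power3_eq_cube power4_eq_xxxx)
qed (use z in simp)

text \<open>\<open>a\<^sub>8\<close> is free of \<open>q\<close>, so its \<open>p\<close>-derivative is the \<open>q\<close>-derivative of \<open>Da\<^sub>8\<close>.\<close>

lemma p_a8:
  assumes z: "z \<in> U"
  shows "pd 3 a8 z = pd 4 (I1 f) z * a8 z / 6 - pd 4 (pd 4 (I1 f)) z * a1 z / (6 * a3 z) + a2 z * (a8 z)^2 / a1 z
      - a3 z * a7 z * a8 z / a1 z"
proof -
  let ?G = "\<lambda>z. I1 f z * a8 z / 3 - pd 4 (I1 f) z * a1 z / (6 * a3 z) + a2 z * a8 z / a3 z - a7 z"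
  have "pd 4 ?G z = pd 4 (Dhat f a8) z"
    using z by (intro pd_eq) (simp_all add: D_a8)
  also have "\<dots> = pd 3 a8 z"
    using z by (simp add: q_Dhat q_a8 D_q_zero)
  finally show ?thesis
  proof (rule solve_linear)
    show "(pd 3 a8 z - (pd 4 (I1 f) z * a8 z / 6 - pd 4 (pd 4 (I1 f)) z * a1 z / (6 * a3 z) + a2 z * (a8 z)^2 / a1 z
      - a3 z * a7 z * a8 z / a1 z)) * (- 1) = pd 4 ?G z - pd 3 a8 z"
      using z a1_nz[OF z] a3_nz[OF z]
      by (simp add: pd_rules q_derivs)
        (simp add: field_simps power2_eq_square power3_eq_cube power4_eq_xxxx)
  qed simp
qed

text \<open>
  Two linear equations for \<open>a\<^sub>1\<^sub>,\<^sub>u\<close> and \<open>a\<^sub>3\<^sub>,\<^sub>u\<close>: the symmetry \<open>\<eta>\<^sub>q\<^sub>u = \<eta>\<^sub>u\<^sub>q\<close> and \<open>(a\<^sub>1 / a\<^sub>3)\<^sub>u = Da\<^sub>7\<close>. The second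
  one is where \<open>r\<^sub>2\<close> enters.
\<close>

lemma u_a3:
  assumes z: "z \<in> U"
  shows "pd 2 a3 z = 2 * I1 f z * a2 z * a3 z * a8 z / (3 * a1 z) - I1 f z * (a3 z)^2 * a7 z / (3 * a1 z)
      - pd 4 (I1 f) z * a2 z / 6 - I2 f z * (a3 z)^2 * a8 z / a1 z + pd 4 (I2 f) z * a3 z / 2
      - a2 z * a3 z * a7 z / a1 z - a1 z * a3 z * r2 z" (is "_ = ?T")
  and u_a1: "pd 2 a1 z = 4 * I1 f z * a2 z * a8 z / 3 - 2 * I1 f z * a3 z * a7 z / 3
      - pd 4 (I1 f) z * a1 z * a2 z / (3 * a3 z) - I2 f z * a3 z * a8 z + pd 4 (I2 f) z * a1 z / 2
      - 2 * (a1 z)^2 * r2 z - a2 z * a7 z" (is "_ = ?S")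
proof -
  note nz = a1_nz[OF z] a3_nz[OF z]
  let ?E = "\<lambda>z. a1 z / a3 z" and ?q = "\<lambda>z. (a3 z)\<^sup>2 / a1 z"
    and ?u = "\<lambda>z. (a2 z)\<^sup>2 / (2 * a1 z) + (a3 z)\<^sup>2 / (2 * a1 z) * I2 f z"
  have "pd 2 ?q z = pd 2 (pd 4 eta) z" "pd 4 ?u z = pd 4 (pd 2 eta) z"
    using z by (intro pd_eq; simp add: q_eta u_eta)+
  then have *: "pd 2 ?q z = pd 4 ?u z"
    using z by (simp add: uq)
  \<comment> \<open>The multiple of the second equation that cancels the derivative of \<open>a1\<close>.\<close>
  have "pd 2 ?q z + pd 2 ?E z * ((a3 z)^3 / (a1 z)\<^sup>2)
      = pd 4 ?u z + Dhat f a7 z * ((a3 z)^3 / (a1 z)\<^sup>2)"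
    by (simp only: * u_E[OF z])
  then show u_a3: "pd 2 a3 z = ?T"
  proof (rule solve_linear)
    show "(pd 2 a3 z - ?T) * (a3 z / a1 z)
      = pd 2 ?q z + pd 2 ?E z * ((a3 z)^3 / (a1 z)\<^sup>2)
        - (pd 4 ?u z + Dhat f a7 z * ((a3 z)^3 / (a1 z)\<^sup>2))"
      using z nz by (simp add: pd_rules D_a7 q_derivs)
        (simp add: field_simps power2_eq_square power3_eq_cube power4_eq_xxxx)
  qed (use nz in simp)
  from u_E[OF z] show "pd 2 a1 z = ?S"
  proof (rule solve_linear)
    show "(pd 2 a1 z - ?S) * (1 / a3 z) = pd 2 ?E z - Dhat f a7 z"
      using z nz by (simp add: pd_rules D_a7 u_a3)
        (simp add: field_simps power2_eq_square power3_eq_cube power4_eq_xxxx)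
  qed (use nz in simp)
qed

text \<open>The symmetry \<open>\<chi>\<^sub>u\<^sub>p = \<chi>\<^sub>p\<^sub>u\<close>.\<close>

lemma p_a2:
  assumes z: "z \<in> U"
  shows "pd 3 a2 z = 2 * I1 f z * a2 z * a3 z * a8 z / (3 * a1 z) - 2 * I1 f z * (a3 z)^2 * a7 z / (3 * a1 z)
      - pd 4 (I1 f) z * a2 z / 6 - I2 f z * (a3 z)^2 * a8 z / (2 * a1 z)
      + pd 4 (I2 f) z * a3 z / 2 - 2 * a2 z * a3 z * a7 z / a1 z + (a2 z)^2 * a8 z / (2 * a1 z)
      - a1 z * a3 z * r2 z" (is "_ = ?T")
proof -
  note nz = a1_nz[OF z] a3_nz[OF z]
  let ?u = "\<lambda>z. a2 z + a7 z * eta z" and ?p = "\<lambda>z. a3 z + a8 z * eta z"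
  have "pd 3 ?u z = pd 3 (pd 2 chi) z" "pd 2 ?p z = pd 2 (pd 3 chi) z"
    using z by (intro pd_eq; simp add: u_chi p_chi)+
  then have "pd 3 ?u z = pd 2 ?p z"
    using z by (simp add: up)
  then show ?thesis
  proof (rule solve_linear)
    show "(pd 3 a2 z - ?T) * 1 = pd 3 ?u z - pd 2 ?p z"
      using z nz by (simp add: pd_rules u_a3 u_a8 u_eta p_eta)
        (simp add: field_simps power2_eq_square power3_eq_cube power4_eq_xxxx)
  qed simp
qed

text \<open>
  The commutator of \<open>\<partial>\<^sub>p\<close> with \<open>D\<close> applied to \<open>a\<^sub>8\<close>. Both \<open>a\<^sub>8\<^sub>,\<^sub>u\<close> and the \<open>p\<close>-derivative of the term \<open>- a\<^sub>7\<close> of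
  \<open>Da\<^sub>8\<close> contribute the unknown; the derivatives of \<open>I\<^sub>1\<^sub>,\<^sub>q\<close> and \<open>I\<^sub>1\<^sub>,\<^sub>q\<^sub>q\<close> along \<open>D\<close> are replaced by means
  of \<open>D_I1q\<close> and \<open>D_I1qq\<close>.
\<close>

lemma p_a7:
  assumes z: "z \<in> U"
  shows "pd 3 a7 z = 2 * I1 f z * a2 z * (a8 z)^2 / (3 * a1 z) - I1 f z * a3 z * a7 z * a8 z / (3 * a1 z)
      - pd 4 (I1 f) z * a2 z * a8 z / (6 * a3 z) - I2 f z * a3 z * (a8 z)^2 / (2 * a1 z)
      + pd 4 (I2 f) z * a8 z / 2 - pd 4 (pd 4 (I2 f)) z * a1 z / (4 * a3 z)
      - a3 z * (a7 z)^2 / (2 * a1 z) - a1 z * a8 z * r2 z" (is "_ = ?T")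
proof -
  note nz = a1_nz[OF z] a3_nz[OF z]
  let ?G = "\<lambda>z. I1 f z * a8 z / 3 - pd 4 (I1 f) z * a1 z / (6 * a3 z) + a2 z * a8 z / a3 z - a7 z"
    and ?H = "\<lambda>z. pd 4 (I1 f) z * a8 z / 6 - pd 4 (pd 4 (I1 f)) z * a1 z / (6 * a3 z) + a2 z * (a8 z)^2 / a1 z
      - a3 z * a7 z * a8 z / a1 z"
  have "pd 3 ?G z = pd 3 (Dhat f a8) z" "Dhat f ?H z = Dhat f (pd 3 a8) z"
    using z by (intro pd_eq D_eq; simp add: D_a8 p_a8)+
  then have "pd 3 ?G z = Dhat f ?H z + pd 3 a7 z"
    using z by (simp add: p_Dhat q_a8 u_a8)
  then show ?thesis
  proof (rule solve_linear)
    show "(pd 3 a7 z - ?T) * (- 2) = pd 3 ?G z - (Dhat f ?H z + pd 3 a7 z)"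
      using z nz by (simp add: pd_rules Dhat_rules D_derivs D_a7 D_a8 p_a1 p_a2 p_a3 p_a8 D_I1q D_I1qq pq)
        (simp add: field_simps power2_eq_square power3_eq_cube power4_eq_xxxx)
  qed simp
qed

text \<open>The symmetry \<open>\<eta>\<^sub>p\<^sub>u = \<eta>\<^sub>u\<^sub>p\<close>.\<close>

lemma u_a2:
  assumes z: "z \<in> U"
  shows "pd 2 a2 z = - (I1 f z * pd 4 (I2 f) z * a3 z / 6) - 2 * I1 f z * a2 z * a3 z * a7 z / (3 * a1 z)
      + 4 * I1 f z * (a2 z)^2 * a8 z / (3 * a1 z) + pd 4 (I1 f) z * I2 f z * a3 z / 6
      - pd 4 (I1 f) z * (a2 z)^2 / (3 * a3 z) - pd 2 (I1 f) z * a3 z / 3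
      - I2 f z * a2 z * a3 z * a8 z / a1 z - I2 f z * (a3 z)^2 * a7 z / (2 * a1 z)
      + pd 3 (I2 f) z * a3 z / 2 + pd 4 (I2 f) z * a2 z / 2 - 3 * (a2 z)^2 * a7 z / (2 * a1 z)
      - 2 * a1 z * a2 z * r2 z" (is "_ = ?T")
proof -
  note nz = a1_nz[OF z] a3_nz[OF z]
  let ?p = "\<lambda>z. a2 z * a3 z / a1 z + (a3 z)\<^sup>2 / (3 * a1 z) * I1 f z"
    and ?u = "\<lambda>z. (a2 z)\<^sup>2 / (2 * a1 z) + (a3 z)\<^sup>2 / (2 * a1 z) * I2 f z"
  have "pd 2 ?p z = pd 2 (pd 3 eta) z" "pd 3 ?u z = pd 3 (pd 2 eta) z"
    using z by (intro pd_eq; simp add: p_eta u_eta)+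
  then have "pd 3 ?u z = pd 2 ?p z"
    using z by (simp add: up)
  then show ?thesis
  proof (rule solve_linear)
    show "(pd 2 a2 z - ?T) * (- (a3 z / a1 z)) = pd 3 ?u z - pd 2 ?p z"
      using z nz by (simp add: pd_rules u_a1 u_a3 p_a1 p_a2 p_a3)
        (simp add: field_simps power2_eq_square power3_eq_cube power4_eq_xxxx)
  qed (use nz in simp)
qed

text \<open>\<open>a\<^sub>7\<close> is free of \<open>q\<close>, so its \<open>p\<close>-derivative is the \<open>q\<close>-derivative of \<open>Da\<^sub>7\<close>, which contains \<open>r\<^sub>2\<close>.\<close>

lemma q_r2:
  assumes z: "z \<in> U"
  shows "pd 4 r2 z = - (I1 f z * (a3 z)^2 * a7 z * a8 z / (3 * (a1 z)^3))
      + pd 4 (I1 f) z * a2 z * a8 z / (2 * (a1 z)^2)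
      - pd 4 (I1 f) z * a3 z * a7 z / (6 * (a1 z)^2)
      - pd 4 (pd 4 (I1 f)) z * a2 z / (6 * a1 z * a3 z)
      + I2 f z * (a3 z)^2 * (a8 z)^2 / (2 * (a1 z)^3)
      - pd 4 (I2 f) z * a3 z * a8 z / (2 * (a1 z)^2) + pd 4 (pd 4 (I2 f)) z / (4 * a1 z)
      + (a3 z)^2 * (a7 z)^2 / (2 * (a1 z)^3)" (is "_ = ?T")
proof -
  note nz = a1_nz[OF z] a3_nz[OF z]
  let ?G = "\<lambda>z. 2 * I1 f z * a2 z * a8 z / (3 * a3 z) - I1 f z * a7 z / 3
      - pd 4 (I1 f) z * a1 z * a2 z / (6 * (a3 z)^2) - (a1 z)^2 * r2 z / a3 z"
  have "pd 4 ?G z = pd 4 (Dhat f a7) z"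
    using z by (intro pd_eq; simp add: D_a7)
  also have "\<dots> = pd 3 a7 z"
    using z by (simp add: q_Dhat q_a7 D_q_zero)
  finally show ?thesis
  proof (rule solve_linear)
    show "(pd 4 r2 z - ?T) * (- ((a1 z)\<^sup>2 / a3 z)) = pd 4 ?G z - pd 3 a7 z"
      using z nz by (simp add: pd_rules q_derivs p_a7)
        (simp add: field_simps power2_eq_square power3_eq_cube power4_eq_xxxx)
  qed (use nz in simp)
qed

text \<open>The symmetry \<open>a\<^sub>2\<^sub>,\<^sub>q\<^sub>u = a\<^sub>2\<^sub>,\<^sub>u\<^sub>q\<close>, used because \<open>a\<^sub>2\<^sub>,\<^sub>q\<close> is a multiple of \<open>a\<^sub>7\<close>.\<close>

lemma u_a7:
  assumes z: "z \<in> U"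
  shows "pd 2 a7 z = - (I1 f z * pd 4 (I2 f) z * a8 z / 6) + I1 f z * pd 4 (pd 4 (I2 f)) z * a1 z / (6 * a3 z)
      + 4 * I1 f z * a2 z * a7 z * a8 z / (3 * a1 z) - 2 * I1 f z * a3 z * (a7 z)^2 / (3 * a1 z)
      + pd 4 (I1 f) z * I2 f z * a8 z / 6 - pd 4 (I1 f) z * a2 z * a7 z / (3 * a3 z)
      - pd 4 (pd 4 (I1 f)) z * I2 f z * a1 z / (6 * a3 z) - pd 2 (I1 f) z * a8 z / 3
      + pd 4 (pd 2 (I1 f)) z * a1 z / (3 * a3 z) - I2 f z * a3 z * a7 z * a8 z / a1 z
      + pd 3 (I2 f) z * a8 z / 2 - pd 4 (pd 3 (I2 f)) z * a1 z / (2 * a3 z)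
      + pd 4 (I2 f) z * a7 z / 2 - a2 z * (a7 z)^2 / a1 z - 2 * a1 z * a7 z * r2 z" (is "_ = ?T")
proof -
  note nz = a1_nz[OF z] a3_nz[OF z]
  let ?q = "\<lambda>z. - ((a3 z)^2 * a7 z / a1 z)"
    and ?u = "\<lambda>z. - (I1 f z * pd 4 (I2 f) z * a3 z / 6) - 2 * I1 f z * a2 z * a3 z * a7 z / (3 * a1 z)
      + 4 * I1 f z * (a2 z)^2 * a8 z / (3 * a1 z) + pd 4 (I1 f) z * I2 f z * a3 z / 6
      - pd 4 (I1 f) z * (a2 z)^2 / (3 * a3 z) - pd 2 (I1 f) z * a3 z / 3
      - I2 f z * a2 z * a3 z * a8 z / a1 z - I2 f z * (a3 z)^2 * a7 z / (2 * a1 z)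
      + pd 3 (I2 f) z * a3 z / 2 + pd 4 (I2 f) z * a2 z / 2 - 3 * (a2 z)^2 * a7 z / (2 * a1 z)
      - 2 * a1 z * a2 z * r2 z"
  have "pd 2 ?q z = pd 2 (pd 4 a2) z" "pd 4 ?u z = pd 4 (pd 2 a2) z"
    using z by (intro pd_eq; simp add: q_a2 u_a2)+
  then have "pd 2 ?q z = pd 4 ?u z"
    using z by (simp add: uq)
  then show ?thesis
  proof (rule solve_linear)
    show "(pd 2 a7 z - ?T) * (- ((a3 z)\<^sup>2 / a1 z)) = pd 2 ?q z - pd 4 ?u z"
      using z nz by (simp add: pd_rules u_a1 u_a3 q_derivs q_r2)
        (simp add: field_simps power2_eq_square power3_eq_cube power4_eq_xxxx)
  qed (use nz in simp)
qed

text \<open>The commutator of \<open>\<partial>\<^sub>u\<close> with \<open>D\<close> applied to \<open>a\<^sub>1\<close>, whose \<open>u\<close>-derivative contains \<open>r\<^sub>2\<close>.\<close>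

lemma D_r2:
  assumes z: "z \<in> U"
  shows "Dhat f r2 z = 2 * Dhat f (I1 f) z * a2 z * a8 z / (3 * (a1 z)^2)
      - Dhat f (I1 f) z * a3 z * a7 z / (3 * (a1 z)^2)
      - Dhat f (I2 f) z * a3 z * a8 z / (2 * (a1 z)^2)
      + I1 f z * pd 4 (I1 f) z * a2 z / (18 * a1 z * a3 z) + I1 f z * pd 4 (I2 f) z / (6 * a1 z)
      - I1 f z * (a2 z)^2 * a8 z / (3 * (a1 z)^2 * a3 z) + I1 f z * r2 z / 3
      - pd 3 (I1 f) z * a2 z / (3 * a1 z * a3 z) - pd 4 (I1 f) z * I2 f z / (4 * a1 z)
      + pd 4 (I1 f) z * (a2 z)^2 / (12 * a1 z * (a3 z)^2) + 2 * pd 2 (I1 f) z / (3 * a1 z)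
      + I2 f z * a3 z * a7 z / (2 * (a1 z)^2) - pd 3 (I2 f) z / (2 * a1 z)
      + pd 4 (I2 f) z * a2 z / (2 * a1 z * a3 z) + (a2 z)^2 * a7 z / (2 * (a1 z)^2 * a3 z)" (is "_ = ?T")
proof -
  note nz = a1_nz[OF z] a3_nz[OF z]
  let ?D = "\<lambda>z. a1 z * a2 z / a3 z"
    and ?u = "\<lambda>z. 4 * I1 f z * a2 z * a8 z / 3 - 2 * I1 f z * a3 z * a7 z / 3
      - pd 4 (I1 f) z * a1 z * a2 z / (3 * a3 z) - I2 f z * a3 z * a8 z + pd 4 (I2 f) z * a1 z / 2
      - 2 * (a1 z)^2 * r2 z - a2 z * a7 z"
  have "Dhat f ?u z = Dhat f (pd 2 a1) z"
    using z by (intro D_eq; simp add: u_a1)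
  also have "\<dots> = pd 2 (Dhat f a1) z"
    using z by (simp add: u_Dhat q_a1)
  also have "\<dots> = pd 2 ?D z"
    using z by (intro pd_eq; simp add: D_a1)
  finally show ?thesis
  proof (rule solve_linear)
    show "(Dhat f r2 z - ?T) * (- 2 * (a1 z)\<^sup>2) = Dhat f ?u z - pd 2 ?D z"
      using z nz by (simp add: pd_rules Dhat_rules u_a1 u_a2 u_a3 D_derivs D_a7 D_a8 D_I1q D_I2q)
        (simp add: field_simps power2_eq_square power3_eq_cube power4_eq_xxxx)
  qed (use nz in simp)
qed

end

section \<open>The forms vanish on the graph of the coefficients\<close>

lemma Theta_nth:
  "Theta f e Y $ 1 = snd e $ 1 * (fst Y $ 2 - fst e $ 3 * fst Y $ 1)"
  "Theta f e Y $ 2 = snd e $ 2 * (fst Y $ 2 - fst e $ 3 * fst Y $ 1) + snd e $ 3 * (fst Y $ 3 - fst e $ 4 * fst Y $ 1)"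
  "Theta f e Y $ 3 = ((snd e $ 2)\<^sup>2 / (2 * snd e $ 1) + (snd e $ 3)\<^sup>2 / (2 * snd e $ 1) * I2 f (fst e))
        * (fst Y $ 2 - fst e $ 3 * fst Y $ 1)
      + (snd e $ 2 * snd e $ 3 / snd e $ 1 + (snd e $ 3)\<^sup>2 / (3 * snd e $ 1) * I1 f (fst e))
        * (fst Y $ 3 - fst e $ 4 * fst Y $ 1)
      + (snd e $ 3)\<^sup>2 / snd e $ 1 * (fst Y $ 4 - f (fst e) * fst Y $ 1)"
  "Theta f e Y $ 4 = snd e $ 4 * (fst Y $ 2 - fst e $ 3 * fst Y $ 1)
      + snd e $ 5 * (fst Y $ 3 - fst e $ 4 * fst Y $ 1) + snd e $ 1 / snd e $ 3 * fst Y $ 1"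
  by (simp_all add: Theta_def Let_def)

lemma da_nth: "da Y $ 1 = snd Y $ 1" "da Y $ 2 = snd Y $ 2" "da Y $ 3 = snd Y $ 3"
    "da Y $ 4 = snd Y $ 4" "da Y $ 5 = snd Y $ 5"
  by (simp_all add: da_def)

lemma Pi_form_nth:
  "Pi_form f e Y $ i = (\<Sum>k\<in>UNIV. Pi_mat (snd e) $ i $ k * da Y $ k)
     + (\<Sum>j\<in>UNIV. (Lambda_mat f (fst e) (snd e) $ i $ j + R_mat f (fst e) (snd e) $ i $ j) * Theta f e Y $ j)"
  by (simp add: Pi_form_def matrix_vector_mult_def)

definition jet_vector :: "(real^4 \<Rightarrow> real) \<Rightarrow> real^4 \<Rightarrow> real^4" where
  "jet_vector f z = vector [1, z$3, z$4, f z]"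

context linearized_ode
begin

definition "y = (\<lambda>z. vector [a1 z, a2 z, a3 z, a7 z, a8 z, r2 z] :: real^6)"

lemma y_nth [simp]: "y z $ 1 = a1 z" "y z $ 2 = a2 z" "y z $ 3 = a3 z" "y z $ 4 = a7 z" "y z $ 5 = a8 z"
    "y z $ 6 = r2 z"
  by (simp_all add: y_def)

text \<open>
  The forms are evaluated on the tangent vectors of the graph that project to \<open>\<partial>\<^sub>q\<close>, \<open>D\<close>, \<open>\<partial>\<^sub>p\<close> and \<open>\<partial>\<^sub>u\<close>. The
  \<open>r\<^sub>2\<close>-component is arbitrary because \<open>Pi_form\<close> does not involve \<open>dr\<^sub>2\<close>. In this frame each \<open>\<theta>\<^sup>j\<close> has few
  nonzero values, which keeps the twenty identities small.
\<close>

lemma Pi_form_q: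
  assumes "z \<in> U"
  shows "Pi_form f (z, y z) (axis 4 1, vector [pd 4 a1 z, pd 4 a2 z, pd 4 a3 z, pd 4 a7 z, pd 4 a8 z, r]) = 0"
  using assms a1_nz[OF assms] a3_nz[OF assms]
  by (simp add: vec_eq_iff forall_5 Pi_form_nth sum_5 sum_4 Theta_nth da_nth Pi_mat_def Lambda_mat_def R_mat_def Let_def
     q_derivs coeff_A_def coeff_B_def coeff_C_def coeff_Q_def coeff_H_def coeff_r1_def coeff_r3_def coeff_r4_def Delta_def axis_def)
        (simp add: field_simps power2_eq_square power3_eq_cube power4_eq_xxxx)

lemma Pi_form_D:
  assumes "z \<in> U"
  shows "Pi_form f (z, y z) (jet_vector f z, vector [Dhat f a1 z, Dhat f a2 z, Dhat f a3 z, Dhat f a7 z, Dhat f a8 z, r]) = 0"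
  using assms a1_nz[OF assms] a3_nz[OF assms]
  by (simp add: vec_eq_iff forall_5 Pi_form_nth sum_5 sum_4 Theta_nth da_nth Pi_mat_def Lambda_mat_def R_mat_def Let_def
     D_derivs D_a7 D_a8 coeff_Q_def Delta_def jet_vector_def)
        (simp add: field_simps power2_eq_square power3_eq_cube power4_eq_xxxx)

lemma Pi_form_p:
  assumes "z \<in> U"
  shows "Pi_form f (z, y z) (axis 3 1, vector [pd 3 a1 z, pd 3 a2 z, pd 3 a3 z, pd 3 a7 z, pd 3 a8 z, r]) = 0"
  using assms a1_nz[OF assms] a3_nz[OF assms]
  by (simp add: vec_eq_iff forall_5 Pi_form_nth sum_5 sum_4 Theta_nth da_nth Pi_mat_def Lambda_mat_def R_mat_def Let_def
     p_a1 p_a2 p_a3 p_a7 p_a8 coeff_A_def coeff_B_def coeff_C_def coeff_Q_def coeff_H_def coeff_r1_def coeff_r3_def coeff_r4_def Delta_def axis_def)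
        (simp add: field_simps power2_eq_square power3_eq_cube power4_eq_xxxx)

lemma Pi_form_u:
  assumes "z \<in> U"
  shows "Pi_form f (z, y z) (axis 2 1, vector [pd 2 a1 z, pd 2 a2 z, pd 2 a3 z, pd 2 a7 z, pd 2 a8 z, r]) = 0"
  using assms a1_nz[OF assms] a3_nz[OF assms]
  by (simp add: vec_eq_iff forall_5 Pi_form_nth sum_5 sum_4 Theta_nth da_nth Pi_mat_def Lambda_mat_def R_mat_def Let_def
     u_a1 u_a2 u_a3 u_a7 u_a8 p_a7 u_f coeff_A_def coeff_B_def coeff_C_def coeff_Q_def coeff_H_def coeff_r1_def coeff_r3_def coeff_r4_def Delta_def axis_def)
        (simp add: field_simps power2_eq_square power3_eq_cube power4_eq_xxxx)

end

section \<open>The two-form on an integral manifold\<close>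

lemma frechet_derivative_linear_family:
  fixes \<alpha> :: "'e::euclidean_space \<Rightarrow> 'e \<Rightarrow> real"
  assumes lin: "\<And>e. linear (\<alpha> e)" and diff: "\<And>b. (\<lambda>e. \<alpha> e b) differentiable (at e0)"
  shows "frechet_derivative (\<lambda>e. \<alpha> e W) (at e0) X
    = (\<Sum>b\<in>Basis. (W \<bullet> b) * frechet_derivative (\<lambda>e. \<alpha> e b) (at e0) X)"
proof -
  have eq: "(\<lambda>e. \<alpha> e W) = (\<lambda>e. \<Sum>b\<in>Basis. (W \<bullet> b) * \<alpha> e b)"
  proof
    fix e
    interpret linear "\<alpha> e" by (rule lin)
    show "\<alpha> e W = (\<Sum>b\<in>Basis. (W \<bullet> b) * \<alpha> e b)"
      by (subst (1) euclidean_representation[of W, symmetric]) (simp add: sum scale)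
  qed
  have "((\<lambda>e. \<Sum>b\<in>Basis. (W \<bullet> b) * \<alpha> e b) has_derivative
      (\<lambda>X. \<Sum>b\<in>Basis. (W \<bullet> b) * frechet_derivative (\<lambda>e. \<alpha> e b) (at e0) X)) (at e0)"
    using has_derivative_frechet[OF diff] by (intro has_derivative_sum has_derivative_mult_right)
  from frechet_derivative_at[OF this] show ?thesis
    unfolding eq by (simp add: fun_eq_iff)
qed

text \<open>
  The pull-back of \<open>\<alpha>\<close> along \<open>\<sigma>\<close> vanishes identically, hence so does its exterior derivative, which is
  the pull-back of \<open>d\<alpha>\<close>: the second derivatives of \<open>\<sigma>\<close> cancel by symmetry.
\<close>

lemma ext_deriv_on_integral_manifold:
  fixes \<alpha> :: "'e::euclidean_space \<Rightarrow> 'e \<Rightarrow> real" and \<sigma> :: "'m::real_normed_vector \<Rightarrow> 'e"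
  assumes U: "open U" "z \<in> U"
    and lin: "\<And>e. linear (\<alpha> e)" and diff: "\<And>W. (\<lambda>e. \<alpha> e W) differentiable (at (\<sigma> z))"
    and \<sigma>: "(\<sigma> has_derivative \<sigma>' z) (at z)"
    and \<sigma>': "\<And>Y. ((\<lambda>x. \<sigma>' x Y) has_derivative S Y) (at z)"
    and sym: "\<And>X Y. S Y X = S X Y"
    and zero: "\<And>x Y. x \<in> U \<Longrightarrow> \<alpha> (\<sigma> x) (\<sigma>' x Y) = 0"
  shows "ext_deriv \<alpha> (\<sigma> z) (\<sigma>' z X) (\<sigma>' z Y) = 0"
proof -
  have expand: "\<alpha> e W = (\<Sum>b\<in>Basis. (W \<bullet> b) * \<alpha> e b)" for e W
  proof -
    interpret linear "\<alpha> e" by (rule lin)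
    show ?thesis by (subst (1) euclidean_representation[of W, symmetric]) (simp add: sum scale)
  qed
  have "frechet_derivative (\<lambda>e. \<alpha> e (\<sigma>' z Y)) (at (\<sigma> z)) (\<sigma>' z X) = - \<alpha> (\<sigma> z) (S Y X)" for X Y
  proof -
    let ?D = "\<lambda>b X. (\<sigma>' z Y \<bullet> b) * frechet_derivative (\<lambda>e. \<alpha> e b) (at (\<sigma> z)) (\<sigma>' z X) + (S Y X \<bullet> b) * \<alpha> (\<sigma> z) b"
    have chain: "((\<lambda>x. \<alpha> (\<sigma> x) b) has_derivative (\<lambda>X. frechet_derivative (\<lambda>e. \<alpha> e b) (at (\<sigma> z)) (\<sigma>' z X))) (at z)" for b
      using has_derivative_compose[OF \<sigma> has_derivative_frechet[OF diff]] .
    have "((\<lambda>x. \<Sum>b\<in>Basis. (\<sigma>' x Y \<bullet> b) * \<alpha> (\<sigma> x) b) has_derivative (\<lambda>X. \<Sum>b\<in>Basis. ?D b X)) (at z)"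
      by (intro has_derivative_sum has_derivative_mult has_derivative_inner_left \<sigma>' chain)
    moreover have "((\<lambda>x. \<Sum>b\<in>Basis. (\<sigma>' x Y \<bullet> b) * \<alpha> (\<sigma> x) b) has_derivative (\<lambda>X. 0)) (at z)"
      by (rule has_derivative_transform_within_open[OF has_derivative_const U])
         (simp add: zero flip: expand)
    ultimately have "(\<lambda>X. \<Sum>b\<in>Basis. ?D b X) = (\<lambda>X. 0)"
      by (rule has_derivative_unique)
    then have "(\<Sum>b\<in>Basis. ?D b X) = 0"
      by (rule fun_cong)
    moreover have "(\<Sum>b\<in>Basis. ?D b X)
        = frechet_derivative (\<lambda>e. \<alpha> e (\<sigma>' z Y)) (at (\<sigma> z)) (\<sigma>' z X) + \<alpha> (\<sigma> z) (S Y X)"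
      unfolding frechet_derivative_linear_family[of \<alpha>, OF lin diff, of "\<sigma>' z Y"] sum.distrib
      by (rule arg_cong[OF expand[symmetric]])
    ultimately show ?thesis
      by simp
  qed
  then show ?thesis
    unfolding ext_deriv_def by (simp add: sym)
qed

subsection \<open>The exterior derivative of the fourth form\<close>

lemma linear_Pi_form: "linear (\<lambda>Y. Pi_form f e Y $ i)"
proof (rule linearI)
  have da: "da (X + Y) = da X + da Y" "da (c *\<^sub>R X) = c *\<^sub>R da X" for X Y c
    by (simp_all add: vec_eq_iff forall_5 da_nth)
  have Th: "Theta f e (X + Y) = Theta f e X + Theta f e Y" "Theta f e (c *\<^sub>R X) = c *\<^sub>R Theta f e X" for X Y c
    by (simp_all add: vec_eq_iff forall_4 Theta_nth algebra_simps add_divide_distrib diff_divide_distrib)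
  show "Pi_form f e (X + Y) $ i = Pi_form f e X $ i + Pi_form f e Y $ i" for X Y
    by (simp add: Pi_form_def da Th matrix_vector_right_distrib)
  show "Pi_form f e (c *\<^sub>R X) $ i = c *\<^sub>R Pi_form f e X $ i" for X c
    by (simp add: Pi_form_def da Th matrix_vector_mult_scaleR algebra_simps)
qed

lemma differentiable_fst: "g differentiable (at (fst e)) \<Longrightarrow> (\<lambda>e. g (fst e)) differentiable (at e)"
  using differentiable_compose[of g fst e UNIV]
  by (simp add: bounded_linear_imp_differentiable bounded_linear_fst)

lemma differentiable_snd_nth: "(\<lambda>e. snd e $ i) differentiable (at e)"
  by (intro bounded_linear_imp_differentiable bounded_linear_compose[OF bounded_linear_vec_nth bounded_linear_snd, unfolded o_def])

lemma differentiable_fst_nth: "(\<lambda>e. fst e $ i) differentiable (at e)"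
  by (intro bounded_linear_imp_differentiable bounded_linear_compose[OF bounded_linear_vec_nth bounded_linear_fst, unfolded o_def])

lemma Pi_form_4_differentiable:
  assumes U: "open U" "smooth_on U f" "fst e \<in> U" and nz: "snd e $ 1 \<noteq> 0" "snd e $ 3 \<noteq> 0"
  shows "(\<lambda>e. Pi_form f e W $ 4) differentiable (at e)"
proof -
  have sm: "smooth_on U (I1 f)" "smooth_on U (I2 f)" using U by (simp_all add: smooth_on_I1 smooth_on_I2)
  have [simp]: "(\<lambda>e. g (fst e)) differentiable (at e)" if "smooth_on U g" for g :: "real^4 \<Rightarrow> real"
    using differentiable_fst smooth_on_differentiable that U(3) by blast
  note [simp] = sm smooth_on_pd U(2) differentiable_snd_nth differentiable_fst_nth nz
  show ?thesis
    by (simp add: Pi_form_nth sum_5 sum_4 Theta_nth da_nth Pi_mat_def Lambda_mat_def R_mat_def Let_def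
       coeff_Q_def coeff_C_def coeff_r1_def coeff_r3_def Delta_def)
qed

text \<open>Reduces the directional derivatives of \<open>Pi_form\<close> to derivatives of functions of one real variable.\<close>

lemma frechet_derivative_along_line:
  fixes g :: "'a::real_normed_vector \<Rightarrow> real"
  assumes "g differentiable (at e)" and line: "((\<lambda>t. g (e + t *\<^sub>R v)) has_real_derivative d) (at 0)"
  shows "frechet_derivative g (at e) v = d"
proof -
  have "((\<lambda>t. e + t *\<^sub>R v) has_derivative (\<lambda>t. t *\<^sub>R v)) (at (0::real))"
    by (auto intro!: derivative_eq_intros)
  from has_derivative_compose[OF this, of g "frechet_derivative g (at e)"]
  have "((\<lambda>t. g (e + t *\<^sub>R v)) has_derivative (\<lambda>t. frechet_derivative g (at e) (t *\<^sub>R v))) (at 0)"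
    using has_derivative_frechet[OF assms(1)] by simp
  then have "(\<lambda>t. frechet_derivative g (at e) (t *\<^sub>R v)) = (*) d"
    using line unfolding has_field_derivative_def by (rule has_derivative_unique)
  then show ?thesis
    by (metis mult.right_neutral scaleR_one)
qed

text \<open>The fourth row of \<open>Pi_mat\<close> at the point \<open>a + t b\<close>, applied to a vector \<open>c\<close>.\<close>

lemma Pi_row_4_derivative:
  fixes a1 a2 a3 a7 a8 b1 b2 b3 b7 b8 c1 c3 c4 c5 :: real
  assumes "a1 \<noteq> 0" "a3 \<noteq> 0"
  shows "((\<lambda>t. ((a2 + t * b2) * (a8 + t * b8) - (a3 + t * b3) * (a7 + t * b7)) * c1 / ((a1 + t * b1)\<^sup>2 * (a3 + t * b3))
      - ((a2 + t * b2) * (a8 + t * b8) - (a3 + t * b3) * (a7 + t * b7)) * c3 / ((a1 + t * b1) * (a3 + t * b3)\<^sup>2)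
      + c4 / (a1 + t * b1) - (a2 + t * b2) * c5 / ((a1 + t * b1) * (a3 + t * b3))) has_real_derivative
    ((b2 * a8 + a2 * b8 - b3 * a7 - a3 * b7) / (a1\<^sup>2 * a3)
        - (a2 * a8 - a3 * a7) * (2 * b1 / (a1^3 * a3) + b3 / (a1\<^sup>2 * a3\<^sup>2))) * c1
     - ((b2 * a8 + a2 * b8 - b3 * a7 - a3 * b7) / (a1 * a3\<^sup>2)
        - (a2 * a8 - a3 * a7) * (b1 / (a1\<^sup>2 * a3\<^sup>2) + 2 * b3 / (a1 * a3^3))) * c3
     - b1 / a1\<^sup>2 * c4
     - (b2 / (a1 * a3) - a2 * (b1 / (a1\<^sup>2 * a3) + b3 / (a1 * a3\<^sup>2))) * c5) (at 0)"
  using assms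
  by (auto intro!: derivative_eq_intros)
        (simp add: field_simps power2_eq_square power3_eq_cube power4_eq_xxxx)

text \<open>
  The \<open>da\<close>- and \<open>dr\<^sub>2\<close>-components of \<open>\<rho>'\<^sup>2\<close>. All \<open>\<theta>\<^sup>j\<close> vanish on the vertical vector \<open>(0, w)\<close>, and on
  \<open>d_theta4\<close> only \<open>\<theta>\<^sup>4\<close> does not, even when the fibre coordinates move. Hence of the coefficients of \<open>\<pi>'\<^sup>4\<close>
  only the row of \<open>Pi_mat\<close> and the entry \<open>r\<^sub>2\<close> of \<open>R_mat\<close> are differentiated.
\<close>

lemma rho2_vertical:
  assumes U: "open U" "smooth_on U f" "z \<in> U" and nz: "y $ 1 \<noteq> 0" "y $ 3 \<noteq> 0"
  shows "rho2_form f (z, y) (0, w) = (\<Sum>i\<in>UNIV. beta f z y $ i * da (0::real^4, w) $ i) + w $ 6"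
proof -
  define V where "V = snd (d_theta4 f (z, y))"
  have V: "d_theta4 f (z, y) = ((y$3 / y$1) *\<^sub>R jet_vector f z, V)"
    by (simp add: V_def d_theta4_def Let_def jet_vector_def)
  note diff = Pi_form_4_differentiable[OF U(1,2), of "(z, y)", simplified, OF U(3) nz]
  \<comment> \<open>The value of \<open>r\<^sub>2 \<theta>\<^sup>4\<close> on \<open>d_theta4\<close>, as the fibre coordinates move from \<open>y\<close> to \<open>y + t w\<close>.\<close>
  have scale: "((\<lambda>t. (y $ 6 + t * w $ 6) * ((y $ 1 + t * w $ 1) * y $ 3) / ((y $ 3 + t * w $ 3) * y $ 1))
      has_real_derivative (w $ 6 + y $ 6 * (w $ 1 / y $ 1 - w $ 3 / y $ 3))) (at 0)"
    using nz by (auto intro!: derivative_eq_intros) (simp add: field_simps power2_eq_square)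
  note D = Pi_row_4_derivative[OF nz, of "y $ 2" _ "y $ 5" _ _ "y $ 4"]
  have along_theta4: "((\<lambda>t. Pi_form f ((z, y) + t *\<^sub>R d_theta4 f (z, y)) (0, w) $ 4) has_real_derivative d) (at 0)"
    if "((\<lambda>t. ((y $ 2 + t * V $ 2) * (y $ 5 + t * V $ 5) - (y $ 3 + t * V $ 3) * (y $ 4 + t * V $ 4)) * w $ 1
          / ((y $ 1 + t * V $ 1)\<^sup>2 * (y $ 3 + t * V $ 3))
        - ((y $ 2 + t * V $ 2) * (y $ 5 + t * V $ 5) - (y $ 3 + t * V $ 3) * (y $ 4 + t * V $ 4)) * w $ 3
          / ((y $ 1 + t * V $ 1) * (y $ 3 + t * V $ 3)\<^sup>2)
        + w $ 4 / (y $ 1 + t * V $ 1)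
        - (y $ 2 + t * V $ 2) * w $ 5 / ((y $ 1 + t * V $ 1) * (y $ 3 + t * V $ 3))) has_real_derivative d) (at 0)" for d
    using that by (simp add: Pi_form_nth Theta_nth da_nth sum_5 sum_4 Pi_mat_def Delta_def Let_def V)
  have along_w: "((\<lambda>t. Pi_form f ((z, y) + t *\<^sub>R (0, w)) (d_theta4 f (z, y)) $ 4) has_real_derivative d) (at 0)"
    if "((\<lambda>t. ((y $ 2 + t * w $ 2) * (y $ 5 + t * w $ 5) - (y $ 3 + t * w $ 3) * (y $ 4 + t * w $ 4)) * V $ 1
          / ((y $ 1 + t * w $ 1)\<^sup>2 * (y $ 3 + t * w $ 3))
        - ((y $ 2 + t * w $ 2) * (y $ 5 + t * w $ 5) - (y $ 3 + t * w $ 3) * (y $ 4 + t * w $ 4)) * V $ 3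
          / ((y $ 1 + t * w $ 1) * (y $ 3 + t * w $ 3)\<^sup>2)
        + V $ 4 / (y $ 1 + t * w $ 1)
        - (y $ 2 + t * w $ 2) * V $ 5 / ((y $ 1 + t * w $ 1) * (y $ 3 + t * w $ 3))
        + (y $ 6 + t * w $ 6) * ((y $ 1 + t * w $ 1) * y $ 3) / ((y $ 3 + t * w $ 3) * y $ 1))
        has_real_derivative d) (at 0)" for d
    using that by (simp add: Pi_form_nth Theta_nth da_nth sum_5 sum_4 Pi_mat_def Delta_def Let_def V
        R_mat_def Lambda_mat_def jet_vector_def)
  obtain a1 a2 a3 a7 a8 where a: "a1 = y $ 1" "a2 = y $ 2" "a3 = y $ 3" "a7 = y $ 4" "a8 = y $ 5"
    by blast
  note nz' = nz[folded a]
  define N where "N = V $ 2 * a8 + a2 * V $ 5 - V $ 3 * a7 - a3 * V $ 4"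
  have "rho2_form f (z, y) (0, w) =
      (y $ 6 / a1 - N / (a1\<^sup>2 * a3) + 2 * (a2 * a8 - a3 * a7) * V $ 3 / (a1\<^sup>2 * a3\<^sup>2) - V $ 4 / a1\<^sup>2
         + a2 * V $ 5 / (a1\<^sup>2 * a3)) * w $ 1
    + (a8 * V $ 1 / (a1\<^sup>2 * a3) - a8 * V $ 3 / (a1 * a3\<^sup>2) - V $ 5 / (a1 * a3)) * w $ 2
    + (N / (a1 * a3\<^sup>2) - 2 * (a2 * a8 - a3 * a7) * V $ 1 / (a1\<^sup>2 * a3\<^sup>2) - a7 * V $ 1 / (a1\<^sup>2 * a3)
         + a7 * V $ 3 / (a1 * a3\<^sup>2) + a2 * V $ 5 / (a1 * a3\<^sup>2) - y $ 6 / a3) * w $ 3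
    + V $ 3 / (a1 * a3) * w $ 4
    + (V $ 2 / (a1 * a3) - 2 * a2 * V $ 3 / (a1 * a3\<^sup>2)) * w $ 5 + w $ 6" (is "_ = ?k1 * _ + ?k2 * _ + ?k3 * _ + ?k4 * _ + ?k5 * _ + _")
    unfolding rho2_form_def ext_deriv_def
      frechet_derivative_along_line[OF diff along_theta4, OF D]
      frechet_derivative_along_line[OF diff along_w, OF DERIV_add[OF D scale]] a[symmetric]
    using nz' unfolding N_def
    by (simp add: field_simps power2_eq_square power3_eq_cube)
  moreover have "?k1 = beta f z y $ 1" "?k2 = beta f z y $ 2" "?k3 = beta f z y $ 3"
    "?k4 = beta f z y $ 4" "?k5 = beta f z y $ 5"
    using nz' by (simp_all add: N_def V_def d_theta4_def beta_def Let_def a[symmetric])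
      (simp_all add: field_simps power2_eq_square power3_eq_cube)
  ultimately show ?thesis
    by (simp only: sum_5 da_nth snd_conv)
qed

section \<open>The dual frame and the last row of the system\<close>

text \<open>The frame dual to \<open>\<theta>\<^sup>1, \<dots>, \<theta>\<^sup>4\<close>; the operators \<open>ops\<close> differentiate along it.\<close>

definition Theta_dual :: "(real^4 \<Rightarrow> real) \<Rightarrow> real^4 \<Rightarrow> real^6 \<Rightarrow> 4 \<Rightarrow> real^4" where
  "Theta_dual f z y j =
     (let a1 = y$1; a2 = y$2; a3 = y$3; a8 = y$5; i1 = I1 f z; i2 = I2 f z; X = jet_vector f z
      in (vector
        [(Delta y / a1^2) *\<^sub>R X + (1/a1) *\<^sub>R axis 2 1 - (a2 / (a1*a3)) *\<^sub>R axis 3 1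
           + ((2*a2*a3*i1 - 3*a3^2*i2 + 3*a2^2) / (6*a1*a3^2)) *\<^sub>R axis 4 1,
         - (a8/a1) *\<^sub>R X + (1/a3) *\<^sub>R axis 3 1 - ((a3*i1 + 3*a2) / (3*a3^2)) *\<^sub>R axis 4 1,
         (a1 / a3^2) *\<^sub>R axis 4 1,
         (a3/a1) *\<^sub>R X] :: real^4^4) $ j)"

lemma axis_nth: "axis i (1::real) $ k = (if k = i then 1 else 0)"
  by (simp add: axis_def)

lemma Theta_dual:
  assumes "y $ 1 \<noteq> 0" "y $ 3 \<noteq> 0"
  shows "Theta f (z, y) (Theta_dual f z y j, w) $ i = (if i = j then 1 else 0)"
proof -
  have "\<forall>i j. Theta f (z, y) (Theta_dual f z y j, w) $ i = (if i = j then 1 else 0)"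
    using assms
    by (simp add: forall_4 Theta_nth Theta_dual_def Let_def jet_vector_def axis_nth Delta_def)
       (simp add: field_simps power2_eq_square)
  then show ?thesis by blast
qed

lemma frame_decomposition:
  assumes "y $ 1 \<noteq> 0" "y $ 3 \<noteq> 0"
  shows "Y = (0, snd Y) + (\<Sum>j\<in>UNIV. Theta f (z, y) Y $ j *\<^sub>R (Theta_dual f z y j, 0))"
proof -
  have "fst Y = (\<Sum>j\<in>UNIV. Theta f (z, y) Y $ j *\<^sub>R Theta_dual f z y j)"
    using assms
    by (simp add: vec_eq_iff forall_4 sum_4 Theta_nth Theta_dual_def Let_def jet_vector_def axis_nth Delta_def)
       (simp add: field_simps power2_eq_square)
  then show ?thesis
    by (simp add: prod_eq_iff fst_sum snd_sum)
qed

lemma linear_rho2: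
  assumes U: "open U" "smooth_on U f" "z \<in> U" and nz: "y $ 1 \<noteq> 0" "y $ 3 \<noteq> 0"
  shows "linear (rho2_form f (z, y))"
proof -
  note diff = Pi_form_4_differentiable[OF U(1,2), of "(z, y)", simplified, OF U(3) nz]
  note expand = frechet_derivative_linear_family[of "\<lambda>e Y. Pi_form f e Y $ 4", OF linear_Pi_form diff]
  have 1: "linear (\<lambda>Y. frechet_derivative (\<lambda>e. Pi_form f e Y $ 4) (at (z, y)) X)" for X
  proof -
    have "linear (\<lambda>Y. \<Sum>b\<in>Basis. (Y \<bullet> b) * frechet_derivative (\<lambda>e. Pi_form f e b $ 4) (at (z, y)) X)"
      by (rule linearI) (simp_all add: inner_add_left algebra_simps sum.distrib sum_distrib_left)
    also have "(\<lambda>Y. \<Sum>b\<in>Basis. (Y \<bullet> b) * frechet_derivative (\<lambda>e. Pi_form f e b $ 4) (at (z, y)) X)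
        = (\<lambda>Y. frechet_derivative (\<lambda>e. Pi_form f e Y $ 4) (at (z, y)) X)"
      by (rule ext) (rule expand[symmetric])
    finally show ?thesis .
  qed
  have 2: "linear (\<lambda>Y. frechet_derivative (\<lambda>e. Pi_form f e X $ 4) (at (z, y)) Y)" for X
    using linear_frechet_derivative[OF diff] .
  show ?thesis
    unfolding rho2_form_def[abs_def] ext_deriv_def
    by (intro linear_compose_neg linear_compose_sub 1 2)
qed

text \<open>
  This justifies the definite description \<open>coeff_s\<close>: the values of \<open>\<rho>'\<^sup>2\<close> on the dual frame are the only
  candidates for the coefficients \<open>s\<^sub>i\<close>, and they work because \<open>rho2_vertical\<close> gives the rest of \<open>\<rho>'\<^sup>2\<close>.
\<close>

lemma rho2_expansion:
  assumes U: "open U" "smooth_on U f" "z \<in> U" and nz: "y $ 1 \<noteq> 0" "y $ 3 \<noteq> 0"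
  shows "rho2_form f (z, y) Y
     = (\<Sum>i\<in>UNIV. beta f z y $ i * da Y $ i) + snd Y $ 6 + (\<Sum>i\<in>UNIV. coeff_s f z y $ i * Theta f (z, y) Y $ i)"
proof -
  interpret linear "rho2_form f (z, y)" by (rule linear_rho2[OF U nz])
  let ?P = "\<lambda>s. \<forall>Y. rho2_form f (z, y) Y
     = (\<Sum>i\<in>UNIV. beta f z y $ i * da Y $ i) + snd Y $ 6 + (\<Sum>i\<in>UNIV. s $ i * Theta f (z, y) Y $ i)"
  let ?s = "(\<chi> j. rho2_form f (z, y) (Theta_dual f z y j, 0)) :: real^4"
  have "?P ?s"
  proof
    fix Y :: "(real^4) \<times> (real^6)"
    have "rho2_form f (z, y) Y
        = rho2_form f (z, y) ((0, snd Y) + (\<Sum>j\<in>UNIV. Theta f (z, y) Y $ j *\<^sub>R (Theta_dual f z y j, 0)))"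
      by (rule arg_cong[OF frame_decomposition[OF nz]])
    also have "\<dots> = rho2_form f (z, y) (0, snd Y)
        + (\<Sum>j\<in>UNIV. Theta f (z, y) Y $ j * rho2_form f (z, y) (Theta_dual f z y j, 0))"
      by (simp only: add sum scale real_scaleR_def)
    finally show "rho2_form f (z, y) Y = (\<Sum>i\<in>UNIV. beta f z y $ i * da Y $ i) + snd Y $ 6
        + (\<Sum>i\<in>UNIV. ?s $ i * Theta f (z, y) Y $ i)"
      by (simp add: rho2_vertical[OF U nz] da_def mult.commute)
  qed
  moreover have "s = t" if "?P s" "?P t" for s t
  proof -
    have "(\<Sum>i\<in>UNIV. s $ i * Theta f (z, y) (Theta_dual f z y j, 0) $ i)
        = (\<Sum>i\<in>UNIV. t $ i * Theta f (z, y) (Theta_dual f z y j, 0) $ i)" for j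
      using that[THEN spec, of "(Theta_dual f z y j, 0)"] by linarith
    then show "s = t"
      by (simp add: Theta_dual[OF nz] vec_eq_iff if_distrib cong: if_cong)
  qed
  ultimately have "?P (coeff_s f z y)"
    unfolding coeff_s_def by (intro theI[where P = ?P]) blast+
  then show ?thesis by blast
qed

lemma frechet_derivative_pd:
  assumes "g differentiable (at z)"
  shows "frechet_derivative g (at z) Y = (\<Sum>j\<in>UNIV. Y $ j * pd j g z)"
proof -
  interpret linear "frechet_derivative g (at z)" by (rule linear_frechet_derivative[OF assms])
  have Y: "Y = (\<Sum>j\<in>UNIV. Y $ j *\<^sub>R axis j 1)"
    by (simp add: vec_eq_iff axis_def if_distrib cong: if_cong)
  show ?thesis
    by (subst Y) (simp add: sum scale pd_def)
qed

lemma frechet_derivative_frame: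
  assumes "g differentiable (at z)"
  shows "frechet_derivative g (at z) Y = Y $ 1 * Dhat f g z + (Y $ 2 - z $ 3 * Y $ 1) * pd 2 g z
     + (Y $ 3 - z $ 4 * Y $ 1) * pd 3 g z + (Y $ 4 - f z * Y $ 1) * pd 4 g z"
  by (simp add: frechet_derivative_pd[OF assms] sum_4 Dhat_def total2_def algebra_simps)

lemma ops_eq_frechet:
  assumes "g differentiable (at z)"
  shows "ops f z y g $ j = frechet_derivative g (at z) (Theta_dual f z y j)"
proof -
  have "\<forall>j. ops f z y g $ j = frechet_derivative g (at z) (Theta_dual f z y j)"
    by (simp add: forall_4 frechet_derivative_frame[OF assms, of _ f] ops_def Theta_dual_def Let_def
        jet_vector_def axis_nth)
  then show ?thesis ..
qed

definition section_derivative :: "(real^4 \<Rightarrow> real^6) \<Rightarrow> real^4 \<Rightarrow> real^4 \<Rightarrow> real^6" where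
  "section_derivative y z Y = (\<chi> i. frechet_derivative (\<lambda>z. y z $ i) (at z) Y)"

lemma has_derivative_vec_nth:
  fixes g :: "'a::real_normed_vector \<Rightarrow> real^'n::finite"
  assumes "\<And>i. ((\<lambda>x. g x $ i) has_derivative (\<lambda>h. D h $ i)) (at x)"
  shows "(g has_derivative D) (at x)"
  unfolding has_derivative_componentwise_within[where f = g]
  using assms by (auto simp: Basis_vec_def inner_axis)

text \<open>
  The instance of \<open>ext_deriv_on_integral_manifold\<close> for the graph \<open>z \<mapsto> (z, y z)\<close>. The family \<open>S\<close> is its second
  derivative, whose symmetry is that of the second partial derivatives.
\<close>

lemma ext_deriv_Pi_on_section:
  assumes U: "open U" "smooth_on U f" "z \<in> U" and y: "\<And>i. smooth_on U (\<lambda>z. y z $ i)"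
    and nz: "y z $ 1 \<noteq> 0" "y z $ 3 \<noteq> 0"
    and zero: "\<And>z Y. z \<in> U \<Longrightarrow> Pi_form f (z, y z) (Y, section_derivative y z Y) = 0"
  shows "ext_deriv (\<lambda>e Y. Pi_form f e Y $ 4) (z, y z)
           (X, section_derivative y z X) (Y, section_derivative y z Y) = 0"
proof (rule ext_deriv_on_integral_manifold[where \<sigma> = "\<lambda>z. (z, y z)" and z = z and U = U
      and \<sigma>' = "\<lambda>z Y. (Y, section_derivative y z Y)"
      and S = "\<lambda>Y X. (0, \<chi> i. \<Sum>j\<in>UNIV. Y $ j * (\<Sum>k\<in>UNIV. X $ k * pd k (pd j (\<lambda>z. y z $ i)) z))", OF U(1,3)])
  show "linear (\<lambda>Y. Pi_form f e Y $ 4)" for e by (rule linear_Pi_form)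
  show "(\<lambda>e. Pi_form f e W $ 4) differentiable at (z, y z)" for W
    by (rule Pi_form_4_differentiable[OF U(1,2)]) (simp_all add: U nz)
  show "((\<lambda>z. (z, y z)) has_derivative (\<lambda>Y. (Y, section_derivative y z Y))) (at z)"
    using has_derivative_frechet[OF smooth_on_differentiable[OF y U(3)]]
    by (intro has_derivative_Pair has_derivative_ident has_derivative_vec_nth)
       (simp add: section_derivative_def)
  show "((\<lambda>x. (Y, section_derivative y x Y)) has_derivative
         (\<lambda>X. (0, \<chi> i. \<Sum>j\<in>UNIV. Y $ j * (\<Sum>k\<in>UNIV. X $ k * pd k (pd j (\<lambda>z. y z $ i)) z)))) (at z)" for Y
  proof (intro has_derivative_Pair has_derivative_const has_derivative_vec_nth)
    fix i
    have d: "(pd j (\<lambda>z. y z $ i) has_derivative (\<lambda>X. \<Sum>k\<in>UNIV. X $ k * pd k (pd j (\<lambda>z. y z $ i)) z)) (at z)" for j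
      using smooth_on_differentiable[OF smooth_on_pd[OF y] U(3)]
      by (simp add: has_derivative_frechet flip: frechet_derivative_pd)
    have "((\<lambda>x. \<Sum>j\<in>UNIV. Y $ j * pd j (\<lambda>z. y z $ i) x) has_derivative
        (\<lambda>X. \<Sum>j\<in>UNIV. Y $ j * (\<Sum>k\<in>UNIV. X $ k * pd k (pd j (\<lambda>z. y z $ i)) z))) (at z)"
      by (intro has_derivative_sum has_derivative_mult_right d)
    then show "((\<lambda>x. section_derivative y x Y $ i) has_derivative (\<lambda>X. (\<chi> i. \<Sum>j\<in>UNIV. Y $ j *
        (\<Sum>k\<in>UNIV. X $ k * pd k (pd j (\<lambda>z. y z $ i)) z)) $ i)) (at z)"
      by (rule has_derivative_transform_within_open[OF _ U(1,3), THEN has_derivative_eq_rhs])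
         (simp_all add: section_derivative_def frechet_derivative_pd smooth_on_differentiable[OF y])
  qed
  show "(0, \<chi> i. \<Sum>j\<in>UNIV. Y $ j * (\<Sum>k\<in>UNIV. X $ k * pd k (pd j (\<lambda>z. y z $ i)) z))
      = (0, \<chi> i. \<Sum>j\<in>UNIV. X $ j * (\<Sum>k\<in>UNIV. Y $ k * pd k (pd j (\<lambda>z. y z $ i)) z))" for X Y :: "real^4"
  proof -
    have "(\<Sum>j\<in>UNIV. Y $ j * (\<Sum>k\<in>UNIV. X $ k * pd k (pd j (\<lambda>z. y z $ i)) z))
      = (\<Sum>j\<in>UNIV. X $ j * (\<Sum>k\<in>UNIV. Y $ k * pd k (pd j (\<lambda>z. y z $ i)) z))" for i
      unfolding sum_distrib_left
      by (subst sum.swap, intro sum.cong refl)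
         (simp add: pd_commute[OF U(1,3) y, of _ _] mult.left_commute)
    then show ?thesis by simp
  qed
  show "Pi_form f (x, y x) (Y, section_derivative y x Y) $ 4 = 0" if "x \<in> U" for x Y
    using zero[OF that] by simp
qed

text \<open>The kernel is trivial: rows 1, 3, 5, then 2 and 4, then 6 successively determine one entry each.\<close>

lemma invertible_lhs_mat:
  assumes "y $ 1 \<noteq> 0" "y $ 3 \<noteq> 0"
  shows "invertible (lhs_mat f z y)"
  unfolding invertible_left_inverse matrix_left_invertible_ker
proof (intro allI impI)
  fix x :: "real^6" assume "lhs_mat f z y *v x = 0"
  then have eq: "(lhs_mat f z y *v x) $ i = 0" for i by simp
  have "x $ 1 = 0" "x $ 3 = 0"
    using eq[of 1] eq[of 3] assms
    by (simp_all add: matrix_vector_mult_def sum_6 lhs_mat_def Let_def append_entry_def Pi_mat_def)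
  moreover from this have "x $ 5 = 0"
    using eq[of 5] assms
    by (simp add: matrix_vector_mult_def sum_6 lhs_mat_def Let_def append_entry_def Pi_mat_def)
  moreover have "x $ 2 = 0" "x $ 4 = 0"
    using eq[of 2] eq[of 4] assms calculation
    by (simp_all add: matrix_vector_mult_def sum_6 lhs_mat_def Let_def append_entry_def Pi_mat_def)
  moreover have "x $ 6 = 0"
    using eq[of 6] calculation
    by (simp add: matrix_vector_mult_def sum_6 lhs_mat_def Let_def append_entry_def)
  ultimately show "x = 0"
    by (simp add: vec_eq_iff forall_6)
qed

text \<open>
  The rows of \<open>lhs_mat ** O = - rhs_mat\<close>, where \<open>O\<close> collects the derivatives of \<open>y\<close> along the dual frame, say that
  the five forms and \<open>\<rho>'\<^sup>2\<close> vanish on the lifts of the dual frame to the graph. For \<open>\<rho>'\<^sup>2\<close> this holds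
  because it contracts \<open>d\<pi>'\<^sup>4\<close> with \<open>d_theta4\<close>, which is itself tangent to the graph.
\<close>

lemma full_auxiliary_systemI:
  assumes U: "open U" "smooth_on U f" and y: "\<And>i. smooth_on U (\<lambda>z. y z $ i)"
    and nz: "\<And>z. z \<in> U \<Longrightarrow> y z $ 1 \<noteq> 0" "\<And>z. z \<in> U \<Longrightarrow> y z $ 3 \<noteq> 0"
    and zero: "\<And>z Y. z \<in> U \<Longrightarrow> Pi_form f (z, y z) (Y, section_derivative y z Y) = 0"
    and tangent: "\<And>z. z \<in> U \<Longrightarrow> \<exists>X. d_theta4 f (z, y z) = (X, section_derivative y z X)"
  shows "full_auxiliary_system f U y"
  unfolding full_auxiliary_system_def
proof
  fix z assume z: "z \<in> U"
  let ?L = "lhs_mat f z (y z)" and ?M = "Lambda_mat f z (y z) + R_mat f z (y z)"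
  let ?e = "\<lambda>j. Theta_dual f z (y z) j"
  let ?O = "(\<chi> i j. section_derivative y z (?e j) $ i) :: real^4^6"
  have ops: "(\<chi> i j. ops f z (y z) (\<lambda>z'. y z' $ i) $ j) = ?O"
    by (simp add: ops_eq_frechet[OF smooth_on_differentiable[OF y z]] section_derivative_def)
  have rho: "rho2_form f (z, y z) (Y, section_derivative y z Y) = 0" for Y
    using tangent[OF z] ext_deriv_Pi_on_section[OF U z y nz[OF z] zero] by (auto simp: rho2_form_def)
  have row: "(?L ** ?O) $ i $ j = - rhs_mat f z (y z) $ i $ j" for i j
  proof -
    have P: "(\<Sum>k\<in>UNIV. Pi_mat (y z) $ i $ k * da (?e j, section_derivative y z (?e j)) $ k) = - ?M $ i $ j" for i
    proof -
      have "(\<Sum>l\<in>UNIV. ?M $ i $ l * Theta f (z, y z) (?e j, section_derivative y z (?e j)) $ l) = ?M $ i $ j"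
        by (simp only: Theta_dual[OF nz[OF z]] if_distrib mult_1_right mult_zero_right sum.delta finite UNIV_I if_True
            cong: if_cong)
      then show ?thesis
        using arg_cong[OF zero[OF z, of "?e j"], of "\<lambda>v. v $ i"] by (simp add: Pi_form_nth eq_neg_iff_add_eq_0)
    qed
    have s: "(\<Sum>i\<in>UNIV. beta f z (y z) $ i * da (?e j, section_derivative y z (?e j)) $ i)
        + section_derivative y z (?e j) $ 6 = - coeff_s f z (y z) $ j"
    proof -
      have "(\<Sum>l\<in>UNIV. coeff_s f z (y z) $ l * Theta f (z, y z) (?e j, section_derivative y z (?e j)) $ l)
          = coeff_s f z (y z) $ j"
        by (simp only: Theta_dual[OF nz[OF z]] if_distrib mult_1_right mult_zero_right sum.delta finite UNIV_I if_True
            cong: if_cong)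
      then show ?thesis
        using rho2_expansion[OF U z nz[OF z], of "(?e j, section_derivative y z (?e j))"]
        by (simp add: rho eq_neg_iff_add_eq_0)
    qed
    have "\<forall>i. (?L ** ?O) $ i $ j = - rhs_mat f z (y z) $ i $ j"
      using P[of 1] P[of 2] P[of 3] P[of 4] P[of 5] s
      by (simp add: forall_6 matrix_matrix_mult_def sum_6 sum_5 lhs_mat_def rhs_mat_def Let_def append_entry_def da_nth)
    then show ?thesis ..
  qed
  have inv: "matrix_inv ?L ** ?L = mat 1"
    unfolding matrix_inv_def
    by (rule someI2_ex[OF invertible_lhs_mat[OF nz[OF z], unfolded invertible_def]]) simp
  have "?L ** ?O = - rhs_mat f z (y z)"
    using row by (simp add: vec_eq_iff)
  then have "matrix_inv ?L ** (?L ** ?O) = matrix_inv ?L ** (- rhs_mat f z (y z))"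
    by simp
  then have "?O = matrix_inv ?L ** (- rhs_mat f z (y z))"
    by (simp add: matrix_mul_assoc inv)
  also have "\<dots> = - (matrix_inv ?L ** rhs_mat f z (y z))"
    by (simp add: vec_eq_iff matrix_matrix_mult_def sum_negf)
  finally show "(\<chi> i j. ops f z (y z) (\<lambda>z'. y z' $ i) $ j) = - (matrix_inv ?L ** rhs_mat f z (y z))"
    using ops by simp
qed

section \<open>A linearizable equation satisfies all steps\<close>

context linearized_ode
begin

lemma y_smooth: "smooth_on U (\<lambda>z. y z $ i)"
proof -
  have "\<forall>i. smooth_on U (\<lambda>z. y z $ i)" by (simp add: forall_6)
  then show ?thesis ..
qed

lemma section_derivative_y:
  "z \<in> U \<Longrightarrow> section_derivative y z Y =
     Y $ 1 *\<^sub>R vector [Dhat f a1 z, Dhat f a2 z, Dhat f a3 z, Dhat f a7 z, Dhat f a8 z, Dhat f r2 z]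
   + (Y $ 2 - z $ 3 * Y $ 1) *\<^sub>R vector [pd 2 a1 z, pd 2 a2 z, pd 2 a3 z, pd 2 a7 z, pd 2 a8 z, pd 2 r2 z]
   + (Y $ 3 - z $ 4 * Y $ 1) *\<^sub>R vector [pd 3 a1 z, pd 3 a2 z, pd 3 a3 z, pd 3 a7 z, pd 3 a8 z, pd 3 r2 z]
   + (Y $ 4 - f z * Y $ 1) *\<^sub>R vector [pd 4 a1 z, pd 4 a2 z, pd 4 a3 z, pd 4 a7 z, pd 4 a8 z, pd 4 r2 z]"
  by (simp add: vec_eq_iff forall_6 section_derivative_def frechet_derivative_frame[of _ _ _ f])

lemma jet_frame: "Y = Y $ 1 *\<^sub>R jet_vector f z + (Y $ 2 - z $ 3 * Y $ 1) *\<^sub>R axis 2 1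
    + (Y $ 3 - z $ 4 * Y $ 1) *\<^sub>R axis 3 1 + (Y $ 4 - f z * Y $ 1) *\<^sub>R axis 4 1"
  by (simp add: vec_eq_iff forall_4 jet_vector_def axis_nth)

lemma Pi_form_section:
  assumes z: "z \<in> U"
  shows "Pi_form f (z, y z) (Y, section_derivative y z Y) = 0"
proof -
  have "Pi_form f (z, y z) (Y, section_derivative y z Y) $ i = 0" for i
  proof -
    interpret linear "\<lambda>Y. Pi_form f (z, y z) Y $ i" by (rule linear_Pi_form)
    have "(Y, section_derivative y z Y) =
        Y $ 1 *\<^sub>R (jet_vector f z, vector [Dhat f a1 z, Dhat f a2 z, Dhat f a3 z, Dhat f a7 z, Dhat f a8 z, Dhat f r2 z])
      + (Y $ 2 - z $ 3 * Y $ 1) *\<^sub>R (axis 2 1, vector [pd 2 a1 z, pd 2 a2 z, pd 2 a3 z, pd 2 a7 z, pd 2 a8 z, pd 2 r2 z])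
      + (Y $ 3 - z $ 4 * Y $ 1) *\<^sub>R (axis 3 1, vector [pd 3 a1 z, pd 3 a2 z, pd 3 a3 z, pd 3 a7 z, pd 3 a8 z, pd 3 r2 z])
      + (Y $ 4 - f z * Y $ 1) *\<^sub>R (axis 4 1, vector [pd 4 a1 z, pd 4 a2 z, pd 4 a3 z, pd 4 a7 z, pd 4 a8 z, pd 4 r2 z])"
      using jet_frame[of Y z] by (simp add: section_derivative_y[OF z])
    then show ?thesis
      by (simp only: add scale Pi_form_D[OF z] Pi_form_u[OF z] Pi_form_p[OF z] Pi_form_q[OF z]) simp
  qed
  then show ?thesis by (simp add: vec_eq_iff)
qed

text \<open>\<open>D_r2\<close> in the form in which \<open>I\<^sub>5\<close> and \<open>I\<^sub>6\<close> collect the derivatives of the invariants.\<close>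

lemma D_r2_invariants:
  assumes "z \<in> U"
  shows "Dhat f r2 z =
      (1/3) * I1 f z * r2 z + (a2 z)^2 * a7 z / (2 * (a1 z)^2 * a3 z)
      - (a2 z)^2 * a8 z / (3 * (a1 z)^2 * a3 z) * I1 f z
      + (a2 z)^2 / (12 * a1 z * (a3 z)^2) * pd 4 (I1 f) z
      - a3 z * a8 z / (2 * (a1 z)^2) * Dhat f (I2 f) z
      + a3 z * a7 z / (a1 z)^2 * ((1/2) * I2 f z - (1/3) * Dhat f (I1 f) z)
      + 2 * a2 z * a8 z / (3 * (a1 z)^2) * Dhat f (I1 f) z
      - 1 / a1 z * I5 f z + a2 z / (a1 z * a3 z) * I6 f z"
  using a1_nz[OF assms] a3_nz[OF assms] by (simp add: D_r2[OF assms] I5_def I6_def field_simps power2_eq_square)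

lemma d_theta4_tangent:
  assumes z: "z \<in> U"
  shows "d_theta4 f (z, y z) = ((a3 z / a1 z) *\<^sub>R jet_vector f z, section_derivative y z ((a3 z / a1 z) *\<^sub>R jet_vector f z))"
  using a1_nz[OF z] a3_nz[OF z]
  by (simp add: d_theta4_def Let_def jet_vector_def section_derivative_y[OF z] vec_eq_iff forall_6
        D_derivs[OF z] D_a2[OF z] D_a7[OF z] D_a8[OF z] D_r2_invariants[OF z])
     (simp add: field_simps power2_eq_square power3_eq_cube)

lemma full_auxiliary_system_y: "full_auxiliary_system f U y"
  using d_theta4_tangent by (intro full_auxiliary_systemI open_U smooth_f y_smooth Pi_form_section) auto

text \<open>The equations for \<open>v\<close> and \<open>w = Dv\<close> are those for \<open>a\<^sub>1\<close> and \<open>a\<^sub>2\<close>, rewritten by means of \<open>v\<^sup>2 a\<^sub>1 = 1\<close>.\<close>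

lemma linearization_steps:
  assumes pos: "\<And>z. z \<in> U \<Longrightarrow> a1 z > 0" and v: "\<And>z. z \<in> U \<Longrightarrow> v z = 1 / sqrt (a1 z)"
  shows "linearization_steps f U v (Dhat f v) a1 a2 a3 a7 a8 r2 eta chi \<phi> \<psi>"
proof -
  have smooth_v [simp]: "smooth_on U v"
    by (rule smooth_on_cong[OF open_U _ v], intro smooth_on_intros smooth_on_sqrt open_U)
       (auto simp: pos less_imp_neq[OF pos, THEN not_sym])
  have v_nz [simp]: "v z \<noteq> 0" and va1: "(v z)\<^sup>2 * a1 z = 1" if "z \<in> U" for z
    using pos[OF that] by (simp_all add: v[OF that] power_divide)
  have D_v: "Dhat f v z = - (v z * a2 z / (2 * a3 z))" if z: "z \<in> U" for z
  proof -
    have "Dhat f (\<lambda>z. (v z)\<^sup>2 * a1 z) z = Dhat f (\<lambda>_. 1) z"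
      using va1 z by (intro D_eq)
    then have "2 * v z * (a1 z * Dhat f v z) + v z * v z * a1 z * (a2 z / a3 z) = 0"
      using z by (simp add: Dhat_rules D_a1 power2_eq_square algebra_simps)
    then have "v z * a1 z * (2 * Dhat f v z + v z * a2 z / a3 z) = 0"
      by (simp add: algebra_simps)
    then have "2 * Dhat f v z + v z * a2 z / a3 z = 0"
      using z by simp
    then show ?thesis by simp
  qed
  have p_v: "pd 3 v z = - (v z * pd 3 a1 z / (2 * a1 z))" if z: "z \<in> U" for z
  proof -
    have "pd 3 (\<lambda>z. (v z)\<^sup>2 * a1 z) z = pd 3 (\<lambda>_. 1) z"
      using va1 z by (intro pd_eq)
    then have "v z * (2 * a1 z * pd 3 v z + v z * pd 3 a1 z) = 0"
      using z by (simp add: pd_rules power2_eq_square algebra_simps)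
    then have "2 * a1 z * pd 3 v z + v z * pd 3 a1 z = 0"
      using z by simp
    then show ?thesis
      using a1_nz[OF z] by (simp add: field_simps add_eq_0_iff)
  qed
  have D_w: "Dhat f (Dhat f v) z + (1/3) * I1 f z * Dhat f v z = - (1/4) * I2 f z * v z" if z: "z \<in> U" for z
  proof -
    have "Dhat f (Dhat f v) z = Dhat f (\<lambda>z. - (v z * a2 z / (2 * a3 z))) z"
      using D_v z by (intro D_eq)
    then show ?thesis
      using z a3_nz[OF z] by (simp add: Dhat_rules D_v D_a2 D_a3) (simp add: field_simps power2_eq_square)
  qed
  have step2: "v z * pd 3 a3 z + (2 * Dhat f v z - (1/3) * v z * I1 f z) * pd 4 a3 z
        = ((1/6) * v z * pd 4 (I1 f) z - 2 * pd 3 v z) * a3 z" if z: "z \<in> U" for z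
    using a1_nz[OF z] a3_nz[OF z]
    by (simp add: D_v[OF z] p_v[OF z] p_a1[OF z] p_a3[OF z] q_a3[OF z]) (simp add: field_simps power2_eq_square)
  have step3: "a1 z = 1 / (v z)\<^sup>2 \<and> a2 z = - 2 * a3 z * (Dhat f v z / v z)" if z: "z \<in> U" for z
    using va1[OF z] v_nz[OF z] a3_nz[OF z] by (simp add: D_v[OF z] field_simps)
  have x_psi: "pd 1 \<psi> z = chi z * pd 1 \<phi> z - z $ 3 * a1 z" if z: "z \<in> U" for z
    using contact_D[OF z] by (simp add: Dhat_def total2_def q_phi[OF z] q_psi[OF z] contact_p[OF z] u_psi[OF z]
        a7_eq[OF z] algebra_simps)
  have y: "(\<lambda>z. vector [a1 z, a2 z, a3 z, a7 z, a8 z, r2 z]) = y"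
    by (simp add: y_def)
  show ?thesis
    unfolding linearization_steps_def y
  proof (intro conjI ballI full_auxiliary_system_y)
    fix z assume z: "z \<in> U"
    show "a7 z = pd 3 (\<lambda>z. a1 z / a3 z) z - Dhat f a8 z" "a8 z = pd 4 (\<lambda>z. a1 z / a3 z) z"
      by (simp_all add: p_E q_E z)
    show "eta z = Dhat f chi z / Dhat f \<phi> z" "chi z = Dhat f \<psi> z / Dhat f \<phi> z"
      using D_phi_nz[OF z] by (simp_all add: eta_def contact_D z)
    show "r2 z = a3 z / (a1 z)^2 *
      (- (1/3) * I1 f z * a7 z + (2/3) * (a2 z * a8 z / a3 z) * I1 f z
       - (1/6) * (a1 z * a2 z / (a3 z)^2) * pd 4 (I1 f) z - Dhat f a7 z)"
      by (simp add: r2_def)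
    show "a7 z * Dhat f \<psi> z = a1 z / a3 z * (pd 2 \<psi> z - a1 z)"
      by (simp add: D_psi u_psi z)
    show "Dhat f a3 z = 1 / 3 * I1 f z * a3 z" by (simp add: D_a3 z)
  qed (use step2 step3 D_w x_psi in \<open>auto simp: D_r2_invariants D_eta u_eta p_eta q_eta D_chi u_chi p_chi
        D_phi a7_eq a8_eq p_psi\<close>)
qed

end

section \<open>Functions produced by the steps linearize the equation\<close>

lemma matrix_frechet_vector_3:
  assumes "g differentiable (at m)" "h differentiable (at m)" "k differentiable (at m)"
  shows "matrix (frechet_derivative (\<lambda>m. vector [g m, h m, k m] :: real^3) (at m)) $ i $ j
    = (vector [pd j g m, pd j h m, pd j k m] :: real^3) $ i"
proof -
  have "((\<lambda>m. vector [g m, h m, k m] :: real^3) has_derivative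
      (\<lambda>Y. vector [frechet_derivative g (at m) Y, frechet_derivative h (at m) Y, frechet_derivative k (at m) Y])) (at m)"
  proof (rule has_derivative_vec_nth)
    fix i :: 3
    show "((\<lambda>x. (vector [g x, h x, k x] :: real^3) $ i) has_derivative (\<lambda>Y. (vector [frechet_derivative g (at m) Y,
        frechet_derivative h (at m) Y, frechet_derivative k (at m) Y] :: real^3) $ i)) (at m)"
      using exhaust_3[of i] assms by (auto simp: has_derivative_frechet)
  qed
  from frechet_derivative_at[OF this, symmetric] show ?thesis
    by (simp add: matrix_def pd_def)
qed

lemma total2_Dhat: "total2 g z r = Dhat f g z + (r - f z) * pd 4 g z"
  by (simp add: Dhat_def total2_def algebra_simps)

text \<open>
  The equations for \<open>\<eta>\<close>, \<open>\<chi>\<close>, \<open>\<phi>\<close>, \<open>\<psi>\<close> give the derivatives from which the contact condition, the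
  Jacobian determinant \<open>a\<^sub>1\<^sup>2\<close> and the prolongation are read off. The expression for \<open>\<psi>\<^sub>u\<close> comes from the
  equation with factor \<open>a\<^sub>7\<close> after division by \<open>D\<phi> = a\<^sub>1 / a\<^sub>3\<close>.
\<close>

lemma linearization_procedure_linearizes:
  assumes U: "open U" and proc: "linearization_procedure f U v w a1 a2 a3 a7 a8 r2 \<eta> chi \<phi> \<psi>"
  shows "linearizing_contact_transformation U f \<phi> \<psi> chi"
proof -
  have sm: "smooth_on (proj ` U) \<phi>" "smooth_on (proj ` U) \<psi>" "smooth_on (proj ` U) chi"
    and steps: "linearization_steps f U (lift v) w (lift a1) a2 a3 (lift a7) (lift a8) r2 \<eta> (lift chi) (lift \<phi>) (lift \<psi>)"
    using proc by (auto simp: linearization_procedure_def)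
  have diff: "\<phi> differentiable (at (proj z))" "\<psi> differentiable (at (proj z))" "chi differentiable (at (proj z))"
    if "z \<in> U" for z
    using sm that smooth_on_differentiable by blast+
  have total1: "total1 \<phi> z = Dhat f (lift \<phi>) z" "total1 \<psi> z = Dhat f (lift \<psi>) z" "total1 chi z = Dhat f (lift chi) z"
    if "z \<in> U" for z
    using diff[OF that] by (simp_all add: total1_eq_Dhat_lift)
  note lift = pd_lift_1 pd_lift_2 pd_lift_3
  have vals: "a1 (proj z) \<noteq> 0" "a3 z \<noteq> 0" "total1 \<phi> z = a1 (proj z) / a3 z"
      "total1 chi z = a1 (proj z) / a3 z * \<eta> z"
      "pd 2 \<phi> (proj z) = a7 (proj z)" "pd 3 \<phi> (proj z) = a8 (proj z)"
      "pd 2 chi (proj z) = a2 z + a7 (proj z) * \<eta> z" "pd 3 chi (proj z) = a3 z + a8 (proj z) * \<eta> z"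
      "pd 3 \<psi> (proj z) = a8 (proj z) * chi (proj z)"
      "pd 1 \<psi> (proj z) = chi (proj z) * pd 1 \<phi> (proj z) - z $ 3 * a1 (proj z)"
      "pd 2 \<psi> (proj z) = a1 (proj z) + chi (proj z) * a7 (proj z)"
      "Dhat f \<eta> z = 0" "pd 4 \<eta> z = (a3 z)\<^sup>2 / a1 (proj z)" "\<eta> z = total1 chi z / total1 \<phi> z"
    if z: "z \<in> U" for z
  proof -
    note d = diff[OF z]
    have s: "lift v z \<noteq> 0" "a3 z \<noteq> 0" "lift a1 z = 1 / (lift v z)\<^sup>2"
        "Dhat f \<eta> z = 0" "pd 4 \<eta> z = (a3 z)\<^sup>2 / lift a1 z"
        "Dhat f (lift chi) z = lift a1 z / a3 z * \<eta> z"
        "pd 2 (lift chi) z = a2 z + lift a7 z * \<eta> z" "pd 3 (lift chi) z = a3 z + lift a8 z * \<eta> z"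
        "Dhat f (lift \<phi>) z = lift a1 z / a3 z" "pd 2 (lift \<phi>) z = lift a7 z" "pd 3 (lift \<phi>) z = lift a8 z"
        "lift a7 z * Dhat f (lift \<psi>) z = lift a1 z / a3 z * (pd 2 (lift \<psi>) z - lift a1 z)"
        "pd 1 (lift \<psi>) z = lift chi z * pd 1 (lift \<phi>) z - z$3 * lift a1 z"
        "pd 3 (lift \<psi>) z = lift a8 z * lift chi z"
        "lift chi z = Dhat f (lift \<psi>) z / Dhat f (lift \<phi>) z" "\<eta> z = Dhat f (lift chi) z / Dhat f (lift \<phi>) z"
      using steps[unfolded linearization_steps_def] z by blast+
    from s(1,3) have a1: "lift a1 z \<noteq> 0" by simp
    have "lift a1 z / a3 z * (pd 2 (lift \<psi>) z - lift a1 z) = lift a1 z / a3 z * (lift chi z * lift a7 z)"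
      using s(9,12,15) a1 s(2) by (simp add: mult_ac)
    then have "pd 2 (lift \<psi>) z - lift a1 z = lift chi z * lift a7 z"
      using a1 s(2) by (metis divide_eq_0_iff mult_left_cancel)
    then have "pd 2 (lift \<psi>) z = lift a1 z + lift chi z * lift a7 z"
      by simp
    then show "pd 2 \<psi> (proj z) = a1 (proj z) + chi (proj z) * a7 (proj z)"
      using d by (simp add: lift) (simp add: lift_def)
    show "a1 (proj z) \<noteq> 0" "a3 z \<noteq> 0" "total1 \<phi> z = a1 (proj z) / a3 z"
      "total1 chi z = a1 (proj z) / a3 z * \<eta> z" "Dhat f \<eta> z = 0" "pd 4 \<eta> z = (a3 z)\<^sup>2 / a1 (proj z)"
      "\<eta> z = total1 chi z / total1 \<phi> z"
      using a1 s(2,4,5,6,9,16) by (simp_all add: total1[OF z] lift_def)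
    show "pd 2 \<phi> (proj z) = a7 (proj z)" "pd 3 \<phi> (proj z) = a8 (proj z)"
      "pd 2 chi (proj z) = a2 z + a7 (proj z) * \<eta> z" "pd 3 chi (proj z) = a3 z + a8 (proj z) * \<eta> z"
      "pd 3 \<psi> (proj z) = a8 (proj z) * chi (proj z)"
      "pd 1 \<psi> (proj z) = chi (proj z) * pd 1 \<phi> (proj z) - z $ 3 * a1 (proj z)"
      using s(7,8,10,11,13,14) d by (simp_all add: lift) (simp_all add: lift_def)
  qed
  have "maps_ode_to U \<phi> \<psi> chi f (\<lambda>_. 0)"
    unfolding maps_ode_to_def
  proof (intro ballI conjI allI)
    fix z r assume z: "z \<in> U"
    show E: "total1 \<phi> z \<noteq> 0" using vals[OF z] by simp
    have "pd i (prolong_q \<phi> chi) z = pd i \<eta> z" for i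
      by (rule pd_cong[OF U z]) (simp add: prolong_q_def vals(14))
    then have "prolong_r \<phi> chi z r = total2 \<eta> z r / total1 \<phi> z"
      by (simp add: prolong_r_def total2_def)
    also have "total2 \<eta> z r = (r - f z) * ((a3 z)\<^sup>2 / a1 (proj z))"
      using vals[OF z] by (simp add: total2_Dhat[of _ _ _ f])
    finally show "r = f z \<longleftrightarrow> prolong_r \<phi> chi z r = 0"
      using E vals(1,2)[OF z] by simp
  qed
  moreover have "contact_transformation (proj ` U) \<phi> \<psi> chi"
    unfolding contact_transformation_def
  proof (intro conjI open_proj_image U sm ballI exI allI)
    fix m assume "m \<in> proj ` U"
    then obtain z where z: "z \<in> U" and m: "m = proj z" by blast
    note val = vals[OF z]
    define e where "e = a1 m / a3 z"
    have a1: "a1 m = e * a3 z" using val(2) by (simp add: e_def)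
    have \<phi>: "pd 1 \<phi> m = e - z $ 3 * a7 m - z $ 4 * a8 m" "pd 2 \<phi> m = a7 m" "pd 3 \<phi> m = a8 m"
      and chi: "pd 1 chi m = e * \<eta> z - z $ 3 * (a2 z + a7 m * \<eta> z) - z $ 4 * (a3 z + a8 m * \<eta> z)"
        "pd 2 chi m = a2 z + a7 m * \<eta> z" "pd 3 chi m = a3 z + a8 m * \<eta> z"
      and \<psi>: "pd 1 \<psi> m = chi m * pd 1 \<phi> m - z $ 3 * a1 m" "pd 2 \<psi> m = a1 m + chi m * a7 m"
        "pd 3 \<psi> m = a8 m * chi m"
      using val(3-11) by (simp_all add: total1_def m[symmetric] e_def)
    have "det (matrix (frechet_derivative (\<lambda>m. vector [\<phi> m, \<psi> m, chi m] :: real^3) (at m))) = (a1 m)\<^sup>2"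
      using diff[OF z, folded m]
      by (simp add: det_3 matrix_frechet_vector_3 \<phi> chi \<psi> a1) (simp add: algebra_simps power2_eq_square)
    then show "det (matrix (frechet_derivative (\<lambda>m. vector [\<phi> m, \<psi> m, chi m] :: real^3) (at m))) \<noteq> 0"
      using val m by simp
    show "frechet_derivative \<psi> (at m) Y - chi m * frechet_derivative \<phi> (at m) Y = a1 m * (Y $ 2 - m $ 3 * Y $ 1)" for Y
      using diff[OF z] by (simp add: frechet_derivative_pd sum_3 m val(5,6,9-11)) (simp add: algebra_simps)
  qed
  ultimately show ?thesis
    by (simp add: linearizing_contact_transformation_def)
qed

section \<open>The procedure applies to every linearizable equation\<close>

text \<open>
  If the contact factor \<open>\<psi>\<^sub>u - \<chi> \<phi>\<^sub>u\<close> vanished at a point, \<open>d\<psi>\<close> would be a multiple of \<open>d\<phi>\<close> there and the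
  Jacobian determinant would vanish.
\<close>

lemma linearizing_contact_transformation_relations:
  assumes lin: "linearizing_contact_transformation U f \<phi> \<psi> chi" and U: "open U" and z: "z \<in> U"
  shows "Dhat f (lift \<phi>) z \<noteq> 0"
    and "Dhat f (lift \<psi>) z = lift chi z * Dhat f (lift \<phi>) z"
    and "pd 3 (lift \<psi>) z = lift chi z * pd 3 (lift \<phi>) z"
    and "pd 2 \<psi> (proj z) - chi (proj z) * pd 2 \<phi> (proj z) \<noteq> 0"
    and "Dhat f (\<lambda>z. Dhat f (lift chi) z / Dhat f (lift \<phi>) z) z = 0"
proof -
  have sm: "smooth_on (proj ` U) \<phi>" "smooth_on (proj ` U) \<psi>" "smooth_on (proj ` U) chi"
    and maps: "maps_ode_to U \<phi> \<psi> chi f (\<lambda>_. 0)"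
    using lin by (auto simp: linearizing_contact_transformation_def contact_transformation_def)
  have diff: "\<phi> differentiable (at (proj z))" "\<psi> differentiable (at (proj z))" "chi differentiable (at (proj z))"
    if "z \<in> U" for z
    using sm that smooth_on_differentiable by blast+
  note lift = pd_lift_1 pd_lift_2 pd_lift_3 pd_lift_4
  have total1: "total1 \<phi> z = Dhat f (lift \<phi>) z" "total1 chi z = Dhat f (lift chi) z" if "z \<in> U" for z
    using diff[OF that] by (simp_all add: total1_eq_Dhat_lift)
  show E: "Dhat f (lift \<phi>) z \<noteq> 0"
    using maps z by (simp add: maps_ode_to_def total1)
  have "prolong_r \<phi> chi z (f z) = 0"
    using maps z unfolding maps_ode_to_def by blast
  then have "total2 (prolong_q \<phi> chi) z (f z) = 0"
    using E z by (simp add: prolong_r_def total1)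
  then have "Dhat f (prolong_q \<phi> chi) z = 0"
    by (simp add: Dhat_def)
  then show "Dhat f (\<lambda>z. Dhat f (lift chi) z / Dhat f (lift \<phi>) z) z = 0"
    using Dhat_cong[OF U z, of "prolong_q \<phi> chi" "\<lambda>z. Dhat f (lift chi) z / Dhat f (lift \<phi>) z" f]
    by (simp add: prolong_q_def total1)
  let ?m = "proj z"
  obtain l where l: "frechet_derivative \<psi> (at ?m) Y - chi ?m * frechet_derivative \<phi> (at ?m) Y
      = l * (Y $ 2 - z $ 3 * Y $ 1)" for Y
  proof -
    obtain l where "\<forall>m\<in>proj ` U. \<forall>Y. frechet_derivative \<psi> (at m) Y - chi m * frechet_derivative \<phi> (at m) Y
        = l m * (Y $ 2 - m $ 3 * Y $ 1)"
      using lin unfolding linearizing_contact_transformation_def contact_transformation_def by blast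
    then show ?thesis using z that[of "l ?m"] by simp
  qed
  have contact: "pd 1 \<psi> ?m - chi ?m * pd 1 \<phi> ?m = - l * z $ 3" "pd 2 \<psi> ?m - chi ?m * pd 2 \<phi> ?m = l"
    "pd 3 \<psi> ?m - chi ?m * pd 3 \<phi> ?m = 0"
    using l[of "axis 1 1"] l[of "axis 2 1"] l[of "axis 3 1"] by (simp_all add: pd_def axis_nth)
  then have \<psi>: "pd 1 \<psi> ?m = chi ?m * pd 1 \<phi> ?m - l * z $ 3" "pd 2 \<psi> ?m = chi ?m * pd 2 \<phi> ?m + l"
    "pd 3 \<psi> ?m = chi ?m * pd 3 \<phi> ?m"
    by simp_all
  show "Dhat f (lift \<psi>) z = lift chi z * Dhat f (lift \<phi>) z"
    "pd 3 (lift \<psi>) z = lift chi z * pd 3 (lift \<phi>) z"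
    using diff[OF z] \<psi> by (simp_all add: Dhat_def total2_def lift) (simp_all add: lift_def algebra_simps)
  show "pd 2 \<psi> ?m - chi ?m * pd 2 \<phi> ?m \<noteq> 0"
  proof
    assume "pd 2 \<psi> ?m - chi ?m * pd 2 \<phi> ?m = 0"
    then have "l = 0" using contact by simp
    then have "det (matrix (frechet_derivative (\<lambda>m. vector [\<phi> m, \<psi> m, chi m] :: real^3) (at ?m))) = 0"
      using diff[OF z] \<psi> by (simp add: det_3 matrix_frechet_vector_3 algebra_simps)
    then show False
      using lin z by (simp add: linearizing_contact_transformation_def contact_transformation_def)
  qed
qed

text \<open>
  The requirement \<open>a\<^sub>1 = 1 / v\<^sup>2\<close> forces \<open>a\<^sub>1 > 0\<close>, while the contact factor of the given transformation may be
  negative. The equation \<open>u''' = 0\<close> is invariant under \<open>u \<mapsto> - u\<close>, so \<open>(\<phi>, - \<psi>, - \<chi>)\<close> also linearizes; the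
  sign \<open>s\<close> is chosen to make the factor positive at \<open>z0\<close>, hence on a neighbourhood \<open>W\<close>.
\<close>

lemma linearizable_imp_linearization_procedure:
  assumes \<Omega>: "smooth_on \<Omega> f" and U: "open U" "z0 \<in> U" "U \<subseteq> \<Omega>"
    and lin: "linearizing_contact_transformation U f \<phi> \<psi> chi"
  shows "\<exists>U v w a1 a2 a3 a7 a8 r2 \<eta> chi \<phi> \<psi>. open U \<and> z0 \<in> U \<and> U \<subseteq> \<Omega> \<and>
            linearization_procedure f U v w a1 a2 a3 a7 a8 r2 \<eta> chi \<phi> \<psi>"
proof -
  note rel = linearizing_contact_transformation_relations[OF lin U(1)]
  have sm: "smooth_on (proj ` U) \<phi>" "smooth_on (proj ` U) \<psi>" "smooth_on (proj ` U) chi"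
    using lin by (auto simp: linearizing_contact_transformation_def contact_transformation_def)
  have V: "open (proj ` U)" by (rule open_proj_image[OF U(1)])
  define lam where "lam m = pd 2 \<psi> m - chi m * pd 2 \<phi> m" for m
  have lam: "smooth_on (proj ` U) lam"
    unfolding lam_def[abs_def] by (intro smooth_on_intros V sm)
  define s where "s = sgn (lam (proj z0))"
  have s: "s * s = 1" "s \<noteq> 0"
    using rel(4)[OF U(2)] by (auto simp: s_def lam_def sgn_if)
  define W where "W = {z \<in> U. s * lift lam z > 0}"
  have "continuous_on U (\<lambda>z. s * lift lam z)"
    using smooth_on_differentiable[OF smooth_on_lift[OF U(1) lam]]
    by (intro continuous_intros continuous_at_imp_continuous_on ballI differentiable_imp_continuous_within) auto
  then have W: "open W"
    using continuous_open_preimage[OF _ U(1) open_greaterThan[of 0], of "\<lambda>z. s * lift lam z"]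
    by (auto simp: W_def vimage_def Int_def)
  have z0: "z0 \<in> W"
    using U(2) rel(4)[OF U(2)] by (simp add: W_def s_def lift_def lam_def sgn_if)
  have WU: "W \<subseteq> U" by (auto simp: W_def)
  then have PW: "proj ` W \<subseteq> proj ` U" by blast
  have oW: "open (proj ` W)" by (rule open_proj_image[OF W])
  note smW = smooth_on_subset[OF _ PW]
  define \<psi>' where "\<psi>' m = s * \<psi> m" for m
  define chi' where "chi' m = s * chi m" for m
  define a1 where "a1 m = s * lam m" for m
  have sm': "smooth_on (proj ` W) \<psi>'" "smooth_on (proj ` W) chi'" "smooth_on (proj ` W) a1"
    "smooth_on (proj ` W) \<phi>"
    unfolding \<psi>'_def[abs_def] chi'_def[abs_def] a1_def[abs_def]
    by (intro smooth_on_mult smooth_on_const oW smW sm lam)+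
  have diff: "\<phi> differentiable (at (proj z))" "\<psi> differentiable (at (proj z))" "chi differentiable (at (proj z))"
    if "z \<in> W" for z
    using sm that smooth_on_differentiable WU by blast+
  have diff4: "lift g differentiable (at z)" if "smooth_on (proj ` U) g" "z \<in> W" for g z
    using smooth_on_differentiable[OF smooth_on_lift[OF U(1) that(1)]] WU that(2) by blast
  have scaled: "lift \<psi>' = (\<lambda>z. s * lift \<psi> z)" "lift chi' = (\<lambda>z. s * lift chi z)"
    by (simp_all add: fun_eq_iff lift_def \<psi>'_def chi'_def)
  have D_scaled: "Dhat f (lift \<psi>') z = s * Dhat f (lift \<psi>) z" "Dhat f (lift chi') z = s * Dhat f (lift chi) z"
    "pd i (lift \<psi>') z = s * pd i (lift \<psi>) z" if "z \<in> W" for z i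
    using diff4[OF _ that] sm by (simp_all add: scaled Dhat_mult pd_mult)
  note lift_pd = pd_lift_1 pd_lift_2 pd_lift_3 pd_lift_4
  have a1_pos: "lift a1 z > 0" if "z \<in> W" for z
    using that by (simp add: W_def a1_def lift_def)
  have a1: "lift a1 z = pd 2 (lift \<psi>') z - lift chi' z * pd 2 (lift \<phi>) z" if "z \<in> W" for z
    using diff[OF that] by (simp add: D_scaled(3)[OF that] lift_pd) (simp add: lift_def chi'_def a1_def lam_def algebra_simps)
  interpret L: linearized_ode f "lift \<phi>" "lift \<psi>'" "lift chi'" "lift a1" "lift (pd 2 \<phi>)" "lift (pd 3 \<phi>)" W
  proof
    show "open W" by (rule W)
    show "smooth_on W f" using \<Omega> WU U(3) by (meson smooth_on_subset subset_trans)
    show "smooth_on W (lift \<phi>)" "smooth_on W (lift \<psi>')" "smooth_on W (lift chi')"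
      by (intro smooth_on_lift W sm')+
    fix z assume z: "z \<in> W"
    then have zU: "z \<in> U" using WU by blast
    have dW: "g differentiable (at (proj z))" if "smooth_on (proj ` W) g" for g
      using smooth_on_differentiable[OF that] z by blast
    show "pd 4 (lift \<phi>) z = 0" "pd 4 (lift \<psi>') z = 0" "pd 4 (lift chi') z = 0"
      by (rule pd_lift_4[OF dW], rule sm')+
    show "Dhat f (lift \<psi>') z = lift chi' z * Dhat f (lift \<phi>) z"
      "pd 3 (lift \<psi>') z = lift chi' z * pd 3 (lift \<phi>) z"
      using rel(2,3)[OF zU] by (simp_all add: D_scaled[OF z] fun_cong[OF scaled(2)])
    show "pd 2 (lift \<psi>') z - lift chi' z * pd 2 (lift \<phi>) z \<noteq> 0"
      using a1[OF z] a1_pos[OF z] by simp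
    show "Dhat f (lift \<phi>) z \<noteq> 0" by (rule rel(1)[OF zU])
    show "lift a1 z = pd 2 (lift \<psi>') z - lift chi' z * pd 2 (lift \<phi>) z" by (rule a1[OF z])
    show "lift (pd 2 \<phi>) z = pd 2 (lift \<phi>) z" "lift (pd 3 \<phi>) z = pd 3 (lift \<phi>) z"
      using diff(1)[OF z] by (simp_all add: lift_pd) (simp_all add: lift_def)
    have "Dhat f (\<lambda>z. Dhat f (lift chi') z / Dhat f (lift \<phi>) z) z
        = Dhat f (\<lambda>z. s * (Dhat f (lift chi) z / Dhat f (lift \<phi>) z)) z"
      by (rule Dhat_cong[OF W z]) (simp add: D_scaled)
    also have "\<dots> = s * Dhat f (\<lambda>z. Dhat f (lift chi) z / Dhat f (lift \<phi>) z) z"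
    proof (subst Dhat_mult)
      have f: "smooth_on U f" using \<Omega> U(3) by (rule smooth_on_subset)
      have "smooth_on U (\<lambda>z. Dhat f (lift chi) z / Dhat f (lift \<phi>) z)"
        by (intro smooth_on_intros smooth_on_Dhat smooth_on_lift U(1) sm f rel(1))
      then show "(\<lambda>z. Dhat f (lift chi) z / Dhat f (lift \<phi>) z) differentiable (at z)"
        using zU by (rule smooth_on_differentiable)
    qed simp_all
    finally show "Dhat f (\<lambda>z. Dhat f (lift chi') z / Dhat f (lift \<phi>) z) z = 0"
      using rel(5)[OF zU] by simp
  qed
  define v where "v m = 1 / sqrt (a1 m)" for m
  have v: "smooth_on (proj ` W) v"
    unfolding v_def[abs_def] using a1_pos
    by (intro smooth_on_intros smooth_on_sqrt oW sm') (auto simp: lift_def less_imp_neq[THEN not_sym])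
  have "linearization_procedure f W v (Dhat f (lift v)) a1 L.a2 L.a3 (pd 2 \<phi>) (pd 3 \<phi>) L.r2 L.eta chi' \<phi> \<psi>'"
    unfolding linearization_procedure_def
  proof (intro conjI)
    show "\<forall>g\<in>{v, a1, pd 2 \<phi>, pd 3 \<phi>, chi', \<phi>, \<psi>'}. smooth_on (proj ` W) g"
      using v sm' smooth_on_pd by blast
    show "\<forall>g\<in>{Dhat f (lift v), L.a2, L.a3, L.r2, L.eta}. smooth_on W g"
      using L.smooth_coefficients L.smooth_Dhat[OF smooth_on_lift[OF W v]] by blast
    show "linearization_steps f W (lift v) (Dhat f (lift v)) (lift a1) L.a2 L.a3 (lift (pd 2 \<phi>)) (lift (pd 3 \<phi>))
        L.r2 L.eta (lift chi') (lift \<phi>) (lift \<psi>')"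
      using a1_pos by (intro L.linearization_steps) (simp_all add: lift_def v_def)
  qed
  then show ?thesis
    using W z0 WU U(3) by blast
qed

theorem theorem3p1:
  fixes f :: "real^4 \<Rightarrow> real" and \<Omega> :: "(real^4) set" and z0 :: "real^4"
  assumes "open \<Omega>" and "z0 \<in> \<Omega>" and "smooth_on \<Omega> f"
    and equivalent: "\<exists>U \<phi> \<psi> chi. open U \<and> z0 \<in> U \<and> U \<subseteq> \<Omega> \<and>
           linearizing_contact_transformation U f \<phi> \<psi> chi"
  shows "(\<exists>U v w a1 a2 a3 a7 a8 r2 \<eta> chi \<phi> \<psi>. open U \<and> z0 \<in> U \<and> U \<subseteq> \<Omega> \<and>
            linearization_procedure f U v w a1 a2 a3 a7 a8 r2 \<eta> chi \<phi> \<psi>) \<and>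
         (\<forall>U v w a1 a2 a3 a7 a8 r2 \<eta> chi \<phi> \<psi>. open U \<and> z0 \<in> U \<and> U \<subseteq> \<Omega> \<and>
            linearization_procedure f U v w a1 a2 a3 a7 a8 r2 \<eta> chi \<phi> \<psi> \<longrightarrow>
            linearizing_contact_transformation U f \<phi> \<psi> chi)"
proof (intro conjI allI impI)
  show "\<exists>U v w a1 a2 a3 a7 a8 r2 \<eta> chi \<phi> \<psi>. open U \<and> z0 \<in> U \<and> U \<subseteq> \<Omega> \<and>
            linearization_procedure f U v w a1 a2 a3 a7 a8 r2 \<eta> chi \<phi> \<psi>"
  proof -
    obtain U \<phi> \<psi> chi where U: "open U" "z0 \<in> U" "U \<subseteq> \<Omega>" "linearizing_contact_transformation U f \<phi> \<psi> chi"
      using equivalent by blast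
    show ?thesis by (rule linearizable_imp_linearization_procedure[OF assms(3) U])
  qed
next
  fix U v w a1 a2 a3 a7 a8 r2 \<eta> chi \<phi> \<psi>
  assume "open U \<and> z0 \<in> U \<and> U \<subseteq> \<Omega> \<and> linearization_procedure f U v w a1 a2 a3 a7 a8 r2 \<eta> chi \<phi> \<psi>"
  then show "linearizing_contact_transformation U f \<phi> \<psi> chi"
    using linearization_procedure_linearizes by (elim conjE)
qed

end
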